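(* Let $C_n$ be the vertex set of a convex $n$-gon, $C_n^*$ its dual pseudoline arrangement, and $C_n^{*k}$ the support of $C_n^*$ minus its first $k$ levels. Then: (i) For every $k$-triangulation $T$ of the $n$-gon, the dual arrangement $T^*:=\{S^*\mid S\text{ a }k\text{-star of }T\}$ is a pseudoline arrangement (with contact points) supported by $C_n^{*k}$. (ii) For every pseudoline arrangement $\Lambda$ (with contact points) supported by $C_n^{*k}$, the primal set of edges $E:=\{[p,q]\mid p,q\in C_n,\ p^*\wedge q^*\text{ is a contact point of }\Lambda\}$ is a $k$-triangulation of the $n$-gon.
   Context: The space of lines of the plane is the Möbius strip $\mathcal M=\mathbb R^2/(\theta,d)\sim(\theta+\pi,-d)$ (angle $\theta$, signed distance $d$ to the origin). For a point $p$, $p^*$ is the set of lines through $p$, a pseudoline of $\mathcal M$; $C_n^*=\{p^*\mid p\in C_n\}$ is a simple pseudoline arrangement, $p^*\wedge q^*$ denoting the unique crossing point (the line $(pq)$). A pseudoline arrangement with contact points is a finite set of pseudolines any two of which have exactly one crossing point and possibly contact points (touching without crossing); its support is the union of its pseudolines; "supported by $\mathcal S$" means having support $\mathcal S$. The first level of an arrangement is the boundary of the external face of the complement of its support; the $j$th level is inductively the first level of the support minus its first $j-1$ levels; $C_n^{*k}$ is the support minus its first $k$ levels. An $\ell$-crossing is a set of $\ell$ mutually crossing edges of $C_n$. A $k$-triangulation of the $n$-gon is a maximal set of edges of $C_n$ containing no $(k+1)$-crossing. A $k$-star is a set of edges $\{s_js_{j+k}\mid j\in\mathbb Z_{2k+1}\}$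 where $s_0,\dots,s_{2k}$ are points of $C_n$ in cyclic order; a $k$-star of $T$ is one all of whose edges lie in $T$. A bisector of a $k$-star is a line through a vertex $s_j$ that separates $s_{j-k}$ and $s_{j+k}$ (bisector of the angle $s_{j-k}s_js_{j+k}$); $S^*\subset\mathcal M$ is the set of all bisectors of $S$.
   Formalization: In (ii), E is completed by the edges with fewer than k points of C_n on one side, which lie in every k-triangulation but never give contact points (n=3, k=1: E is empty). Bisectors include the lines along star edges; removing a level keeps the vertices where remaining arcs end. *)

theory Defs
  imports "HOL-Analysis.Analysis"
begin

section \<open>The space of lines of the plane\<close>

text \<open>The plane is \<^typ>\<open>complex\<close>. The line with direction angle \<open>\<theta>\<close> and signed distance \<open>d\<close> to the
  origin is the level set at height \<open>d\<close> of the inner product with the unit normal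
  \<open>(-sin \<theta>, cos \<theta>)\<close>.\<close>

definition unit_normal :: "real \<Rightarrow> complex" where
  "unit_normal \<theta> = \<i> * cis \<theta>"

definition line_points :: "real \<Rightarrow> real \<Rightarrow> complex set" where
  "line_points \<theta> d = {z. unit_normal \<theta> \<bullet> z = d}"

typedef line = "range (case_prod line_points)"
  morphisms points_on Abs_line
  by blast

definition mk_line :: "real \<Rightarrow> real \<Rightarrow> line" where
  "mk_line \<theta> d = Abs_line (line_points \<theta> d)"

lemma points_on_mk_line [simp]: "points_on (mk_line \<theta> d) = line_points \<theta> d"
  unfolding mk_line_def by (rule Abs_line_inverse) (auto intro: image_eqI[where x = "(\<theta>, d)"])

lemma line_exhaust: obtains \<theta> d where "l = mk_line \<theta> d"
  by (cases l) (auto simp: mk_line_def)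

text \<open>The fibres of \<^const>\<open>mk_line\<close> are the classes of the equivalence relation generated by
  \<open>(\<theta>, d) ~ (\<theta> + \<pi>, -d)\<close> (see \<open>mk_line_eq_iff\<close> below). With the quotient topology
  from the plane of parameters, \<^typ>\<open>line\<close> is therefore the Moebius strip.\<close>

instantiation line :: topological_space
begin

definition open_line :: "line set \<Rightarrow> bool" where
  "open_line U \<longleftrightarrow> open (case_prod mk_line -` U :: (real \<times> real) set)"

instance
proof
  show "open (UNIV :: line set)"
    by (simp add: open_line_def)
  show "open (U \<inter> V)" if "open U" "open V" for U V :: "line set"
    using that by (simp add: open_line_def open_Int)
  show "open (\<Union>K)" if "\<forall>U\<in>K. open U" for K :: "line set set"
    using that by (auto simp: open_line_def vimage_Union)
qed

end

lemma unit_normal_inner: "unit_normal \<theta> \<bullet> z = cos \<theta> * Im z - sin \<theta> * Re z"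
  by (simp add: unit_normal_def inner_complex_def)

lemma cos_int_mult_pi: "cos (of_int m * pi) = (if even m then 1 else -1)" for m :: int
  by (cases m rule: int_cases2) (simp_all add: cos_npi)

lemma mk_line_eq_iff:
  "mk_line \<theta> d = mk_line \<theta>' d' \<longleftrightarrow>
     (\<exists>m::int. \<theta>' = \<theta> + of_int m * pi \<and> d' = (if even m then d else - d))"
proof
  assume "mk_line \<theta> d = mk_line \<theta>' d'"
  then have eq: "line_points \<theta> d = line_points \<theta>' d'"
    by (metis points_on_mk_line)
  have mem: "cos \<theta>' * y - sin \<theta>' * x = d'" if "cos \<theta> * y - sin \<theta> * x = d" for x y
  proof -
    have "Complex x y \<in> line_points \<theta> d"
      using that by (simp add: line_points_def unit_normal_inner)
    then show ?thesis
      unfolding eq by (simp add: line_points_def unit_normal_inner)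
  qed
  have sq: "d * (sin \<theta> * sin \<theta>) + d * (cos \<theta> * cos \<theta>) = d"
    by (metis distrib_left mult.right_neutral power2_eq_square sin_cos_squared_add)
  have a0: "cos \<theta>' * (d * cos \<theta>) - sin \<theta>' * (- d * sin \<theta>) = d'"
    by (rule mem) (use sq in \<open>simp add: algebra_simps\<close>)
  have a1: "cos \<theta>' * (sin \<theta> + d * cos \<theta>) - sin \<theta>' * (cos \<theta> - d * sin \<theta>) = d'"
    by (rule mem) (use sq in \<open>simp add: algebra_simps\<close>)
  have "sin (\<theta>' - \<theta>) = 0"
    using a0 a1 by (simp add: sin_diff algebra_simps)
  then obtain m :: int where m: "\<theta>' - \<theta> = of_int m * pi"
    by (auto simp: sin_zero_iff_int2)
  have "d' = d * cos (\<theta>' - \<theta>)"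
    using a0 by (simp add: cos_diff algebra_simps)
  also have "cos (\<theta>' - \<theta>) = (if even m then 1 else -1)"
    unfolding m by (rule cos_int_mult_pi)
  finally have "d' = (if even m then d else - d)"
    by simp
  with m show "\<exists>m::int. \<theta>' = \<theta> + of_int m * pi \<and> d' = (if even m then d else - d)"
    by (intro exI[of _ m]) linarith
next
  assume "\<exists>m::int. \<theta>' = \<theta> + of_int m * pi \<and> d' = (if even m then d else - d)"
  then obtain m :: int where m: "\<theta>' = \<theta> + of_int m * pi" "d' = (if even m then d else - d)"
    by blast
  have sc: "sin (of_int m * pi) = 0" "cos (of_int m * pi) = (if even m then 1 else -1)"
    by (simp_all add: sin_zero_iff_int2 cos_int_mult_pi)
  have "unit_normal \<theta>' \<bullet> z = (if even m then 1 else -1) * (unit_normal \<theta> \<bullet> z)" for z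
    unfolding m(1) unit_normal_inner cos_add sin_add sc by (simp add: algebra_simps)
  then show "mk_line \<theta> d = mk_line \<theta>' d'"
    unfolding mk_line_def line_points_def m(2) by auto
qed

section \<open>Pseudoline arrangements with contact points\<close>

text \<open>Pseudolines are projections to the Moebius strip of graphs of continuous
  \<open>\<pi>\<close>-antiperiodic functions; the function is determined by the pseudoline.\<close>

definition represents :: "(real \<Rightarrow> real) \<Rightarrow> line set \<Rightarrow> bool" where
  "represents f L \<longleftrightarrow> continuous_on UNIV f \<and> (\<forall>x. f (x + pi) = - f x) \<and>
     L = range (\<lambda>x. mk_line x (f x))"

definition pseudoline :: "line set \<Rightarrow> bool" where
  "pseudoline L \<longleftrightarrow> (\<exists>f. represents f L)"

definition crossing_point :: "line set \<Rightarrow> line set \<Rightarrow> line \<Rightarrow> bool" where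
  "crossing_point L M P \<longleftrightarrow>
     (\<exists>f g x. represents f L \<and> represents g M \<and> P = mk_line x (f x) \<and> f x = g x \<and>
       (\<exists>\<epsilon>>0. \<forall>y\<in>{x - \<epsilon><..<x}. \<forall>z\<in>{x<..<x + \<epsilon>}. (f y - g y) * (f z - g z) < 0))"

definition contact_point :: "line set \<Rightarrow> line set \<Rightarrow> line \<Rightarrow> bool" where
  "contact_point L M P \<longleftrightarrow>
     (\<exists>f g x. represents f L \<and> represents g M \<and> P = mk_line x (f x) \<and> f x = g x \<and>
       (\<exists>\<epsilon>>0. \<forall>y\<in>{x - \<epsilon><..<x}. \<forall>z\<in>{x<..<x + \<epsilon>}. (f y - g y) * (f z - g z) > 0))"

text \<open>Only used when there is exactly one crossing point.\<close>

definition wedge :: "line set \<Rightarrow> line set \<Rightarrow> line" where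
  "wedge L M = (THE P. crossing_point L M P)"

text \<open>The last conjunct excludes overlaps: two pseudolines meet only at isolated points.\<close>

definition pseudoline_arrangement :: "line set set \<Rightarrow> bool" where
  "pseudoline_arrangement \<Lambda> \<longleftrightarrow> finite \<Lambda> \<and> (\<forall>L\<in>\<Lambda>. pseudoline L) \<and>
     (\<forall>L\<in>\<Lambda>. \<forall>M\<in>\<Lambda>. L \<noteq> M \<longrightarrow>
        (\<exists>!P. crossing_point L M P) \<and>
        (\<forall>P\<in>L \<inter> M. crossing_point L M P \<or> contact_point L M P))"

definition support :: "line set set \<Rightarrow> line set" where
  "support \<Lambda> = \<Union>\<Lambda>"

definition arrangement_contact_point :: "line set set \<Rightarrow> line \<Rightarrow> bool" where
  "arrangement_contact_point \<Lambda> P \<longleftrightarrow> (\<exists>L\<in>\<Lambda>. \<exists>M\<in>\<Lambda>. L \<noteq> M \<and> contact_point L M P)"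

section \<open>Levels\<close>

text \<open>The external face is the component of the complement that contains lines arbitrarily far
  from the origin; it is unique when \<open>X\<close> is compact, since the Moebius strip has one end.\<close>

definition external_face :: "line set \<Rightarrow> line set" where
  "external_face X = \<Union>{F \<in> components (- X). \<not> bounded {d. \<exists>\<theta>. mk_line \<theta> d \<in> F}}"

definition first_level :: "line set \<Rightarrow> line set" where
  "first_level X = frontier (external_face X)"

text \<open>Removing a level removes its open arcs. The bare difference would also delete the vertices of
  the level, at which the remaining arcs end; the closure puts those back.\<close>

definition remove_first_level :: "line set \<Rightarrow> line set" where
  "remove_first_level X = closure (X - first_level X)"

definition remove_levels :: "nat \<Rightarrow> line set \<Rightarrow> line set" where
  "remove_levels k X = (remove_first_level ^^ k) X"

section \<open>Convex polygons and their duals\<close>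

definition convex_ngon_vertices :: "nat \<Rightarrow> complex set \<Rightarrow> bool" where
  "convex_ngon_vertices n C \<longleftrightarrow> 3 \<le> n \<and> finite C \<and> card C = n \<and>
     {p. p extreme_point_of (convex hull C)} = C"

definition dual_point :: "complex \<Rightarrow> line set" where
  "dual_point p = {l. p \<in> points_on l}"

definition dual_points :: "complex set \<Rightarrow> line set set" where
  "dual_points C = dual_point ` C"

definition edges :: "complex set \<Rightarrow> complex set set" where
  "edges C = {{p, q} | p q. p \<in> C \<and> q \<in> C \<and> p \<noteq> q}"

definition edges_cross :: "complex set \<Rightarrow> complex set \<Rightarrow> bool" where
  "edges_cross e e' \<longleftrightarrow> (\<exists>p q r s. e = {p, q} \<and> e' = {r, s} \<and> e \<noteq> e' \<and>
     open_segment p q \<inter> open_segment r s \<noteq> {})"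

definition is_crossing :: "nat \<Rightarrow> complex set \<Rightarrow> complex set set \<Rightarrow> bool" where
  "is_crossing l C X \<longleftrightarrow> X \<subseteq> edges C \<and> finite X \<and> card X = l \<and>
     (\<forall>e\<in>X. \<forall>e'\<in>X. e \<noteq> e' \<longrightarrow> edges_cross e e')"

definition crossing_free :: "nat \<Rightarrow> complex set \<Rightarrow> complex set set \<Rightarrow> bool" where
  "crossing_free l C T \<longleftrightarrow> (\<nexists>X. X \<subseteq> T \<and> is_crossing l C X)"

definition k_triangulation :: "nat \<Rightarrow> complex set \<Rightarrow> complex set set \<Rightarrow> bool" where
  "k_triangulation k C T \<longleftrightarrow> T \<subseteq> edges C \<and> crossing_free (k + 1) C T \<and>
     (\<forall>T'. T \<subseteq> T' \<and> T' \<subseteq> edges C \<and> crossing_free (k + 1) C T' \<longrightarrow> T' = T)"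

section \<open>Stars and their bisectors\<close>

definition ccw :: "complex \<Rightarrow> complex \<Rightarrow> complex \<Rightarrow> bool" where
  "ccw p q r \<longleftrightarrow> 0 < Im (cnj (q - p) * (r - p))"

text \<open>For points in convex position, being listed in counterclockwise cyclic order means that all
  index-increasing triples are counterclockwise. Clockwise listings give the same stars and the
  same bisectors. Indices of \<open>s\<close> live in \<open>{0..2k}\<close> and are read modulo \<open>2k + 1\<close>; in particular
  \<open>j - k\<close> is written \<open>j + k + 1\<close>.\<close>

definition star_vertices :: "nat \<Rightarrow> complex set \<Rightarrow> (nat \<Rightarrow> complex) \<Rightarrow> bool" where
  "star_vertices k C s \<longleftrightarrow> (\<forall>j<2 * k + 1. s j \<in> C) \<and>
     (\<forall>h i j. h < i \<and> i < j \<and> j < 2 * k + 1 \<longrightarrow> ccw (s h) (s i) (s j))"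

definition star_edges :: "nat \<Rightarrow> (nat \<Rightarrow> complex) \<Rightarrow> complex set set" where
  "star_edges k s = {{s j, s ((j + k) mod (2 * k + 1))} | j. j < 2 * k + 1}"

definition k_star :: "nat \<Rightarrow> complex set \<Rightarrow> complex set set \<Rightarrow> bool" where
  "k_star k C S \<longleftrightarrow> (\<exists>s. star_vertices k C s \<and> S = star_edges k s)"

text \<open>Weak separation (opposite closed half-planes): the lines supporting the edges of a star count
  as bisectors, as they must for the set of bisectors to be a closed curve. Both orders of \<open>p\<close> and
  \<open>q\<close> are covered, because \<open>l = mk_line \<theta> d = mk_line (\<theta> + \<pi>) (- d)\<close>.\<close>

definition separates :: "line \<Rightarrow> complex \<Rightarrow> complex \<Rightarrow> bool" where
  "separates l p q \<longleftrightarrow>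
     (\<exists>\<theta> d. l = mk_line \<theta> d \<and> unit_normal \<theta> \<bullet> p \<le> d \<and> d \<le> unit_normal \<theta> \<bullet> q)"

definition dual_star :: "nat \<Rightarrow> complex set \<Rightarrow> complex set set \<Rightarrow> line set" where
  "dual_star k C S = {l. \<exists>s j. star_vertices k C s \<and> S = star_edges k s \<and> j < 2 * k + 1 \<and>
     s j \<in> points_on l \<and>
     separates l (s ((j + k + 1) mod (2 * k + 1))) (s ((j + k) mod (2 * k + 1)))}"

definition dual_arrangement :: "nat \<Rightarrow> complex set \<Rightarrow> complex set set \<Rightarrow> line set set" where
  "dual_arrangement k C T = {dual_star k C S | S. k_star k C S \<and> S \<subseteq> T}"

section \<open>Primal edges\<close>

definition primal_edges :: "complex set \<Rightarrow> line set set \<Rightarrow> complex set set" where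
  "primal_edges C \<Lambda> = {{p, q} | p q. p \<in> C \<and> q \<in> C \<and> p \<noteq> q \<and>
     arrangement_contact_point \<Lambda> (wedge (dual_point p) (dual_point q))}"

text \<open>Edges with fewer than \<open>k\<close> points of \<open>C\<close> on one side. They are in no \<open>(k+1)\<close>-crossing, so they
  belong to every \<open>k\<close>-triangulation. What remains after removing the first \<open>k\<close> levels either misses
  the dual point of such an edge or has a mere corner there, carried by a single pseudoline; so
  these edges can never appear in \<^const>\<open>primal_edges\<close>.\<close>

definition short_edges :: "nat \<Rightarrow> complex set \<Rightarrow> complex set set" where
  "short_edges k C = {{p, q} | p q. p \<in> C \<and> q \<in> C \<and> p \<noteq> q \<and> card {r \<in> C. ccw p q r} < k}"

end

theory Submission
  imports Defs
begin

text \<open>The dual \<open>S\<^sup>*\<close> of a \<open>k\<close>-star is the graph of the median of the heights (signed distances,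
  as functions of the angle) of the \<open>2k+1\<close> vertices of \<open>S\<close>, and \<open>C\<^sub>n\<^sup>*\<^sup>k\<close> consists of the
  lines \<open>(\<theta>, d)\<close> with at least \<open>k + 1\<close> vertices weakly on either side and at least one vertex on
  the line.

  (i) Each angle of \<open>T\<close> not cut off by fewer than \<open>k\<close> vertices belongs to exactly one \<open>k\<close>-star: among
  the \<open>k\<close>-crossings of \<open>T\<close> inside the angle an extremal one, together with the angle, is the
  star, because a missing edge of the star is crossed by a \<open>k\<close>-crossing, which can be spliced with the
  given one.  Hence through a generic line of \<open>C\<^sub>n\<^sup>*\<^sup>k\<close> passes exactly one star curve, and there
  are \<open>n - 2k\<close> curves.  A star curve \<open>S\<^sup>*\<close> meets the dual of each of the \<open>n - 2k - 1\<close> points outside \<open>S\<close> exactly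
  once, and each crossing of \<open>S\<^sup>*\<close> with another star curve lies on the dual of such a point, a different
  one for each crossing.  By antiperiodicity \<open>S\<^sup>*\<close> crosses each of the \<open>n - 2k - 1\<close> other curves
  at least once, so it crosses each of them exactly once.

  (ii) Suppose that \<open>k + 1\<close> contact edges cross mutually.  The side on which a curve of \<open>\<Lambda>\<close> passes
  their \<open>2k + 2\<close> end points (the majority, ties being broken by one of them) is antiperiodic, hence
  flips somewhere; as the curve cannot flip at a contact edge, it does so at the dual of one of the
  \<open>n - 2k - 2\<close> remaining points.  Different curves use different points, but there are
  \<open>n - 2k\<close> curves.  So the contact edges extend to a \<open>k\<close>-triangulation \<open>T\<close>, and as
  \<open>\<Lambda>\<close> and \<open>T\<^sup>*\<close> have the same number of contacts, nothing was added.\<close>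

section \<open>Crossing chains\<close>

text \<open>Both directions are reduced to one notion, \<open>net\<close>: a set of antiperiodic
  functions that covers the kernel, with exactly one curve through each of its lines at angles
  without ties in height. Star curves of a triangulation and the curves of an arrangement are both
  nets and can thus be compared. At an angle where two vertices tie, no third one is level with
  them, so two curves meeting there either stay on their vertices (a crossing) or exchange them (a
  contact). Hence each edge with at least k vertices on both sides is either a crossing or a
  contact, and as single crossings of all pairs amount to \<open>(n - 2 * k) choose 2\<close>, the
  number of contacts is the same for all such nets. The obstacle in (i) is an angle whose sides end
  at adjacent vertices: no missing chord lies inside, so maximality says nothing about it. An
  endless run of such angles around the polygon would give k + 1 mutually crossing edges. In (ii)
  the tie-break is needed because 2k + 2 is even, and its antiperiodicity is what forces a flip on
  every curve.\<close>

definition crossing_chain :: "(int \<Rightarrow> int \<Rightarrow> bool) \<Rightarrow> int \<Rightarrow> nat \<Rightarrow> (nat \<Rightarrow> int) \<Rightarrow> (nat \<Rightarrow> int) \<Rightarrow> bool" where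
  "crossing_chain E n r x y \<longleftrightarrow>
     (\<forall>i j. i < j \<longrightarrow> j < r \<longrightarrow> x i < x j \<and> y i < y j) \<and>
     (\<forall>i<r. \<forall>j<r. x i < y j \<and> y j < x i + n) \<and> (\<forall>i<r. E (x i) (y i))"

lemma chainI:
  assumes "\<And>i j. i < j \<Longrightarrow> j < r \<Longrightarrow> x i < x j \<and> y i < y j"
    and "\<And>i j. i < r \<Longrightarrow> j < r \<Longrightarrow> x i < y j \<and> y j < x i + n"
    and "\<And>i. i < r \<Longrightarrow> E (x i) (y i)"
  shows "crossing_chain E n r x y"
  using assms by (auto simp: crossing_chain_def)

lemma chain_strict_mono: "crossing_chain E n r x y \<Longrightarrow> i < j \<Longrightarrow> j < r \<Longrightarrow> x i < x j \<and> y i < y j"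
  and chain_box: "crossing_chain E n r x y \<Longrightarrow> i < r \<Longrightarrow> j < r \<Longrightarrow> x i < y j \<and> y j < x i + n"
  and chain_edge: "crossing_chain E n r x y \<Longrightarrow> i < r \<Longrightarrow> E (x i) (y i)"
  by (auto simp: crossing_chain_def)

lemma chain_mono_le: "crossing_chain E n r x y \<Longrightarrow> i \<le> j \<Longrightarrow> j < r \<Longrightarrow> x i \<le> x j \<and> y i \<le> y j"
  by (cases "i = j") (use chain_strict_mono[of E n r x y i j] in auto)

text \<open>Chords of an \<open>n\<close>-gon lifted to the universal cover of the circle: \<open>(x, y)\<close> with
  \<open>x < y < x + n\<close>, where \<open>(x, y)\<close> and \<open>(y, x + n)\<close> lift the same chord.\<close>

locale lifted_triangulation =
  fixes E :: "int \<Rightarrow> int \<Rightarrow> bool" and n :: int and k :: nat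
  assumes rot: "E x y \<longleftrightarrow> E y (x + n)"
    and no_chain: "\<And>a b. \<not> crossing_chain E n (k + 1) a b"
    and maximal: "x < y \<Longrightarrow> y < x + n \<Longrightarrow> \<not> E x y \<Longrightarrow>
      \<exists>c d. crossing_chain E n k c d \<and> (\<forall>i<k. x < c i \<and> c i < y \<and> y < d i \<and> d i < x + n)"
    and k_pos: "1 \<le> k"
begin

text \<open>Every chord of the chain would cross a chord from \<open>v\<close> to a position
  strictly between \<open>u\<close> and \<open>w\<close>.\<close>

definition chain_at :: "int \<Rightarrow> int \<Rightarrow> int \<Rightarrow> (nat \<Rightarrow> int) \<Rightarrow> (nat \<Rightarrow> int) \<Rightarrow> bool" where
  "chain_at v u w a b \<longleftrightarrow> crossing_chain E n k a b \<and> (\<forall>i<k. v < a i \<and> a i \<le> u \<and> w \<le> b i \<and> b i < v + n)"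

text \<open>Together with the chords of the chain these edges form the closed zigzag
  \<open>v, a (k - 1), b (k - 1), a (k - 2), ..., a 0, b 0, v\<close>, which is a
  \<open>k\<close>-star. The position \<open>g\<close> stands for the gap between \<open>g\<close>
  and \<open>g + 1\<close>, through which a bisector of the angle at \<open>v\<close>
  passes.\<close>

definition star_at :: "int \<Rightarrow> int \<Rightarrow> (nat \<Rightarrow> int) \<Rightarrow> (nat \<Rightarrow> int) \<Rightarrow> bool" where
  "star_at v g a b \<longleftrightarrow> chain_at v g (g + 1) a b \<and> (\<forall>i. Suc i < k \<longrightarrow> E (a i) (b (Suc i))) \<and>
     E v (a (k - 1)) \<and> E v (b 0)"

lemma chain_atI:
  assumes "\<And>j. j < k \<Longrightarrow> E (a j) (b j)"
    and rng: "\<And>j. j < k \<Longrightarrow> v < a j \<and> a j \<le> u \<and> w \<le> b j \<and> b j < v + n"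
    and "\<And>i j. i < j \<Longrightarrow> j < k \<Longrightarrow> a i < a j \<and> b i < b j"
    and "u < w"
  shows "chain_at v u w a b"
proof -
  have "a i < b j \<and> b j < a i + n" if "i < k" "j < k" for i j
    using rng[OF that(1)] rng[OF that(2)] \<open>u < w\<close> by linarith
  then show ?thesis using assms by (auto simp: chain_at_def intro!: chainI)
qed

lemma rot2: "E (x + n) (y + n) \<longleftrightarrow> E x y"
  using rot by metis

text \<open>Taking the chords \<open>0..j\<close> of the first chain and \<open>j..k - 1\<close> of
  the second gives \<open>k + 1\<close> chords; the common box makes them mutually crossing, which
  \<open>no_chain\<close> forbids.\<close>

lemma splice:
  assumes f: "crossing_chain E n k x y" and g: "crossing_chain E n k x' y'"
    and box: "\<And>i j. i < k \<Longrightarrow> j < k \<Longrightarrow> x i < y' j \<and> y' j < x i + n \<and> x' i < y j \<and> y j < x' i + n"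
    and j: "j < k"
  shows "\<not> (x j < x' j \<and> y j < y' j)"
proof
  assume less: "x j < x' j \<and> y j < y' j"
  define X where "X i = (if i \<le> j then x i else x' (i - 1))" for i
  define Y where "Y i = (if i \<le> j then y i else y' (i - 1))" for i
  have "crossing_chain E n (k + 1) X Y"
  proof (rule chainI)
    fix i l :: nat assume il: "i < l" "l < k + 1"
    show "X i < X l \<and> Y i < Y l"
    proof (cases "i \<le> j \<and> j < l")
      case True
      have "x i \<le> x j \<and> y i \<le> y j" using chain_mono_le[OF f, of i j] True j by auto
      moreover have "x' j \<le> x' (l - 1) \<and> y' j \<le> y' (l - 1)"
        using chain_mono_le[OF g, of j "l - 1"] True il by auto
      ultimately show ?thesis using True less by (auto simp: X_def Y_def)
    next
      case False
      then consider "l \<le> j" | "j < i" using il by linarith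
      then show ?thesis
        using il chain_strict_mono[OF f, of i l] chain_strict_mono[OF g, of "i - 1" "l - 1"] j
        by cases (auto simp: X_def Y_def)
    qed
  next
    fix i l :: nat assume il: "i < k + 1" "l < k + 1"
    show "X i < Y l \<and> Y l < X i + n"
      using il j chain_box[OF f, of i l] chain_box[OF g, of "i - 1" "l - 1"]
        box[of i "l - 1"] box[of "i - 1" l] by (auto simp: X_def Y_def)
  next
    fix i :: nat assume "i < k + 1"
    then show "E (X i) (Y i)"
      using chain_edge[OF f, of i] chain_edge[OF g, of "i - 1"] j by (auto simp: X_def Y_def)
  qed
  then show False using no_chain by blast
qed

text \<open>By \<open>splice\<close> in both orders, chords of equal index are nested, so the pair
  of minimum and maximum is the outer of the two and belongs to \<open>E\<close>. Passing to it
  moves a chain away from the gap that it surrounds.\<close>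

lemma merge:
  assumes f: "crossing_chain E n k x y" and g: "crossing_chain E n k x' y'"
    and box: "\<And>i j. i < k \<Longrightarrow> j < k \<Longrightarrow> x i < y' j \<and> y' j < x i + n \<and> x' i < y j \<and> y j < x' i + n"
  shows "crossing_chain E n k (\<lambda>j. min (x j) (x' j)) (\<lambda>j. max (y j) (y' j))"
proof -
  have box': "x' i < y j \<and> y j < x' i + n \<and> x i < y' j \<and> y' j < x i + n" if "i < k" "j < k" for i j
    using box that by blast
  have edge: "E (min (x j) (x' j)) (max (y j) (y' j))" if j: "j < k" for j
  proof -
    have "\<not> (x j < x' j \<and> y j < y' j)" by (rule splice[OF f g box j])
    moreover have "\<not> (x' j < x j \<and> y' j < y j)" by (rule splice[OF g f box' j])
    ultimately have "x j \<le> x' j \<and> y' j \<le> y j \<or> x' j \<le> x j \<and> y j \<le> y' j"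
      by linarith
    then show ?thesis using chain_edge[OF f j] chain_edge[OF g j]
      by (auto simp: min_def max_def)
  qed
  show ?thesis
  proof (rule chainI)
    fix i j :: nat assume "i < j" "j < k"
    then show "min (x i) (x' i) < min (x j) (x' j) \<and> max (y i) (y' i) < max (y j) (y' j)"
      using chain_strict_mono[OF f, of i j] chain_strict_mono[OF g, of i j] by auto
  next
    fix i j :: nat assume ij: "i < k" "j < k"
    then show "min (x i) (x' i) < max (y j) (y' j) \<and> max (y j) (y' j) < min (x i) (x' i) + n"
      using chain_box[OF f ij] chain_box[OF g ij] box[OF ij] by (auto simp: min_def max_def)
  qed (rule edge)
qed

text \<open>The inner chord of each nested pair, by the same argument; needed for chords that
  \<open>chain_improvement\<close> reads from their other end.\<close>

lemma merge2:
  assumes "crossing_chain E n k x y" and "crossing_chain E n k x' y'"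
    and "\<And>i j. i < k \<Longrightarrow> j < k \<Longrightarrow> x i < y' j \<and> y' j < x i + n \<and> x' i < y j \<and> y j < x' i + n"
  shows "crossing_chain E n k (\<lambda>j. max (x j) (x' j)) (\<lambda>j. min (y j) (y' j))"
proof -
  have edge: "E (max (x j) (x' j)) (min (y j) (y' j))" if j: "j < k" for j
  proof -
    have "\<not> (x j < x' j \<and> y j < y' j)" by (rule splice[OF assms(1,2) assms(3) j])
    moreover have "\<not> (x' j < x j \<and> y' j < y j)"
      by (rule splice[OF assms(2,1) _ j]) (use assms(3) in blast)
    ultimately have "x j \<le> x' j \<and> y' j \<le> y j \<or> x' j \<le> x j \<and> y j \<le> y' j"
      by linarith
    then show ?thesis using chain_edge[OF assms(1) j] chain_edge[OF assms(2) j]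
      by (auto simp: min_def max_def)
  qed
  show ?thesis
  proof (rule chainI)
    fix i j :: nat assume "i < j" "j < k"
    then show "max (x i) (x' i) < max (x j) (x' j) \<and> min (y i) (y' i) < min (y j) (y' j)"
      using chain_strict_mono[OF assms(1), of i j] chain_strict_mono[OF assms(2), of i j] by auto
  next
    fix i j :: nat assume ij: "i < k" "j < k"
    then show "max (x i) (x' i) < min (y j) (y' j) \<and> min (y j) (y' j) < max (x i) (x' i) + n"
      using chain_box[OF assms(1) ij] chain_box[OF assms(2) ij] assms(3)[OF ij]
      by (auto simp: min_def max_def)
  qed (rule edge)
qed

text \<open>A missing chord is crossed by \<open>k\<close> chords whose left ends are distinct
  positions strictly between \<open>x\<close> and \<open>y\<close>, but there are at most
  \<open>k - 1\<close> of these.\<close>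

lemma short_chord:
  assumes "x < y" "y < x + n" "y \<le> x + int k"
  shows "E x y"
proof (rule ccontr)
  assume "\<not> E x y"
  then obtain c d where cd: "crossing_chain E n k c d" "\<forall>i<k. x < c i \<and> c i < y \<and> y < d i \<and> d i < x + n"
    using maximal assms by blast
  have "x + int i < c i" if "i < k" for i
    using that
  proof (induction i)
    case 0 then show ?case using cd by auto
  next
    case (Suc i) then show ?case using chain_strict_mono[OF cd(1), of i "Suc i"] by auto
  qed
  from this[of "k - 1"] have "x + int (k - 1) < c (k - 1)" "c (k - 1) < y"
    using k_pos cd by auto
  then show False using assms(3) k_pos by linarith
qed

text \<open>Each position of the gap gives a missing chord from \<open>v\<close>, hence by
  maximality \<open>k\<close> chords crossing it. Merging these outwards, one position after the
  other, pushes the right ends across the whole gap while the left ends stay at or before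
  \<open>u\<close>.\<close>

lemma chain_across_wide_gap:
  assumes no: "\<And>z. u < z \<Longrightarrow> z < w \<Longrightarrow> \<not> E v z"
    and uw: "u + 2 \<le> w" "v < u" "w < v + n"
  shows "\<exists>a b. chain_at v u w a b"
proof -
  \<comment> \<open>The right boundary runs from \<open>u + 2\<close>, where the single missing
    chord from \<open>v\<close> to \<open>u + 1\<close> provides the chain, up to
    \<open>w\<close>.\<close>
  have "z \<le> w \<longrightarrow> (\<exists>a b. chain_at v u z a b)" if "u + 2 \<le> z" for z
    using that
  proof (induction z rule: int_ge_induct)
    case base
    show ?case
    proof
      assume "u + 2 \<le> w"
      then have "\<not> E v (u + 1)" using no by auto
      then obtain c d where cd: "crossing_chain E n k c d"
        "\<forall>i<k. v < c i \<and> c i < u + 1 \<and> u + 1 < d i \<and> d i < v + n"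
        using maximal[of v "u + 1"] uw by auto
      then have "chain_at v u (u + 2) c d" by (auto simp: chain_at_def)
      then show "\<exists>a b. chain_at v u (u + 2) a b" by blast
    qed
  next
    case (step z)
    show ?case
    proof
      assume z: "z + 1 \<le> w"
      then obtain a b where ab: "chain_at v u z a b" using step by auto
      have "\<not> E v z" using no[of z] step z by auto
      then obtain c d where cd: "crossing_chain E n k c d"
        "\<forall>i<k. v < c i \<and> c i < z \<and> z < d i \<and> d i < v + n"
        using maximal[of v z] step z uw by auto
      have "crossing_chain E n k (\<lambda>j. min (a j) (c j)) (\<lambda>j. max (b j) (d j))"
      proof (rule merge)
        show "crossing_chain E n k a b" using ab by (simp add: chain_at_def)
        show "crossing_chain E n k c d" by (rule cd)
        fix i j assume "i < k" "j < k"
        then have "v < a i" "a i \<le> u" "z \<le> b j" "b j < v + n" "v < c i" "c i < z" "z < d j" "d j < v + n"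
          using ab cd(2) by (auto simp: chain_at_def)
        then show "a i < d j \<and> d j < a i + n \<and> c i < b j \<and> b j < c i + n"
          using step by linarith
      qed
      then have "chain_at v u (z + 1) (\<lambda>j. min (a j) (c j)) (\<lambda>j. max (b j) (d j))"
        using ab cd(2) by (auto simp: chain_at_def min_def max_def)
      then show "\<exists>a b. chain_at v u (z + 1) a b" by blast
    qed
  qed
  then show ?thesis using uw by auto
qed

text \<open>A missing chord \<open>(a i, b (i + 1))\<close> is crossed by \<open>k\<close> chords. Merging these with the chain,
  rotated so that it starts at index \<open>i + 1\<close>, gives a chain that is farther from the gap
  between \<open>u\<close> and \<open>w\<close>.\<close>

lemma chain_improvement:
  assumes ab: "chain_at v u w a b" and uw: "u < w" and i: "Suc i < k" and ne: "\<not> E (a i) (b (Suc i))"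
  shows "\<exists>a' b'. chain_at v u w a' b' \<and> (\<forall>j<k. a' j \<le> a j \<and> b j \<le> b' j) \<and>
    (\<exists>j<k. a' j < a j \<or> b j < b' j)"
proof -
  have ch: "crossing_chain E n k a b" and rng: "\<And>j. j < k \<Longrightarrow> v < a j \<and> a j \<le> u \<and> w \<le> b j \<and> b j < v + n"
    using ab by (auto simp: chain_at_def)
  have bx: "\<And>i j. i < k \<Longrightarrow> j < k \<Longrightarrow> a i < b j \<and> b j < a i + n"
    using ch chain_box by blast
  obtain c d where cd: "crossing_chain E n k c d"
    and cd_rng: "\<And>j. j < k \<Longrightarrow> a i < c j \<and> c j < b (Suc i) \<and> b (Suc i) < d j \<and> d j < a i + n"
    using maximal[OF _ _ ne] bx[of i "Suc i"] i by auto
  define m where "m = k - Suc i"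
  have m: "0 < m" "m < k" "Suc i + m = k" using i by (auto simp: m_def)
  \<comment> \<open>The chain in rotated form: the \<open>m\<close> chords from index
    \<open>i + 1\<close> on, followed by the chords \<open>0..i\<close> read from their other end as
    \<open>(b j, a j + n)\<close>. Now all left ends lie strictly between \<open>a i\<close> and
    \<open>b (Suc i)\<close>, as those of \<open>c\<close> do, so the two chains can be
    merged.\<close>
  define A where "A j = (if j < m then a (Suc i + j) else b (j - m))" for j
  define B where "B j = (if j < m then b (Suc i + j) else a (j - m) + n)" for j
  have rngA: "a i < A j \<and> A j < b (Suc i)" if "j < k" for j
  proof (cases "j < m")
    case True
    then show ?thesis using chain_strict_mono[OF ch, of i "Suc i + j"] bx[of "Suc i + j" "Suc i"] m i
      by (auto simp: A_def)
  next
    case False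
    then show ?thesis using chain_strict_mono[OF ch, of "j - m" "Suc i"] bx[of i "j - m"] m i that
      by (auto simp: A_def)
  qed
  have rngB: "b (Suc i) \<le> B j \<and> B j \<le> a i + n" if "j < k" for j
  proof (cases "j < m")
    case True
    then show ?thesis using chain_mono_le[OF ch, of "Suc i" "Suc i + j"] bx[of i "Suc i + j"] m i
      by (auto simp: B_def)
  next
    case False
    then have "j - m \<le> i" using m that by linarith
    then show ?thesis using chain_mono_le[OF ch, of "j - m" i] bx[of "j - m" "Suc i"] False i
      by (auto simp: B_def)
  qed
  have AB: "crossing_chain E n k A B"
  proof (rule chainI)
    fix p q :: nat assume pq: "p < q" "q < k"
    consider "q < m" | "p < m" "m \<le> q" | "m \<le> p" using pq by linarith
    then show "A p < A q \<and> B p < B q"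
    proof cases
      case 1 then show ?thesis using pq m chain_strict_mono[OF ch, of "Suc i + p" "Suc i + q"]
        by (auto simp: A_def B_def)
    next
      case 2
      have "b (Suc i + p) < a (q - m) + n" "a (Suc i + p) < b (q - m)"
        using bx[of "q - m" "Suc i + p"] bx[of "Suc i + p" "q - m"] 2 pq m by auto
      then show ?thesis using 2 by (auto simp: A_def B_def)
    next
      case 3 then show ?thesis using pq m chain_strict_mono[OF ch, of "p - m" "q - m"]
        by (auto simp: A_def B_def)
    qed
  next
    fix p q assume "p < k" "q < k"
    then show "A p < B q \<and> B q < A p + n" using rngA[of p] rngB[of q] by linarith
  next
    fix p assume p: "p < k"
    show "E (A p) (B p)"
    proof (cases "p < m")
      case True then show ?thesis using chain_edge[OF ch, of "Suc i + p"] m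
        by (auto simp: A_def B_def)
    next
      case False then show ?thesis using chain_edge[OF ch, of "p - m"] p rot[of "a (p - m)"]
        by (auto simp: A_def B_def)
    qed
  qed
  have box: "A i' < d j \<and> d j < A i' + n \<and> c i' < B j \<and> B j < c i' + n"
    if "i' < k" "j < k" for i' j
    using rngA[OF that(1)] rngB[OF that(2)] cd_rng[OF that(1)] cd_rng[OF that(2)] by linarith
  have M1: "crossing_chain E n k (\<lambda>j. min (A j) (c j)) (\<lambda>j. max (B j) (d j))"
    by (rule merge[OF AB cd box])
  have M2: "crossing_chain E n k (\<lambda>j. max (A j) (c j)) (\<lambda>j. min (B j) (d j))"
    by (rule merge2[OF AB cd box])
  \<comment> \<open>The new ends must stay between \<open>v\<close> and \<open>v + n\<close>. If
    \<open>d m\<close> lies beyond \<open>v + n\<close>, so do the later \<open>d\<close>, and the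
    inner merge moves the chords \<open>0..i\<close> outwards while their ends \<open>d - n\<close>
    remain after \<open>v\<close>. Otherwise \<open>d j\<close> is below \<open>v + n\<close> for
    all \<open>j < m\<close>, and the outer merge moves the chords from \<open>i + 1\<close>
    on.\<close>
  show ?thesis
  proof (cases "v + n < d m")
    case True
    define a' where "a' j = (if j \<le> i then min (a j) (d (m + j) - n) else a j)" for j
    define b' where "b' j = (if j \<le> i then max (b j) (c (m + j)) else b j)" for j
    have low: "E (a' j) (b' j) \<and> v < a' j \<and> a' j \<le> a j \<and> b j \<le> b' j \<and> b' j < b (Suc i)"
      if j: "j \<le> i" for j
    proof -
      have mj: "m + j < k" using j m by linarith
      have "E (max (b j) (c (m + j))) (min (a j + n) (d (m + j)))"
        using chain_edge[OF M2 mj] by (simp add: A_def B_def)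
      moreover have "min (a j + n) (d (m + j)) = a' j + n"
        using j by (simp add: a'_def min_def)
      ultimately have "E (a' j) (b' j)"
        using rot[of "a' j"] j by (simp add: b'_def)
      moreover have "v + n < d (m + j)"
        using True chain_mono_le[OF cd, of m "m + j"] mj by linarith
      moreover have "c (m + j) < b (Suc i)" using cd_rng[OF mj] by simp
      ultimately show ?thesis using j rng[of j] i chain_strict_mono[OF ch, of j "Suc i"]
        by (auto simp: a'_def b'_def)
    qed
    have "crossing_chain E n k a' b'"
    proof (rule chainI)
      fix p q :: nat assume pq: "p < q" "q < k"
      show "a' p < a' q \<and> b' p < b' q"
      proof (cases "q \<le> i")
        case True
        then show ?thesis using pq chain_strict_mono[OF ch, of p q] chain_strict_mono[OF cd, of "m + p" "m + q"] m
          by (auto simp: a'_def b'_def min_def max_def)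
      next
        case False
        then have q: "Suc i \<le> q" by simp
        show ?thesis
        proof (cases "p \<le> i")
          case True
          have "a p < a q" "b (Suc i) \<le> b q"
            using chain_strict_mono[OF ch, of p q] chain_mono_le[OF ch, of "Suc i" q] pq q by auto
          then show ?thesis using low[OF True] False by (auto simp: a'_def b'_def)
        next
          case False
          then show ?thesis using q pq chain_strict_mono[OF ch, of p q] by (auto simp: a'_def b'_def)
        qed
      qed
    next
      fix p q assume pq: "p < k" "q < k"
      have "v < a' p" "a' p \<le> u"
        using low[of p] rng[of p] pq by (auto simp: a'_def)
      moreover have "w \<le> b' q" "b' q < v + n"
        using low[of q] rng[of q] rng[of "Suc i"] pq i by (auto simp: b'_def split: if_splits)
      ultimately show "a' p < b' q \<and> b' q < a' p + n" using uw by linarith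
    next
      fix p assume "p < k"
      then show "E (a' p) (b' p)"
        using low[of p] chain_edge[OF ch, of p] by (cases "p \<le> i") (auto simp: a'_def b'_def)
    qed
    moreover have "v < a' p \<and> a' p \<le> a p \<and> b p \<le> b' p \<and> b' p < v + n" if "p < k" for p
      using low[of p] rng[of p] rng[of "Suc i"] that i by (cases "p \<le> i") (auto simp: a'_def b'_def)
    moreover have "a' i < a i"
      using cd_rng[of "m + i"] m by (auto simp: a'_def)
    ultimately have "chain_at v u w a' b' \<and> (\<forall>j<k. a' j \<le> a j \<and> b j \<le> b' j) \<and> a' i < a i"
      using rng unfolding chain_at_def by (meson order_trans)
    then show ?thesis using i Suc_lessD by blast
  next
    case False
    have dlt: "d j < v + n" if "j < m" for j
      using False chain_strict_mono[OF cd, of j m] that m by linarith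
    define a' where "a' j = (if j \<le> i then a j else min (a j) (c (j - Suc i)))" for j
    define b' where "b' j = (if j \<le> i then b j else max (b j) (d (j - Suc i)))" for j
    have hi: "E (a' j) (b' j) \<and> a i < a' j \<and> a' j \<le> a j \<and> b j \<le> b' j \<and> b' j < v + n"
      if j: "i < j" "j < k" for j
    proof -
      have mj: "j - Suc i < m" "j - Suc i < k" "Suc (i + (j - Suc i)) = j" using j m by auto
      have "E (min (a j) (c (j - Suc i))) (max (b j) (d (j - Suc i)))"
        using chain_edge[OF M1 mj(2)] mj by (simp add: A_def B_def)
      then have "E (a' j) (b' j)" using j by (simp add: a'_def b'_def)
      then show ?thesis using j rng[of j] dlt[OF mj(1)] cd_rng[OF mj(2)] chain_strict_mono[OF ch, of i j]
        by (auto simp: a'_def b'_def)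
    qed
    have "crossing_chain E n k a' b'"
    proof (rule chainI)
      fix p q :: nat assume pq: "p < q" "q < k"
      show "a' p < a' q \<and> b' p < b' q"
      proof (cases "p \<le> i")
        case True
        show ?thesis
        proof (cases "q \<le> i")
          case True
          then show ?thesis using pq chain_strict_mono[OF ch, of p q] by (auto simp: a'_def b'_def)
        next
          case False
          then have "a p \<le> a i" "a i < a' q" "b p < b q" "b q \<le> b' q"
            using chain_mono_le[OF ch, of p i] hi[of q] chain_strict_mono[OF ch, of p q] pq True i by auto
          then show ?thesis using True by (auto simp: a'_def b'_def)
        qed
      next
        case False
        then have "c (p - Suc i) < c (q - Suc i) \<and> d (p - Suc i) < d (q - Suc i)"
          by (intro chain_strict_mono[OF cd]) (use pq in linarith)+
        moreover have "a p < a q \<and> b p < b q" using chain_strict_mono[OF ch pq] .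
        ultimately show ?thesis using False pq(1) by (auto simp: a'_def b'_def)
      qed
    next
      fix p q assume pq: "p < k" "q < k"
      have "v < a' p" "a' p \<le> u"
        using hi[of p] rng[of p] rng[of i] pq i by (cases "p \<le> i"; force simp: a'_def)+
      moreover have "w \<le> b' q" "b' q < v + n"
        using hi[of q] rng[of q] pq i by (cases "q \<le> i"; force simp: b'_def)+
      ultimately show "a' p < b' q \<and> b' q < a' p + n" using uw by linarith
    next
      fix p assume "p < k"
      then show "E (a' p) (b' p)"
        using hi[of p] chain_edge[OF ch, of p] by (cases "p \<le> i") (auto simp: a'_def b'_def)
    qed
    moreover have "v < a' p \<and> a' p \<le> a p \<and> b p \<le> b' p \<and> b' p < v + n" if "p < k" for p
      using hi[of p] rng[of p] rng[of i] that i by (cases "p \<le> i") (force simp: a'_def b'_def)+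
    moreover have "b (Suc i) < b' (Suc i)"
      using cd_rng[of 0] k_pos by (auto simp: b'_def)
    ultimately have "chain_at v u w a' b' \<and> (\<forall>j<k. a' j \<le> a j \<and> b j \<le> b' j) \<and> b (Suc i) < b' (Suc i)"
      using rng unfolding chain_at_def by (meson order_trans)
    then show ?thesis using i by blast
  qed
qed

text \<open>Each use of \<open>chain_improvement\<close> lowers the total distance of the left ends
  from \<open>v\<close> and of the right ends from \<open>v + n\<close>, so a chain that cannot be
  improved is reached.\<close>

lemma chain_imp_star_edges:
  assumes "chain_at v u w a b" and uw: "u < w"
  shows "\<exists>a b. chain_at v u w a b \<and> (\<forall>i. Suc i < k \<longrightarrow> E (a i) (b (Suc i)))"
  using assms(1)
proof (induction "\<Sum>j<k. nat (a j - v) + nat (v + n - b j)" arbitrary: a b rule: less_induct)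
  case less
  show ?case
  proof (cases "\<forall>i. Suc i < k \<longrightarrow> E (a i) (b (Suc i))")
    case True then show ?thesis using less.prems by blast
  next
    case False
    then obtain a' b' l where ab': "chain_at v u w a' b'" "\<forall>j<k. a' j \<le> a j \<and> b j \<le> b' j"
      "l < k" "a' l < a l \<or> b l < b' l"
      using chain_improvement[OF less.prems uw] by blast
    have "(\<Sum>j<k. nat (a' j - v) + nat (v + n - b' j)) < (\<Sum>j<k. nat (a j - v) + nat (v + n - b j))"
    proof (rule sum_strict_mono_ex1)
      show "\<forall>j\<in>{..<k}. nat (a' j - v) + nat (v + n - b' j) \<le> nat (a j - v) + nat (v + n - b j)"
        using ab'(2) by (auto intro!: add_mono)
      have "v < a' l" "b' l < v + n" using ab' by (auto simp: chain_at_def)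
      then have "nat (a' l - v) + nat (v + n - b' l) < nat (a l - v) + nat (v + n - b l)"
        using ab' by fastforce
      then show "\<exists>j\<in>{..<k}. nat (a' j - v) + nat (v + n - b' j) < nat (a j - v) + nat (v + n - b j)"
        using ab'(3) by blast
    qed simp
    then show ?thesis using less.hyps ab'(1) by blast
  qed
qed

text \<open>The chord from \<open>v\<close> to \<open>z\<close>, placed in front of the chain,
  crosses all its chords and would make a forbidden chain of length \<open>k + 1\<close>.\<close>

lemma chain_angle_empty:
  assumes "chain_at v u w a b" "\<forall>i<k. a i < z \<and> z < b i" "v < z" "z < v + n"
  shows "\<not> E v z"
proof
  assume e: "E v z"
  have ch: "crossing_chain E n k a b" and rng: "\<And>j. j < k \<Longrightarrow> v < a j \<and> a j \<le> u \<and> w \<le> b j \<and> b j < v + n"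
    using assms(1) by (auto simp: chain_at_def)
  have "crossing_chain E n (k + 1) (\<lambda>i. if i = 0 then v else a (i - 1)) (\<lambda>i. if i = 0 then z else b (i - 1))"
  proof (rule chainI)
    fix p q :: nat assume pq: "p < q" "q < k + 1"
    then show "(if p = 0 then v else a (p - 1)) < (if q = 0 then v else a (q - 1)) \<and>
       (if p = 0 then z else b (p - 1)) < (if q = 0 then z else b (q - 1))"
      using chain_strict_mono[OF ch, of "p - 1" "q - 1"] rng[of "q - 1"] assms(2) by auto
  next
    fix p q :: nat assume pq: "p < k + 1" "q < k + 1"
    then show "(if p = 0 then v else a (p - 1)) < (if q = 0 then z else b (q - 1)) \<and>
      (if q = 0 then z else b (q - 1)) < (if p = 0 then v else a (p - 1)) + n"
      using chain_box[OF ch, of "p - 1" "q - 1"] rng[of "q - 1"] rng[of "p - 1"] assms(2-)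
      by (auto simp: less_diff_conv2)
  next
    fix p :: nat assume "p < k + 1"
    then show "E (if p = 0 then v else a (p - 1)) (if p = 0 then z else b (p - 1))"
      using chain_edge[OF ch, of "p - 1"] e by auto
  qed
  then show False using no_chain by blast
qed

text \<open>Both \<open>v + 1\<close> and \<open>v + n - 1\<close> are joined to \<open>v\<close> by
  short chords, so there is a last edge end at or before \<open>g\<close> and a first one after
  it.\<close>

lemma gap_neighbours:
  assumes "v + int k \<le> g" "g < v + n - int k"
  obtains u w where "v < u" "u \<le> g" "g < w" "w < v + n" "E v u" "E v w"
    "\<And>z. u < z \<Longrightarrow> z < w \<Longrightarrow> \<not> E v z"
proof -
  define U where "U = {x. v < x \<and> x \<le> g \<and> E v x}"
  define W where "W = {x. g < x \<and> x < v + n \<and> E v x}"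
  have fin: "finite U" "finite W"
    by (rule finite_subset[of _ "{v..g}"], auto simp: U_def)
      (rule finite_subset[of _ "{g..v + n}"], auto simp: W_def)
  have "v + 1 \<in> U" using assms k_pos short_chord[of v "v + 1"] by (auto simp: U_def)
  moreover have "v + n - 1 \<in> W"
    using assms k_pos short_chord[of "v + n - 1" "v + n"] rot[of v "v + n - 1"] by (auto simp: W_def)
  ultimately have ne: "U \<noteq> {}" "W \<noteq> {}" by auto
  have mm: "Max U \<in> U" "Min W \<in> W" using fin ne by auto
  show ?thesis
  proof (rule that[of "Max U" "Min W"])
    fix z assume z: "Max U < z" "z < Min W"
    show "\<not> E v z"
    proof
      assume "E v z"
      then have "z \<in> U \<or> z \<in> W" using z mm by (auto simp: U_def W_def)
      then show False using z fin by (meson Max_ge Min_le not_le)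
    qed
  qed (use mm in \<open>auto simp: U_def W_def\<close>)
qed

text \<open>Between the two edges of \<open>v\<close> next to the gap, the extremal chain has to end
  exactly at \<open>u\<close> and begin exactly at \<open>w\<close>, since otherwise the edge from
  \<open>v\<close> to \<open>u\<close> or to \<open>w\<close> would cross all \<open>k\<close>
  chords. When \<open>u\<close> and \<open>w\<close> are adjacent, the assumed chain takes the place
  of the one from maximality.\<close>

lemma star_if_chain:
  assumes g: "v + int k \<le> g" "g < v + n - int k" and ab: "chain_at v g (g + 1) a b"
  shows "\<exists>a b. star_at v g a b"
proof -
  obtain u w where uw: "v < u" "u \<le> g" "g < w" "w < v + n" "E v u" "E v w"
    and none: "\<And>z. u < z \<Longrightarrow> z < w \<Longrightarrow> \<not> E v z"
    using gap_neighbours[OF g] by blast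
  have "\<exists>a b. chain_at v u w a b"
  proof (cases "u + 2 \<le> w")
    case True then show ?thesis using chain_across_wide_gap[of u w v] none uw by auto
  next
    case False
    then have "u = g" "w = g + 1" using uw by auto
    then show ?thesis using ab by blast
  qed
  then obtain a b where ab: "chain_at v u w a b" "\<And>i. Suc i < k \<Longrightarrow> E (a i) (b (Suc i))"
    using chain_imp_star_edges[of v u w] uw by force
  have ch: "crossing_chain E n k a b" and rng: "\<And>j. j < k \<Longrightarrow> v < a j \<and> a j \<le> u \<and> w \<le> b j \<and> b j < v + n"
    using ab by (auto simp: chain_at_def)
  have "a (k - 1) = u"
  proof (rule ccontr)
    assume "a (k - 1) \<noteq> u"
    then have "a (k - 1) < u" using rng[of "k - 1"] k_pos by auto
    moreover have "a i \<le> a (k - 1)" if "i < k" for i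
      using chain_mono_le[OF ch, of i "k - 1"] that by auto
    moreover have "u < b i" if "i < k" for i using rng[OF that] uw by linarith
    ultimately have "\<forall>i<k. a i < u \<and> u < b i" by force
    then show False using chain_angle_empty[OF ab(1), of u] uw by auto
  qed
  moreover have "b 0 = w"
  proof (rule ccontr)
    assume "b 0 \<noteq> w"
    then have "w < b 0" using rng[of 0] k_pos by auto
    moreover have "b 0 \<le> b i" if "i < k" for i
      using chain_mono_le[OF ch, of 0 i] that by auto
    moreover have "a i < w" if "i < k" for i using rng[OF that] uw by linarith
    ultimately have "\<forall>i<k. a i < w \<and> w < b i" by force
    then show False using chain_angle_empty[OF ab(1), of w] uw by auto
  qed
  ultimately have "star_at v g a b"
    using ab uw rng ch unfolding star_at_def chain_at_def by force
  then show ?thesis by blast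
qed

text \<open>If the two sides of an angle end at adjacent vertices, the angle at the far end is handled
  first: its star also contains the given angle.\<close>

lemma no_chain_step:
  assumes g: "v + int k \<le> g" "g < v + n - int k" and no: "\<nexists>a b. chain_at v g (g + 1) a b"
  shows "E v g \<and> E v (g + 1) \<and> (\<nexists>a b. chain_at (g + 1) (v + n) (v + n + 1) a b)"
proof -
  obtain u w where uw: "v < u" "u \<le> g" "g < w" "w < v + n" "E v u" "E v w"
    and none: "\<And>z. u < z \<Longrightarrow> z < w \<Longrightarrow> \<not> E v z"
    using gap_neighbours[OF g] by blast
  have "\<not> u + 2 \<le> w"
  proof
    assume "u + 2 \<le> w"
    then obtain a b where "chain_at v u w a b"
      using chain_across_wide_gap[of u w v] none uw by auto
    then have "chain_at v g (g + 1) a b" using uw by (force simp: chain_at_def)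
    then show False using no by blast
  qed
  then have "u = g" "w = g + 1" using uw by auto
  moreover have "\<nexists>a b. chain_at (g + 1) (v + n) (v + n + 1) a b"
  proof
    assume "\<exists>a b. chain_at (g + 1) (v + n) (v + n + 1) a b"
    then obtain a b where st: "star_at (g + 1) (v + n) a b"
      using star_if_chain[of "g + 1" "v + n"] g by fastforce
    then have ch: "crossing_chain E n k a b"
      and rng: "\<And>j. j < k \<Longrightarrow> g + 1 < a j \<and> a j \<le> v + n \<and> v + n + 1 \<le> b j \<and> b j < g + 1 + n"
      and ed: "\<And>i. Suc i < k \<Longrightarrow> E (a i) (b (Suc i))" "E (g + 1) (b 0)"
      by (auto simp: star_at_def chain_at_def)
    \<comment> \<open>Of the star at \<open>g + 1\<close>, the edges from \<open>g + 1\<close> to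
      \<open>b 0\<close> and from \<open>a (j - 1)\<close> to \<open>b j\<close> are again
      \<open>k\<close> mutually crossing chords; shifted by \<open>n\<close> at the \<open>b\<close>
      end they surround the gap after \<open>g\<close> as seen from \<open>v\<close>.\<close>
    define x where "x j = b j - n" for j
    define y where "y j = (if j = 0 then g + 1 else a (j - 1))" for j
    have "E (x j) (y j)" if "j < k" for j
      using that ed(1)[of "j - 1"] ed(2) rot[of "b j - n" "y j"] rot2[of "y j" "b j"]
      by (auto simp: x_def y_def)
    moreover have "v < x j \<and> x j \<le> g \<and> g + 1 \<le> y j \<and> y j < v + n" if "j < k" for j
      using rng[of j] rng[of "j - 1"] chain_strict_mono[OF ch, of "j - 1" j] that g k_pos
      by (force simp: x_def y_def)
    moreover have "x i < x j \<and> y i < y j" if "i < j" "j < k" for i j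
      using that chain_strict_mono[OF ch, of i j] chain_strict_mono[OF ch, of "i - 1" "j - 1"] rng[of "j - 1"]
      by (auto simp: x_def y_def)
    ultimately have "chain_at v g (g + 1) x y"
      by (rule chain_atI) simp_all
    then show False using no by blast
  qed
  ultimately show ?thesis using uw by blast
qed

lemma chain_at_shift:
  assumes c: "chain_at v g (g + 1) a b"
  shows "chain_at (v + n) (g + n) (g + n + 1) (\<lambda>i. a i + n) (\<lambda>i. b i + n)"
    and "chain_at (v - n) (g - n) (g - n + 1) (\<lambda>i. a i - n) (\<lambda>i. b i - n)"
proof -
  have ch: "crossing_chain E n k a b" using c by (simp add: chain_at_def)
  have box: "a i < b j" "b j < a i + n" if "i < k" "j < k" for i j
    using chain_box[OF ch that] by auto
  have shift: "crossing_chain E n k (\<lambda>i. a i + t) (\<lambda>i. b i + t)"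
    if "\<And>x y. E (x + t) (y + t) \<longleftrightarrow> E x y" for t
  proof (rule chainI)
    fix i j assume "i < k" "j < k"
    then show "a i + t < b j + t \<and> b j + t < a i + t + n" using box[of i j] by linarith
  qed (use chain_strict_mono[OF ch] chain_edge[OF ch] that in auto)
  have "crossing_chain E n k (\<lambda>i. a i + n) (\<lambda>i. b i + n)"
    by (rule shift) (rule rot2)
  moreover have "crossing_chain E n k (\<lambda>i. a i - n) (\<lambda>i. b i - n)"
    using shift[of "- n"] rot2[of "_ - n" "_ - n"] by simp
  ultimately show "chain_at (v + n) (g + n) (g + n + 1) (\<lambda>i. a i + n) (\<lambda>i. b i + n)"
    "chain_at (v - n) (g - n) (g - n + 1) (\<lambda>i. a i - n) (\<lambda>i. b i - n)"
    using c by (auto simp: chain_at_def)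
qed

text \<open>If the chain is missing at \<open>(v, g)\<close>, two applications of
  \<open>no_chain_step\<close> carry this to \<open>(v + 1, g + 1)\<close> up to a full turn, so all
  chords from \<open>v + i\<close> to \<open>g + i\<close> are edges. For \<open>v + k < g\<close>
  the first \<open>k + 1\<close> of them cross mutually; for \<open>g = v + k\<close> short chords
  give the missing chain directly.\<close>

theorem star_exists:
  assumes g: "v + int k \<le> g" "g < v + n - int k"
  shows "\<exists>a b. star_at v g a b"
proof (rule ccontr)
  assume "\<nexists>a b. star_at v g a b"
  then have no0: "\<nexists>a b. chain_at v g (g + 1) a b" using star_if_chain[OF g] by blast
  have step: "\<nexists>a b. chain_at (v + int i) (g + int i) (g + int i + 1) a b" for i
  proof (induction i)
    case 0 then show ?case using no0 by simp
  next
    case (Suc i)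
    have "\<nexists>a b. chain_at (g + int i + 1) (v + int i + n) (v + int i + n + 1) a b"
      using no_chain_step[OF _ _ Suc] g by auto
    then have "\<nexists>a b. chain_at (v + int i + n + 1) (g + int i + 1 + n) (g + int i + 1 + n + 1) a b"
      using no_chain_step[of "g + int i + 1" "v + int i + n"] g by auto
    moreover have "v + int i + n + 1 = v + int (Suc i) + n" "g + int i + 1 + n = g + int (Suc i) + n"
      by auto
    ultimately show ?case using chain_at_shift(1) by metis
  qed
  show False
  proof (cases "g = v + int k")
    case True
    have "chain_at v g (g + 1) (\<lambda>i. v + int i + 1) (\<lambda>i. v + int k + 1 + int i)"
      using True g short_chord by (auto simp: chain_at_def crossing_chain_def)
    then show False using no0 by blast
  next
    case False
    have "E (v + int i) (g + int i)" for i
      using no_chain_step[OF _ _ step[of i]] g by auto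
    then have "crossing_chain E n (k + 1) (\<lambda>i. v + int i) (\<lambda>i. g + int i)"
      using False g by (auto simp: crossing_chain_def)
    then show False using no_chain by blast
  qed
qed

text \<open>A star is extremal. If \<open>c j\<close> lies before \<open>a j\<close>, then the
  chords \<open>0..j\<close> of the other chain followed by the zigzag edges from \<open>a j\<close>
  on form a chain of length \<open>k + 1\<close>, unless \<open>d j\<close> reaches the next
  \<open>b\<close>; symmetrically on the other side. The two forced shifts feed each other until
  they run into the end of the angle.\<close>

lemma star_at_lower:
  assumes st: "star_at v g a b" and ch: "chain_at v g (g + 1) c d"
    and le: "\<And>i. i < k \<Longrightarrow> c i \<le> a i \<and> b i \<le> d i" and i: "i < k"
  shows "c i = a i \<and> d i = b i"
proof -
  have chab: "crossing_chain E n k a b" and rng: "\<And>j. j < k \<Longrightarrow> v < a j \<and> a j \<le> g \<and> g + 1 \<le> b j \<and> b j < v + n"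
    and ed: "\<And>i. Suc i < k \<Longrightarrow> E (a i) (b (Suc i))" "E v (a (k - 1))" "E v (b 0)"
    using st by (auto simp: star_at_def chain_at_def)
  have chcd: "crossing_chain E n k c d" and rng': "\<And>j. j < k \<Longrightarrow> v < c j \<and> c j \<le> g \<and> g + 1 \<le> d j \<and> d j < v + n"
    using ch by (auto simp: chain_at_def)
  \<comment> \<open>Padding with \<open>v + n\<close> after the last \<open>b\<close> and with
    \<open>v\<close> before the first \<open>a\<close> turns the two edges at \<open>v\<close> into
    zigzag edges as well.\<close>
  define bb where "bb i = (if i < k then b i else v + n)" for i
  define aa where "aa i = (if i = 0 then v else a (i - 1))" for i
  have bbE: "E (a i) (bb (Suc i))" if "i < k" for i
  proof (cases "Suc i < k")
    case True then show ?thesis using ed by (auto simp: bb_def)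
  next
    case False
    then have "i = k - 1" using that by auto
    then show ?thesis using ed(2) rot False by (auto simp: bb_def)
  qed
  have aaE: "E (aa i) (b i)" if "i < k" for i
    using ed(1)[of "i - 1"] ed(3) that by (auto simp: aa_def)
  have bb_mono: "bb i < bb j" if "i < j" "j \<le> k" for i j
    using chain_strict_mono[OF chab, of i j] rng[of i] that by (auto simp: bb_def)
  have aa_mono: "aa i < aa j" if "i < j" "j \<le> k" for i j
    using chain_strict_mono[OF chab, of "i - 1" "j - 1"] rng[of "j - 1"] that by (auto simp: aa_def)
  have bb_rng: "g + 1 \<le> bb i \<and> bb i \<le> v + n" if "i \<le> k" for i
    using rng[of i] rng[of 0] k_pos that by (force simp: bb_def)
  have aa_rng: "v \<le> aa i \<and> aa i \<le> g" if "i \<le> k" for i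
    using rng[of "i - 1"] rng[of 0] k_pos that by (force simp: aa_def)
  have 1: "bb (Suc j) \<le> d j" if j: "j < k" and lt: "c j < a j" for j
  proof (rule ccontr)
    assume n: "\<not> bb (Suc j) \<le> d j"
    have "crossing_chain E n (k + 1) (\<lambda>i. if i \<le> j then c i else a (i - 1)) (\<lambda>i. if i \<le> j then d i else bb i)"
    proof (rule chainI)
      fix p q :: nat assume pq: "p < q" "q < k + 1"
      consider "q \<le> j" | "p \<le> j" "j < q" | "j < p" by linarith
      then show "(if p \<le> j then c p else a (p - 1)) < (if q \<le> j then c q else a (q - 1)) \<and>
        (if p \<le> j then d p else bb p) < (if q \<le> j then d q else bb q)"
      proof cases
        case 1 then show ?thesis using pq j chain_strict_mono[OF chcd, of p q] by auto
      next
        case 2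
        have "c p \<le> c j \<and> d p \<le> d j" using chain_mono_le[OF chcd 2(1) j] .
        moreover have "a j \<le> a (q - 1) \<and> b j \<le> b (q - 1)"
          by (rule chain_mono_le[OF chab]) (use 2 pq in linarith)+
        moreover have "bb (Suc j) \<le> bb q"
          using bb_mono[of "Suc j" q] pq 2 by (cases "Suc j = q") auto
        ultimately show ?thesis using 2 lt n by auto
      next
        case 3 then show ?thesis using pq chain_strict_mono[OF chab, of "p - 1" "q - 1"] bb_mono[of p q]
          by auto
      qed
    next
      fix p q :: nat assume pq: "p < k + 1" "q < k + 1"
      have "v < (if p \<le> j then c p else a (p - 1)) \<and> (if p \<le> j then c p else a (p - 1)) \<le> g"
        using rng[of "p - 1"] rng'[of p] pq j by auto
      moreover have "g + 1 \<le> (if q \<le> j then d q else bb q) \<and> (if q \<le> j then d q else bb q) \<le> v + n"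
        using rng'[of q] bb_rng[of q] pq j by auto
      ultimately show "(if p \<le> j then c p else a (p - 1)) < (if q \<le> j then d q else bb q) \<and>
        (if q \<le> j then d q else bb q) < (if p \<le> j then c p else a (p - 1)) + n" by linarith
    next
      fix p :: nat assume p: "p < k + 1"
      then show "E (if p \<le> j then c p else a (p - 1)) (if p \<le> j then d p else bb p)"
        using chain_edge[OF chcd, of p] bbE[of "p - 1"] j by auto
    qed
    then show False using no_chain by blast
  qed
  have 2: "c j \<le> aa j" if j: "j < k" and lt: "b j < d j" for j
  proof (rule ccontr)
    assume n: "\<not> c j \<le> aa j"
    have "crossing_chain E n (k + 1) (\<lambda>i. if i \<le> j then aa i else c (i - 1)) (\<lambda>i. if i \<le> j then b i else d (i - 1))"
    proof (rule chainI)
      fix p q :: nat assume pq: "p < q" "q < k + 1"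
      consider "q \<le> j" | "p \<le> j" "j < q" | "j < p" by linarith
      then show "(if p \<le> j then aa p else c (p - 1)) < (if q \<le> j then aa q else c (q - 1)) \<and>
        (if p \<le> j then b p else d (p - 1)) < (if q \<le> j then b q else d (q - 1))"
      proof cases
        case 1 then show ?thesis using pq j chain_strict_mono[OF chab, of p q] aa_mono[of p q] by auto
      next
        case 2
        have "c j \<le> c (q - 1) \<and> d j \<le> d (q - 1)"
          by (rule chain_mono_le[OF chcd]) (use 2 pq in linarith)+
        moreover have "a p \<le> a j \<and> b p \<le> b j" using chain_mono_le[OF chab 2(1) j] .
        moreover have "aa p \<le> aa j"
          using aa_mono[of p j] j 2 by (cases "p = j") auto
        ultimately show ?thesis using 2 lt n by auto
      next
        case 3 then show ?thesis using pq chain_strict_mono[OF chcd, of "p - 1" "q - 1"]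
          by auto
      qed
    next
      fix p q :: nat assume pq: "p < k + 1" "q < k + 1"
      have "v \<le> (if p \<le> j then aa p else c (p - 1)) \<and> (if p \<le> j then aa p else c (p - 1)) \<le> g"
        using aa_rng[of p] rng'[of "p - 1"] pq j by force
      moreover have "g + 1 \<le> (if q \<le> j then b q else d (q - 1)) \<and> (if q \<le> j then b q else d (q - 1)) < v + n"
        using rng'[of "q - 1"] rng[of q] pq j by auto
      ultimately show "(if p \<le> j then aa p else c (p - 1)) < (if q \<le> j then b q else d (q - 1)) \<and>
        (if q \<le> j then b q else d (q - 1)) < (if p \<le> j then aa p else c (p - 1)) + n" by linarith
    next
      fix p :: nat assume p: "p < k + 1"
      then show "E (if p \<le> j then aa p else c (p - 1)) (if p \<le> j then b p else d (p - 1))"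
        using chain_edge[OF chcd, of "p - 1"] aaE[of p] j by auto
    qed
    then show False using no_chain by blast
  qed
  have ac: "c j = a j" if "j < k" for j
    using that
  proof (induction "k - j" arbitrary: j rule: less_induct)
    case less
    show ?case
    proof (rule ccontr)
      assume "c j \<noteq> a j"
      then have lt: "c j < a j" using le[OF less.prems] by auto
      note bd = 1[OF less.prems lt]
      show False
      proof (cases "Suc j < k")
        case True
        then have "b (Suc j) < d (Suc j)"
          using bd chain_strict_mono[OF chcd, of j "Suc j"] by (auto simp: bb_def)
        then have "c (Suc j) \<le> a j" using 2[OF True] by (auto simp: aa_def)
        moreover have "c (Suc j) = a (Suc j)" using less.hyps[of "Suc j"] True by auto
        ultimately show False using chain_strict_mono[OF chab, of j "Suc j"] True by auto
      next
        case False
        then show False using bd rng'[OF less.prems] by (auto simp: bb_def)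
      qed
    qed
  qed
  have "d i = b i"
  proof (rule ccontr)
    assume "d i \<noteq> b i"
    then have "b i < d i" using le[OF i] by auto
    then show False using 2[OF i] ac[OF i] aa_mono[of i "Suc i"] i by (auto simp: aa_def)
  qed
  then show ?thesis using ac i by blast
qed

text \<open>The outer merge of the two stars lies beyond both of them, and by
  \<open>star_at_lower\<close> it equals each.\<close>

theorem star_unique:
  assumes st: "star_at v g a b" "star_at v g c d" and i: "i < k"
  shows "c i = a i \<and> d i = b i"
proof -
  have ch: "chain_at v g (g + 1) a b" "chain_at v g (g + 1) c d" using st by (auto simp: star_at_def)
  have "crossing_chain E n k (\<lambda>j. min (a j) (c j)) (\<lambda>j. max (b j) (d j))"
  proof (rule merge)
    fix i j assume "i < k" "j < k"
    then have "v < a i" "a i \<le> g" "g < b j" "b j < v + n" "v < c i" "c i \<le> g" "g < d j" "d j < v + n"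
      using ch by (auto simp: chain_at_def)
    then show "a i < d j \<and> d j < a i + n \<and> c i < b j \<and> b j < c i + n" by linarith
  qed (use ch in \<open>auto simp: chain_at_def\<close>)
  then have "chain_at v g (g + 1) (\<lambda>j. min (a j) (c j)) (\<lambda>j. max (b j) (d j))"
    using ch by (auto simp: chain_at_def)
  from star_at_lower[OF st(1) this _ i] star_at_lower[OF st(2) this _ i]
  show ?thesis by auto
qed

end

section \<open>Orientation of triples and convex position\<close>

definition orient :: "complex \<Rightarrow> complex \<Rightarrow> complex \<Rightarrow> real" where
  "orient p q r = (Re q - Re p) * (Im r - Im p) - (Im q - Im p) * (Re r - Re p)"

lemma ccw_iff: "ccw p q r \<longleftrightarrow> 0 < orient p q r"
  by (simp add: ccw_def orient_def algebra_simps)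

lemma orient_rot: "orient p q r = orient q r p"
  and orient_swap: "orient p r q = - orient p q r"
  by (simp_all add: orient_def algebra_simps)

lemma orient_same [simp]: "orient p p r = 0" "orient p q q = 0" "orient p q p = 0"
  by (simp_all add: orient_def)

lemma orient_affine:
  "orient p q ((1 - t) *\<^sub>R r + t *\<^sub>R s) = (1 - t) * orient p q r + t * orient p q s"
  by (simp add: orient_def algebra_simps)

lemma ccw_rot: "ccw p q r \<longleftrightarrow> ccw q r p"
  by (simp add: ccw_iff orient_rot[of p])

lemma orient_eq_0:
  assumes "orient p q r = 0" "p \<noteq> q"
  obtains t where "r = (1 - t) *\<^sub>R p + t *\<^sub>R q"
proof -
  obtain t where t: "t * (Re q - Re p) = Re r - Re p" "t * (Im q - Im p) = Im r - Im p"
  proof (cases "Re p = Re q")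
    case True
    then have im: "Im p \<noteq> Im q" using assms(2) complex_eqI by blast
    then have "Re r = Re p" using assms(1) True by (auto simp: orient_def)
    then show ?thesis using that[of "(Im r - Im p) / (Im q - Im p)"] True im by simp
  next
    case False
    define t where "t = (Re r - Re p) / (Re q - Re p)"
    have 1: "t * (Re q - Re p) = Re r - Re p" using False by (simp add: t_def)
    have "(t * (Im q - Im p)) * (Re q - Re p) = (t * (Re q - Re p)) * (Im q - Im p)" by simp
    also have "\<dots> = (Im r - Im p) * (Re q - Re p)"
      unfolding 1 using assms(1) by (simp add: orient_def algebra_simps)
    finally show ?thesis using that[OF 1] False by simp
  qed
  then have "r = (1 - t) *\<^sub>R p + t *\<^sub>R q" by (simp add: complex_eq_iff algebra_simps)
  then show ?thesis using that by blast
qed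

locale ngon =
  fixes C :: "complex set" and n :: nat
  assumes convex_ngon: "convex_ngon_vertices n C"
begin

lemma fin_C: "finite C" and card_C: "card C = n" and n_ge_3: "3 \<le> n"
  using convex_ngon by (auto simp: convex_ngon_vertices_def)

lemma not_in_hull:
  assumes "p \<in> C" shows "p \<notin> convex hull (C - {p})"
proof -
  have "p extreme_point_of (convex hull C)"
    using convex_ngon assms by (auto simp: convex_ngon_vertices_def)
  then have "convex (convex hull C - {p})"
    by (simp add: extreme_point_of_stillconvex)
  moreover have "C - {p} \<subseteq> convex hull C - {p}" using hull_subset[of C convex] by auto
  ultimately have "convex hull (C - {p}) \<subseteq> convex hull C - {p}" by (rule hull_minimal[rotated])
  then show ?thesis by blast
qed

text \<open>The weights are left unnormalised so that signed areas can be inserted as they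
  are.\<close>

lemma no_convex_combination:
  assumes C: "p \<in> C" "q \<in> C" "r \<in> C" "s \<in> C" "s \<noteq> p" "s \<noteq> q" "s \<noteq> r"
    and abc: "0 \<le> a" "0 \<le> b" "0 \<le> c" "0 < a + b + c"
  shows "(a + b + c) *\<^sub>R s \<noteq> a *\<^sub>R p + b *\<^sub>R q + c *\<^sub>R r"
proof
  define d where "d = a + b + c"
  assume s: "(a + b + c) *\<^sub>R s = a *\<^sub>R p + b *\<^sub>R q + c *\<^sub>R r"
  have d: "0 < d" using abc by (simp add: d_def)
  have "s = (1 / d) *\<^sub>R (d *\<^sub>R s)" using d by simp
  also have "\<dots> = (a / d) *\<^sub>R p + (b / d) *\<^sub>R q + (c / d) *\<^sub>R r"
    unfolding d_def s by (simp add: scaleR_add_right)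
  finally have "s = (a / d) *\<^sub>R p + (b / d) *\<^sub>R q + (c / d) *\<^sub>R r" .
  moreover have "a / d + b / d + c / d = 1"
    using d by (simp add: add_divide_distrib[symmetric]) (simp add: d_def)
  moreover have "0 \<le> a / d" "0 \<le> b / d" "0 \<le> c / d" using d abc by auto
  ultimately have "s \<in> convex hull {p, q, r}"
    unfolding convex_hull_3 by blast
  moreover have "convex hull {p, q, r} \<subseteq> convex hull (C - {s})"
    using C by (intro hull_mono) auto
  ultimately show False using not_in_hull C by blast
qed

lemma no_three_collinear:
  assumes pqr: "p \<in> C" "q \<in> C" "r \<in> C" "p \<noteq> q" "p \<noteq> r" "q \<noteq> r"
  shows "orient p q r \<noteq> 0"
proof
  assume "orient p q r = 0"
  then obtain t where t: "r = (1 - t) *\<^sub>R p + t *\<^sub>R q" using orient_eq_0 pqr by metis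
  consider "t < 0" | "0 \<le> t" "t \<le> 1" | "1 < t" by linarith
  then show False
  proof cases
    case 1
    have "(1 + - t + 0) *\<^sub>R p = 1 *\<^sub>R r + (- t) *\<^sub>R q + 0 *\<^sub>R q"
      using t by (simp add: algebra_simps)
    then show False using no_convex_combination[of r q q p 1 "- t" 0] pqr 1 by auto
  next
    case 2
    have "((1 - t) + t + 0) *\<^sub>R r = (1 - t) *\<^sub>R p + t *\<^sub>R q + 0 *\<^sub>R q"
      unfolding t by simp
    then show False using no_convex_combination[of p q q r "1 - t" t 0] pqr 2 by auto
  next
    case 3
    have "(1 + (t - 1) + 0) *\<^sub>R q = 1 *\<^sub>R r + (t - 1) *\<^sub>R p + 0 *\<^sub>R p"
      using t by (simp add: algebra_simps)
    then show False using no_convex_combination[of r p p q 1 "t - 1" 0] pqr 3 by auto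
  qed
qed

text \<open>The signed areas of the four triangles are the coefficients of the affine dependence
  among the four points. A wrong sign of \<open>orient q r s\<close> would make \<open>r\<close>,
  and a wrong sign of \<open>orient p q s\<close> would make \<open>p\<close>, a convex combination
  of the others.\<close>

lemma ccw_trans:
  assumes C: "p \<in> C" "q \<in> C" "r \<in> C" "s \<in> C" and 1: "ccw p q r" and 2: "ccw p r s"
  shows "ccw q r s" and "ccw p q s"
proof -
  have pos: "0 < orient p q r" "0 < orient p r s" using 1 2 by (auto simp: ccw_iff)
  have sum: "orient p q r + orient p r s = orient p q s + orient q r s"
    by (simp add: orient_def algebra_simps)
  have ne: "r \<noteq> p" "r \<noteq> q" "r \<noteq> s" "p \<noteq> q" "p \<noteq> s" using pos by auto
  show qrs: "ccw q r s"
  proof (rule ccontr)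
    assume "\<not> ccw q r s"
    then have le: "orient q r s \<le> 0" by (simp add: ccw_iff)
    then have D: "0 < orient p q s" using sum pos by linarith
    have "orient p q s * Re r = - orient q r s * Re p + orient p r s * Re q + orient p q r * Re s"
      "orient p q s * Im r = - orient q r s * Im p + orient p r s * Im q + orient p q r * Im s"
      by (simp_all add: orient_def algebra_simps)
    moreover have e: "- orient q r s + orient p r s + orient p q r = orient p q s" using sum by simp
    ultimately have "(- orient q r s + orient p r s + orient p q r) *\<^sub>R r
        = (- orient q r s) *\<^sub>R p + orient p r s *\<^sub>R q + orient p q r *\<^sub>R s"
      unfolding e by (simp add: complex_eq_iff)
    then show False
      using no_convex_combination[of p q s r "- orient q r s" "orient p r s" "orient p q r"]
        C ne le pos by auto
  qed
  show "ccw p q s"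
  proof (rule ccontr)
    assume "\<not> ccw p q s"
    then have le: "orient p q s \<le> 0" by (simp add: ccw_iff)
    have "orient q r s * Re p = orient p r s * Re q - orient p q s * Re r + orient p q r * Re s"
      "orient q r s * Im p = orient p r s * Im q - orient p q s * Im r + orient p q r * Im s"
      by (simp_all add: orient_def algebra_simps)
    moreover have e: "orient p r s + - orient p q s + orient p q r = orient q r s" using sum by simp
    ultimately have "(orient p r s + - orient p q s + orient p q r) *\<^sub>R p
        = orient p r s *\<^sub>R q + (- orient p q s) *\<^sub>R r + orient p q r *\<^sub>R s"
      unfolding e by (simp add: complex_eq_iff)
    then show False
      using no_convex_combination[of q r s p "orient p r s" "- orient p q s" "orient p q r"]
        C ne le pos by auto
  qed
qed

lemma ccw_total:
  assumes "p \<in> C" "q \<in> C" "r \<in> C" "p \<noteq> q" "p \<noteq> r" "q \<noteq> r"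
  shows "ccw p q r \<longleftrightarrow> \<not> ccw p r q"
  using no_three_collinear[OF assms] orient_swap[of p r q] by (auto simp: ccw_iff)

lemma ccw_distinct: "ccw p q r \<Longrightarrow> p \<noteq> q \<and> p \<noteq> r \<and> q \<noteq> r"
  by (auto simp: ccw_iff)

section \<open>Cyclic enumeration\<close>

definition cyclic_enumeration :: "(int \<Rightarrow> complex) \<Rightarrow> bool" where
  "cyclic_enumeration c \<longleftrightarrow> range c = C \<and> (\<forall>i j. c i = c j \<longleftrightarrow> i mod int n = j mod int n) \<and>
     (\<forall>i j l. i < j \<longrightarrow> j < l \<longrightarrow> l < i + int n \<longrightarrow> ccw (c i) (c j) (c l))"

text \<open>Seen from a fixed vertex \<open>p0\<close>, counterclockwise order is linear by
  \<open>ccw_trans\<close>, so the other vertices can be ranked by their number of predecessors. The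
  list is continued periodically to all integers, which supplies the lifted positions.\<close>

lemma cyclic_enumeration_ex: "\<exists>c. cyclic_enumeration c"
proof -
  obtain p0 where p0: "p0 \<in> C" using card_C n_ge_3 by (metis card.empty not_numeral_le_zero ex_in_conv)
  define D where "D = C - {p0}"
  have D: "finite D" "card D = n - 1" "p0 \<notin> D" "D \<subseteq> C" using fin_C card_C p0 by (auto simp: D_def)
  define pos where "pos q = card {r \<in> D. ccw p0 r q}" for q
  have pos_mono: "pos q < pos r" if "q \<in> D" "r \<in> D" "ccw p0 q r" for q r
  proof -
    have "{s \<in> D. ccw p0 s q} \<subset> {s \<in> D. ccw p0 s r}"
    proof
      show "{s \<in> D. ccw p0 s q} \<subseteq> {s \<in> D. ccw p0 s r}"
        using ccw_trans(2)[OF p0 _ _ _ _ that(3)] D that by blast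
      have "q \<notin> {s \<in> D. ccw p0 s q}" using ccw_distinct by blast
      then show "{s \<in> D. ccw p0 s q} \<noteq> {s \<in> D. ccw p0 s r}" using that by blast
    qed
    then show ?thesis unfolding pos_def using D by (intro psubset_card_mono) auto
  qed
  have pos_iff: "ccw p0 q r \<longleftrightarrow> pos q < pos r" if "q \<in> D" "r \<in> D" for q r
  proof (cases "q = r")
    case True then show ?thesis using ccw_distinct by auto
  next
    case False
    then have "ccw p0 q r \<or> ccw p0 r q" using ccw_total[of p0 q r] that D p0 by (auto simp: D_def)
    then show ?thesis using pos_mono[of q r] pos_mono[of r q] that by force
  qed
  have inj: "inj_on pos D"
  proof (rule inj_onI)
    fix q r assume "q \<in> D" "r \<in> D" "pos q = pos r"
    then show "q = r" using pos_iff[of q r] pos_iff[of r q] ccw_total[of p0 q r] p0 D by auto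
  qed
  have "pos q < n - 1" if "q \<in> D" for q
  proof -
    have "{r \<in> D. ccw p0 r q} \<subset> D" using that ccw_distinct by blast
    then show ?thesis unfolding pos_def using D psubset_card_mono by metis
  qed
  then have "pos ` D \<subseteq> {..<n - 1}" by auto
  moreover have "card (pos ` D) = n - 1" using inj D by (simp add: card_image)
  ultimately have im: "pos ` D = {..<n - 1}" by (intro card_subset_eq) auto
  \<comment> \<open>Index 0 belongs to \<open>p0\<close>, so the vertex of rank \<open>r\<close>
    gets index \<open>r + 1\<close>.\<close>
  define e where "e i = (if i = 0 then p0 else inv_into D pos (nat i - 1))" for i :: int
  have eD: "e i \<in> D \<and> pos (e i) = nat i - 1" if "0 < i" "i < int n" for i
  proof -
    have "nat i - 1 \<in> pos ` D" using that im by auto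
    then show ?thesis using that inv_into_into[of "nat i - 1" pos D] f_inv_into_f[of "nat i - 1" pos D] by (simp add: e_def)
  qed
  have eC: "e i \<in> C" if "0 \<le> i" "i < int n" for i
    using eD[of i] that p0 D by (cases "i = 0") (auto simp: e_def)
  have base: "ccw (e i) (e j) (e l)" if "0 \<le> i" "i < j" "j < l" "l < int n" for i j l
  proof -
    have lt: "ccw p0 (e a) (e b)" if "0 < a" "a < b" "b < int n" for a b
      using pos_iff[of "e a" "e b"] eD[of a] eD[of b] that by auto
    show ?thesis
    proof (cases "i = 0")
      case True then show ?thesis using lt[of j l] that by (simp add: e_def)
    next
      case False then show ?thesis
        using ccw_trans(1)[OF p0 _ _ _ lt[of i j] lt[of j l]] that eC by auto
    qed
  qed
  have einj: "i = j" if "0 \<le> i" "i < int n" "0 \<le> j" "j < int n" "e i = e j" for i j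
  proof (rule ccontr)
    assume "i \<noteq> j"
    moreover have False if "0 \<le> a" "a < b" "b < int n" "e a = e b" for a b
      using eD[of a] eD[of b] that D by (cases "a = 0") (auto simp: e_def)
    ultimately show False using that by (metis linorder_neqE)
  qed
  define c where "c i = e (i mod int n)" for i
  have npos: "0 < int n" using n_ge_3 by auto
  have md: "0 \<le> i mod int n \<and> i mod int n < int n" for i using npos by auto
  have "range c = C"
  proof
    show "range c \<subseteq> C" using eC md by (auto simp: c_def)
    show "C \<subseteq> range c"
    proof
      fix q assume q: "q \<in> C"
      show "q \<in> range c"
      proof (cases "q = p0")
        case True
        then have "q = c 0" by (simp add: c_def e_def)
        then show ?thesis by blast
      next
        case False
        then have qD: "q \<in> D" using q by (simp add: D_def)
        then have lt: "pos q < n - 1" using im by auto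
        then have "e (int (pos q) + 1) \<in> D \<and> pos (e (int (pos q) + 1)) = pos q"
          using eD[of "int (pos q) + 1"] by auto
        then have "q = e (int (pos q) + 1)" using inj qD by (auto dest: inj_onD)
        also have "\<dots> = c (int (pos q) + 1)" using lt by (simp add: c_def)
        finally show ?thesis by blast
      qed
    qed
  qed
  moreover have "c i = c j \<longleftrightarrow> i mod int n = j mod int n" for i j
    using einj[of "i mod int n" "j mod int n"] md by (auto simp: c_def)
  moreover have "ccw (c i) (c j) (c l)" if "i < j" "j < l" "l < i + int n" for i j l
  proof -
    define t where "t = n * (i div int n)"
    define i' where "i' = i mod int n"
    define j' where "j' = j - i + i'"
    define l' where "l' = l - i + i'"
    have ii: "i = i' + int n * (i div int n)" by (simp add: i'_def)
    then have jj: "j = j' + int n * (i div int n)" and ll: "l = l' + int n * (i div int n)"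
      by (auto simp: j'_def l'_def)
    have rng: "0 \<le> i'" "i' < int n" "i' < j'" "j' < l'" "l' < i' + int n"
      using that md by (auto simp: i'_def j'_def l'_def)
    have ci: "c i = e i'" "c j = e (j' mod int n)" "c l = e (l' mod int n)"
      by (subst ii jj ll, simp add: c_def i'_def)+
    have wrap: "x mod int n = x - int n" if "int n \<le> x" "x < 2 * int n" for x
      using that by (metis add_diff_cancel_right' diff_add_cancel diff_ge_0_iff_ge diff_less_eq
          mod_add_self2 mod_pos_pos_trivial mult_2)
    \<comment> \<open>None, one or two of the indices reach \<open>n\<close>; after reduction the
      triple is a rotation of an increasing one.\<close>
    consider "l' < int n" | "j' < int n" "int n \<le> l'" | "int n \<le> j'" by linarith
    then show ?thesis
    proof cases
      case 1 then show ?thesis using base[of i' j' l'] rng by (simp add: ci)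
    next
      case 2 then show ?thesis using base[of "l' - int n" i' j'] rng wrap[of l']
        by (simp add: ci ccw_rot[of "e (l' - int n)"])
    next
      case 3 then show ?thesis using base[of "j' - int n" "l' - int n" i'] rng wrap[of l'] wrap[of j']
        by (simp add: ci ccw_rot[of "e i'"])
    qed
  qed
  ultimately have "cyclic_enumeration c" unfolding cyclic_enumeration_def by blast
  then show ?thesis by blast
qed

definition vtx :: "int \<Rightarrow> complex" where
  "vtx = (SOME c. cyclic_enumeration c)"

lemma cyclic_enumeration_vtx: "cyclic_enumeration vtx"
  unfolding vtx_def using someI_ex[OF cyclic_enumeration_ex] .

lemma range_vtx: "range vtx = C"
  and vtx_eq_iff: "vtx i = vtx j \<longleftrightarrow> i mod int n = j mod int n"
  and ccw_vtx: "i < j \<Longrightarrow> j < l \<Longrightarrow> l < i + int n \<Longrightarrow> ccw (vtx i) (vtx j) (vtx l)"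
  using cyclic_enumeration_vtx by (auto simp: cyclic_enumeration_def)

lemma vtx_in_C [simp]: "vtx i \<in> C"
  using range_vtx by blast

lemma vtx_add_n [simp]: "vtx (i + int n) = vtx i"
  by (simp add: vtx_eq_iff)

lemma vtx_inj: "vtx i = vtx j \<Longrightarrow> a \<le> i \<Longrightarrow> i < a + int n \<Longrightarrow> a \<le> j \<Longrightarrow> j < a + int n \<Longrightarrow> i = j"
proof -
  assume "vtx i = vtx j" and r: "a \<le> i" "i < a + int n" "a \<le> j" "j < a + int n"
  then have "int n dvd i - j" by (simp add: vtx_eq_iff mod_eq_dvd_iff)
  moreover have "\<bar>i - j\<bar> < int n" using r by linarith
  ultimately show "i = j" using zdvd_imp_le[of "int n" "\<bar>i - j\<bar>"] by auto
qed

lemma vtx_surj: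
  assumes "p \<in> C"
  obtains i where "a \<le> i" "i < a + int n" "vtx i = p"
proof -
  obtain i where i: "p = vtx i" using assms range_vtx by blast
  have npos: "0 < int n" using n_ge_3 by auto
  have "vtx (a + (i - a) mod int n) = p"
    unfolding i by (simp add: vtx_eq_iff mod_simps)
  then show ?thesis using that[of "a + (i - a) mod int n"] npos by auto
qed

lemma ccw_vtx_iff:
  assumes "v < i" "i < v + int n" "v < j" "j < v + int n"
  shows "ccw (vtx v) (vtx i) (vtx j) \<longleftrightarrow> i < j"
proof -
  have "\<not> ccw (vtx v) (vtx i) (vtx j)" if "j < i"
    using ccw_vtx[of v j i] that assms by (simp add: ccw_iff orient_swap[of "vtx v" "vtx j"])
  then show ?thesis using ccw_vtx[of v i j] assms ccw_distinct
    by (metis linorder_neqE)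
qed

section \<open>Crossing edges\<close>

text \<open>In convex position it is enough that \<open>r\<close> and \<open>s\<close> lie strictly
  on opposite sides of the line through \<open>p\<close> and \<open>q\<close>: by
  \<open>ccw_trans\<close> the line through \<open>r\<close> and \<open>s\<close> then separates
  \<open>p\<close> and \<open>q\<close> as well, so the lines intersect in the interior of both
  segments.\<close>

lemma edges_cross_iff:
  assumes C: "p \<in> C" "q \<in> C" "r \<in> C" "s \<in> C" "p \<noteq> q" "r \<noteq> s"
  shows "edges_cross {p, q} {r, s} \<longleftrightarrow> orient p q r * orient p q s < 0"
proof
  assume "edges_cross {p, q} {r, s}"
  then have "{p, q} \<noteq> {r, s}" and "open_segment p q \<inter> open_segment r s \<noteq> {}"
    unfolding edges_cross_def by (auto simp: doubleton_eq_iff open_segment_commute)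
  then obtain z where ne: "{p, q} \<noteq> {r, s}" and "z \<in> open_segment p q" "z \<in> open_segment r s"
    by blast
  then obtain a b where ab: "0 < b" "b < 1"
    and z: "z = (1 - a) *\<^sub>R p + a *\<^sub>R q" "z = (1 - b) *\<^sub>R r + b *\<^sub>R s"
    unfolding in_segment by blast
  have "orient p q z = 0" unfolding z(1) orient_affine by simp
  then have eq: "(1 - b) * orient p q r + b * orient p q s = 0" unfolding z(2) orient_affine by simp
  have zero: "x = p \<or> x = q" if "x \<in> C" "orient p q x = 0" for x
    using no_three_collinear[of p q x] that C by auto
  have "orient p q r \<noteq> 0"
  proof
    assume "orient p q r = 0"
    moreover from this have "orient p q s = 0" using eq ab by auto
    ultimately show False using zero[of r] zero[of s] ne C by auto
  qed
  then show "orient p q r * orient p q s < 0"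
  proof -
    have "orient p q s = - ((1 - b) / b) * orient p q r" using eq ab by (simp add: field_simps)
    then have e: "orient p q r * orient p q s = - ((1 - b) / b) * (orient p q r * orient p q r)" by simp
    have "0 < (1 - b) / b" using ab by simp
    moreover have "0 < orient p q r * orient p q r"
      using \<open>orient p q r \<noteq> 0\<close> by (metis not_real_square_gt_zero)
    ultimately have "0 < (1 - b) / b * (orient p q r * orient p q r)" by (rule mult_pos_pos)
    then show ?thesis using e by simp
  qed
next
  have main: "edges_cross {p, q} {r, s}"
    if C: "p \<in> C" "q \<in> C" "r \<in> C" "s \<in> C" "p \<noteq> q" "r \<noteq> s" and pos: "0 < orient p q r" and neg: "orient p q s < 0"
    for p q r s
  proof -
    have 1: "ccw p s q" "ccw p q r" using pos neg orient_swap[of p s q] by (auto simp: ccw_iff)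
    have "ccw s q r" "ccw p s r" using ccw_trans[OF _ _ _ _ 1] C by auto
    then have p: "0 < orient s r p" and q: "orient s r q < 0"
      using orient_rot[of p s r] orient_swap[of s r q] by (auto simp: ccw_iff)
    \<comment> \<open>The zero of the affine function \<open>orient s r\<close> along the segment
      from \<open>p\<close> to \<open>q\<close>.\<close>
    define a where "a = orient s r p / (orient s r p - orient s r q)"
    have a: "0 < a" "a < 1" using p q by (auto simp: a_def field_simps)
    define z where "z = (1 - a) *\<^sub>R p + a *\<^sub>R q"
    have "orient s r z = 0"
      unfolding z_def orient_affine a_def using p q by (simp add: field_simps)
    then obtain b where b: "z = (1 - b) *\<^sub>R s + b *\<^sub>R r" using orient_eq_0 C by metis
    have "orient p q z = 0" unfolding z_def orient_affine by simp
    then have eq: "(1 - b) * orient p q s + b * orient p q r = 0" unfolding b orient_affine by simp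
    have "0 < b"
    proof (rule ccontr)
      assume "\<not> 0 < b"
      then have "(1 - b) * orient p q s < 0" "b * orient p q r \<le> 0"
        using neg pos by (auto intro: mult_pos_neg mult_nonpos_nonneg)
      then show False using eq by linarith
    qed
    moreover have "b < 1"
    proof (rule ccontr)
      assume "\<not> b < 1"
      then have "0 \<le> (1 - b) * orient p q s" "0 < b * orient p q r"
        using neg pos by (auto intro: mult_nonpos_nonpos)
      then show False using eq by linarith
    qed
    ultimately have "z \<in> open_segment p q \<inter> open_segment s r"
      using a b z_def C by (auto simp: in_segment)
    moreover have "{p, q} \<noteq> {r, s}" using pos neg by (auto simp: doubleton_eq_iff)
    ultimately show ?thesis unfolding edges_cross_def
      by (intro exI[of _ p] exI[of _ q] exI[of _ s] exI[of _ r]) auto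
  qed
  assume "orient p q r * orient p q s < 0"
  then consider "0 < orient p q r" "orient p q s < 0" | "orient p q r < 0" "0 < orient p q s"
    by (auto simp: mult_less_0_iff)
  then show "edges_cross {p, q} {r, s}"
    using main[of p q r s] main[of p q s r] C by cases (auto simp: insert_commute)
qed

definition lift_edges :: "complex set set \<Rightarrow> int \<Rightarrow> int \<Rightarrow> bool" where
  "lift_edges T x y \<longleftrightarrow> x < y \<and> y < x + int n \<and> {vtx x, vtx y} \<in> T"

lemma lift_edges_rot: "lift_edges T x y \<longleftrightarrow> lift_edges T y (x + int n)"
  by (auto simp: lift_edges_def insert_commute)

lemma edge_in_edges: "x < y \<Longrightarrow> y < x + int n \<Longrightarrow> {vtx x, vtx y} \<in> edges C"
proof -
  assume "x < y" "y < x + int n"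
  then have "vtx x \<noteq> vtx y" using vtx_inj[of x y x] by auto
  then show ?thesis unfolding edges_def using vtx_in_C by blast
qed

lemma orient_vtx_neg: "x < s \<Longrightarrow> s < y \<Longrightarrow> y < x + int n \<Longrightarrow> orient (vtx x) (vtx y) (vtx s) < 0"
  using ccw_vtx[of x s y] by (simp add: ccw_iff orient_swap[of "vtx x" "vtx s"])

lemma orient_vtx_pos: "x < y \<Longrightarrow> y < s \<Longrightarrow> s < x + int n \<Longrightarrow> 0 < orient (vtx x) (vtx y) (vtx s)"
  using ccw_vtx[of x y s] by (simp add: ccw_iff)

lemma chords_cross_iff:
  assumes "x < y" "y < x + int n" "s \<noteq> t" "x \<le> s" "s < x + int n" "x \<le> t" "t < x + int n"
  shows "edges_cross {vtx x, vtx y} {vtx s, vtx t} \<longleftrightarrow>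
    (x < s \<and> s < y \<and> y < t) \<or> (x < t \<and> t < y \<and> y < s)"
proof -
  have ne: "vtx x \<noteq> vtx y" "vtx s \<noteq> vtx t"
    using vtx_inj[of x y x] vtx_inj[of s t x] assms by auto
  have sgn: "orient (vtx x) (vtx y) (vtx r) < 0 \<longleftrightarrow> x < r \<and> r < y"
    "0 < orient (vtx x) (vtx y) (vtx r) \<longleftrightarrow> y < r" if r: "x \<le> r" "r < x + int n" for r
  proof -
    consider "r = x" | "x < r" "r < y" | "r = y" | "y < r" using r by linarith
    then have "(orient (vtx x) (vtx y) (vtx r) < 0 \<longleftrightarrow> x < r \<and> r < y) \<and>
      (0 < orient (vtx x) (vtx y) (vtx r) \<longleftrightarrow> y < r)"
      using orient_vtx_neg[of x r y] orient_vtx_pos[of x y r] r(2) assms(1,2)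
      by cases auto
    then show "orient (vtx x) (vtx y) (vtx r) < 0 \<longleftrightarrow> x < r \<and> r < y"
      "0 < orient (vtx x) (vtx y) (vtx r) \<longleftrightarrow> y < r" by auto
  qed
  show ?thesis
    using edges_cross_iff[of "vtx x" "vtx y" "vtx s" "vtx t"] ne sgn[of s] sgn[of t] assms
    by (auto simp: mult_less_0_iff)
qed

lemma edges_cross_sym: "edges_cross e f \<longleftrightarrow> edges_cross f e"
  unfolding edges_cross_def by (metis Int_commute)

lemma is_crossing_of_chain:
  assumes ch: "crossing_chain (lift_edges T) (int n) r x y" and T: "T \<subseteq> edges C"
  shows "\<exists>X\<subseteq>T. is_crossing r C X"
proof -
  define e where "e i = {vtx (x i), vtx (y i)}" for i
  have cr: "edges_cross (e i) (e j)" if "i < j" "j < r" for i j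
  proof -
    have "x i < x j" "y i < y j" "x j < y i" "y j < x i + int n"
      using chain_strict_mono[OF ch that] chain_box[OF ch, of j i] chain_box[OF ch, of i j] that by auto
    then show ?thesis unfolding e_def by (subst chords_cross_iff) auto
  qed
  then have cr': "edges_cross (e i) (e j)" if "i \<noteq> j" "i < r" "j < r" for i j
    using that edges_cross_sym by (metis linorder_neqE_nat)
  have "inj_on e {..<r}"
  proof (rule inj_onI)
    fix i j assume ij: "i \<in> {..<r}" "j \<in> {..<r}" "e i = e j"
    show "i = j"
    proof (rule ccontr)
      assume "i \<noteq> j"
      then have "edges_cross (e i) (e j)" using cr'[of i j] ij(1,2) by simp
      then show False using ij by (auto simp: edges_cross_def)
    qed
  qed
  moreover have "edges_cross f g" if fg: "f \<in> e ` {..<r}" "g \<in> e ` {..<r}" "f \<noteq> g" for f g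
  proof -
    obtain i j where "f = e i" "g = e j" "i < r" "j < r" using fg by blast
    then show ?thesis using cr'[of i j] fg(3) by metis
  qed
  moreover have "e ` {..<r} \<subseteq> T" using chain_edge[OF ch] by (auto simp: e_def lift_edges_def)
  ultimately have "is_crossing r C (e ` {..<r})"
    using T unfolding is_crossing_def by (simp add: card_image)
  then show ?thesis using \<open>e ` {..<r} \<subseteq> T\<close> by blast
qed

text \<open>Every edge of \<open>Y\<close> has one end strictly between \<open>x\<close> and
  \<open>y\<close> and the other strictly beyond \<open>y\<close>. As the edges cross each other,
  near ends and far ends come in the same order, so sorting by near ends gives the chain.\<close>

lemma chain_of_crossing:
  assumes xy: "x < y" "y < x + int n" and Y: "is_crossing r C Y" "Y \<subseteq> T"
    and cross: "\<And>e. e \<in> Y \<Longrightarrow> edges_cross {vtx x, vtx y} e"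
  shows "\<exists>c d. crossing_chain (lift_edges T) (int n) r c d \<and>
    (\<forall>i<r. x < c i \<and> c i < y \<and> y < d i \<and> d i < x + int n)"
proof -
  have "\<exists>s t. e = {vtx s, vtx t} \<and> x < s \<and> s < y \<and> y < t \<and> t < x + int n" if "e \<in> Y" for e
  proof -
    have "e \<in> edges C" using that Y by (auto simp: is_crossing_def)
    then obtain p q where pq: "e = {p, q}" "p \<in> C" "q \<in> C" "p \<noteq> q"
      unfolding edges_def mem_Collect_eq by blast
    obtain s where s: "x \<le> s" "s < x + int n" "vtx s = p" using vtx_surj pq by blast
    obtain t where t: "x \<le> t" "t < x + int n" "vtx t = q" using vtx_surj pq by blast
    have "s \<noteq> t" using s t pq by auto
    then have "(x < s \<and> s < y \<and> y < t) \<or> (x < t \<and> t < y \<and> y < s)"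
      using cross[OF that] chords_cross_iff[OF xy _ s(1,2) t(1,2)] pq s t by auto
    then show ?thesis
    proof
      assume "x < s \<and> s < y \<and> y < t"
      then show ?thesis using pq s t by blast
    next
      assume "x < t \<and> t < y \<and> y < s"
      then have "e = {vtx t, vtx s} \<and> x < t \<and> t < y \<and> y < s \<and> s < x + int n"
        using pq s t by (simp add: insert_commute)
      then show ?thesis by blast
    qed
  qed
  then obtain s t where st: "\<And>e. e \<in> Y \<Longrightarrow> e = {vtx (s e), vtx (t e)} \<and> x < s e \<and> s e < y \<and> y < t e \<and> t e < x + int n"
    by metis
  have mono: "t e < t f" if "e \<in> Y" "f \<in> Y" "s e < s f" for e f
  proof -
    have "e \<noteq> f" using that by auto
    then have "edges_cross e f" using that Y by (auto simp: is_crossing_def)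
    then have "edges_cross {vtx (s e), vtx (t e)} {vtx (s f), vtx (t f)}" using st that by metis
    then show ?thesis using chords_cross_iff[of "s e" "t e" "s f" "t f"] st[of e] st[of f] that by auto
  qed
  have inj: "inj_on s Y"
  proof (rule inj_onI, rule ccontr)
    fix e f assume ef: "e \<in> Y" "f \<in> Y" "s e = s f" "e \<noteq> f"
    then have "edges_cross e f" using Y by (auto simp: is_crossing_def)
    then have "edges_cross {vtx (s e), vtx (t e)} {vtx (s f), vtx (t f)}" using st ef by metis
    then show False using chords_cross_iff[of "s e" "t e" "s f" "t f"] st[of e] st[of f] ef by auto
  qed
  have finY: "finite Y" "card Y = r" using Y by (auto simp: is_crossing_def)
  define xs where "xs = sorted_list_of_set (s ` Y)"
  have xs: "set xs = s ` Y" "length xs = r" "sorted_wrt (<) xs"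
    using finY inj by (auto simp: xs_def card_image)
  define f where "f i = inv_into Y s (xs ! i)" for i
  have f: "f i \<in> Y" "s (f i) = xs ! i" if "i < r" for i
  proof -
    have "xs ! i \<in> s ` Y" using that xs nth_mem by metis
    then show "f i \<in> Y" "s (f i) = xs ! i" by (auto simp: f_def inv_into_into f_inv_into_f)
  qed
  have inc: "s (f i) < s (f j)" if "i < j" "j < r" for i j
    using f[of i] f[of j] that xs sorted_wrt_nth_less[OF xs(3)] by auto
  have "crossing_chain (lift_edges T) (int n) r (\<lambda>i. s (f i)) (\<lambda>i. t (f i))"
  proof (rule chainI)
    fix i j :: nat assume "i < j" "j < r"
    then show "s (f i) < s (f j) \<and> t (f i) < t (f j)"
      using inc mono[of "f i" "f j"] f by auto
  next
    fix i j :: nat assume "i < r" "j < r"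
    then show "s (f i) < t (f j) \<and> t (f j) < s (f i) + int n"
      using st[OF f(1)[of i]] st[OF f(1)[of j]] by auto
  next
    fix i assume "i < r"
    then show "lift_edges T (s (f i)) (t (f i))"
      using st[OF f(1)[of i]] f(1)[of i] Y(2) by (auto simp: lift_edges_def)
  qed
  then show ?thesis using st f by (intro exI[of _ "\<lambda>i. s (f i)"] exI[of _ "\<lambda>i. t (f i)"]) blast
qed

text \<open>Maximality in chain form: adding a missing edge creates a
  \<open>(k + 1)\<close>-crossing, which must contain that edge, and its other \<open>k\<close>
  members are chords crossing it.\<close>

lemma lifted_triangulation:
  assumes T: "k_triangulation k C T" and k: "1 \<le> k"
  shows "lifted_triangulation (lift_edges T) (int n) k"
proof
  have TC: "T \<subseteq> edges C" and free: "crossing_free (k + 1) C T"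
    using T by (auto simp: k_triangulation_def)
  show "lift_edges T x y \<longleftrightarrow> lift_edges T y (x + int n)" for x y by (rule lift_edges_rot)
  show "\<not> crossing_chain (lift_edges T) (int n) (k + 1) a b" for a b
    using is_crossing_of_chain[of T "k + 1" a b] TC free unfolding crossing_free_def by blast
  show "1 \<le> k" by (rule k)
  fix x y :: int assume xy: "x < y" "y < x + int n" "\<not> lift_edges T x y"
  define e where "e = {vtx x, vtx y}"
  have e: "e \<in> edges C" "e \<notin> T" using edge_in_edges xy by (auto simp: e_def lift_edges_def)
  have "\<not> crossing_free (k + 1) C (insert e T)"
  proof
    assume "crossing_free (k + 1) C (insert e T)"
    moreover have "T \<subseteq> insert e T" "insert e T \<subseteq> edges C" using TC e by auto
    ultimately have "insert e T = T" using T unfolding k_triangulation_def by blast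
    then show False using e by auto
  qed
  then obtain X where X: "X \<subseteq> insert e T" "is_crossing (k + 1) C X"
    by (auto simp: crossing_free_def)
  have eX: "e \<in> X"
  proof (rule ccontr)
    assume "e \<notin> X"
    then have "X \<subseteq> T" using X by auto
    then show False using X free by (auto simp: crossing_free_def)
  qed
  have "is_crossing k C (X - {e})"
    using X eX by (auto simp: is_crossing_def)
  then show "\<exists>c d. crossing_chain (lift_edges T) (int n) k c d \<and>
      (\<forall>i<k. x < c i \<and> c i < y \<and> y < d i \<and> d i < x + int n)"
  proof (rule chain_of_crossing[OF xy(1,2)])
    show "X - {e} \<subseteq> T" using X by auto
    fix f assume "f \<in> X - {e}"
    then show "edges_cross {vtx x, vtx y} f" using X eX by (auto simp: is_crossing_def e_def)
  qed
qed

section \<open>Lifted stars\<close>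

text \<open>A star cut open at one vertex \<open>v\<close>: the next \<open>k\<close> vertices are
  \<open>a\<close>, the last \<open>k\<close> are \<open>b\<close>, and the sides of the angle at
  \<open>v\<close> end at \<open>a (k - 1)\<close> and \<open>b 0\<close>.\<close>

definition star_pos :: "nat \<Rightarrow> int \<Rightarrow> (nat \<Rightarrow> int) \<Rightarrow> (nat \<Rightarrow> int) \<Rightarrow> bool" where
  "star_pos k v a b \<longleftrightarrow> (\<forall>i j. i < j \<longrightarrow> j < k \<longrightarrow> a i < a j \<and> b i < b j) \<and>
     (\<forall>i<k. \<forall>j<k. v < a i \<and> a i < b j \<and> b j < v + int n)"

text \<open>The edges joining the vertices \<open>j\<close> and \<open>j + k\<close> of
  \<open>star_seq\<close>, in the groups \<open>j = 0\<close>, \<open>j = k + 1\<close>,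
  \<open>1 \<le> j \<le> k\<close> and \<open>k + 2 \<le> j\<close>.\<close>

definition star_set :: "nat \<Rightarrow> int \<Rightarrow> (nat \<Rightarrow> int) \<Rightarrow> (nat \<Rightarrow> int) \<Rightarrow> complex set set" where
  "star_set k v a b = {{vtx v, vtx (a (k - 1))}, {vtx v, vtx (b 0)}} \<union>
     (\<lambda>i. {vtx (a i), vtx (b i)}) ` {..<k} \<union> (\<lambda>i. {vtx (a i), vtx (b (Suc i))}) ` {i. Suc i < k}"

definition star_seq :: "nat \<Rightarrow> int \<Rightarrow> (nat \<Rightarrow> int) \<Rightarrow> (nat \<Rightarrow> int) \<Rightarrow> nat \<Rightarrow> int" where
  "star_seq k v a b j = (if j = 0 then v else if j \<le> k then a (j - 1) else b (j - k - 1))"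

lemma star_seq_mono:
  assumes "star_pos k v a b" "i < j" "j < 2 * k + 1"
  shows "star_seq k v a b i < star_seq k v a b j" "star_seq k v a b j < v + int n"
    "v \<le> star_seq k v a b i"
proof -
  have m: "\<And>i j. i < j \<Longrightarrow> j < k \<Longrightarrow> a i < a j \<and> b i < b j"
    and r: "\<And>i j. i < k \<Longrightarrow> j < k \<Longrightarrow> v < a i \<and> a i < b j \<and> b j < v + int n"
    using assms(1) by (auto simp: star_pos_def)
  have j1: "\<not> j \<le> k \<Longrightarrow> j - k - 1 < k" using assms by auto
  have "0 < k" using assms(2,3) by linarith
  show "star_seq k v a b i < star_seq k v a b j"
  proof -
    consider "i = 0" "j \<le> k" | "i = 0" "k < j" | "0 < i" "j \<le> k" | "0 < i" "i \<le> k" "k < j" | "k < i" by linarith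
    then show ?thesis
    proof cases
      case 1 then show ?thesis using r[of "j - 1" 0] assms \<open>0 < k\<close> by (auto simp: star_seq_def)
    next
      case 2 then show ?thesis using r[of 0 "j - k - 1"] j1 \<open>0 < k\<close> by (auto simp: star_seq_def)
    next
      case 3 then show ?thesis using m[of "i - 1" "j - 1"] assms by (auto simp: star_seq_def)
    next
      case 4 then show ?thesis using r[of "i - 1" "j - k - 1"] j1 by (auto simp: star_seq_def)
    next
      case 5
      then have "i - k - 1 < j - k - 1" "j - k - 1 < k" using assms by auto
      then show ?thesis using m[of "i - k - 1" "j - k - 1"] 5 assms by (auto simp: star_seq_def)
    qed
  qed
  show "star_seq k v a b j < v + int n"
    using r[of "j - 1" 0] r[of 0 "j - k - 1"] j1 \<open>0 < k\<close> assms by (force simp: star_seq_def)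
  show "v \<le> star_seq k v a b i"
    using r[of "i - 1" 0] r[of 0 "i - k - 1"] \<open>0 < k\<close> assms by (cases "i \<le> k") (force simp: star_seq_def)+
qed

lemma star_edges_image:
  "star_edges k s = (\<lambda>j. {s j, s ((j + k) mod (2 * k + 1))}) ` {..<2 * k + 1}"
  unfolding star_edges_def by auto

lemma star_edges_star_seq:
  assumes "1 \<le> k"
  shows "star_edges k (\<lambda>j. vtx (star_seq k v a b j)) = star_set k v a b"
proof -
  let ?s = "\<lambda>j. vtx (star_seq k v a b j)"
  let ?e = "\<lambda>j. {?s j, ?s ((j + k) mod (2 * k + 1))}"
  have e0: "?e 0 = {vtx v, vtx (a (k - 1))}" using assms by (simp add: star_seq_def)
  have e1: "?e (Suc i) = {vtx (a i), vtx (b i)}" if "i < k" for i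
    using that by (simp add: star_seq_def)
  have e2: "?e (Suc k) = {vtx v, vtx (b 0)}"
    using assms by (simp add: star_seq_def mult_2 insert_commute)
  have e3: "?e (k + 2 + i) = {vtx (a i), vtx (b (Suc i))}" if "Suc i < k" for i
  proof -
    have "(k + 2 + i + k) mod (2 * k + 1) = Suc i"
    proof -
      have "k + 2 + i + k = Suc i + (2 * k + 1)" by simp
      then show ?thesis using that by (metis mod_add_self2 mod_less less_SucI mult_2 add.commute Suc_eq_plus1 trans_less_add1)
    qed
    then show ?thesis using that by (simp add: star_seq_def insert_commute)
  qed
  have "star_edges k ?s = ?e ` {..<2 * k + 1}"
    unfolding star_edges_def by auto
  also have "{..<2 * k + 1} = {0} \<union> Suc ` {..<k} \<union> {Suc k} \<union> (\<lambda>i. k + 2 + i) ` {i. Suc i < k}"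
  proof -
    have "j \<in> {0} \<union> Suc ` {..<k} \<union> {Suc k} \<union> (\<lambda>i. k + 2 + i) ` {i. Suc i < k}" if "j < 2 * k + 1" for j
    proof -
      consider "j = 0" | "0 < j" "j \<le> k" | "j = Suc k" | "k + 2 \<le> j" by linarith
      then show ?thesis
      proof cases
        case 2 then have "j = Suc (j - 1)" "j - 1 < k" by auto
        then show ?thesis by blast
      next
        case 4 then have "j = k + 2 + (j - k - 2)" "Suc (j - k - 2) < k" using that by auto
        then show ?thesis by blast
      qed auto
    qed
    then show ?thesis using assms by auto
  qed
  also have "?e ` \<dots> = star_set k v a b"
  proof -
    have gen: "{A} \<union> X \<union> {B} \<union> Y = {A, B} \<union> X \<union> Y" for A B :: "complex set" and X Y by blast
    have "(\<lambda>i. ?e (Suc i)) ` {..<k} = (\<lambda>i. {vtx (a i), vtx (b i)}) ` {..<k}"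
      by (rule image_cong) (use e1 in auto)
    moreover have "(\<lambda>i. ?e (k + 2 + i)) ` {i. Suc i < k} = (\<lambda>i. {vtx (a i), vtx (b (Suc i))}) ` {i. Suc i < k}"
      by (rule image_cong) (use e3 in auto)
    ultimately show ?thesis
      unfolding star_set_def image_Un image_image image_insert image_empty e0 e2 gen by (simp only:)
  qed
  finally show ?thesis .
qed

lemma star_vertices_star_seq:
  assumes "star_pos k v a b"
  shows "star_vertices k C (\<lambda>j. vtx (star_seq k v a b j))"
  unfolding star_vertices_def
proof (intro conjI allI impI)
  fix h i j assume "h < i \<and> i < j \<and> j < 2 * k + 1"
  then show "ccw (vtx (star_seq k v a b h)) (vtx (star_seq k v a b i)) (vtx (star_seq k v a b j))"
    using star_seq_mono[OF assms, of h i] star_seq_mono[OF assms, of i j] star_seq_mono[OF assms, of h j]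
    by (intro ccw_vtx) auto
qed simp

lemma mod_shift:
  assumes "(h::nat) < m" "r < m"
  shows "(h + r) mod m = (if h + r < m then h + r else h + r - m)"
  using assms by (auto simp: mod_if)

lemma star_vertices_rotate:
  assumes s: "star_vertices k C s" and r: "r < 2 * k + 1"
  shows "star_vertices k C (\<lambda>i. s ((i + r) mod (2 * k + 1)))"
proof -
  have lt: "x mod (2 * k + 1) < 2 * k + 1" for x by simp
  have cc: "ccw (s h) (s i) (s j)" if "h < i" "i < j" "j < 2 * k + 1" for h i j
    using s that by (auto simp: star_vertices_def)
  have "ccw (s ((h + r) mod (2 * k + 1))) (s ((i + r) mod (2 * k + 1))) (s ((j + r) mod (2 * k + 1)))"
    if hij: "h < i" "i < j" "j < 2 * k + 1" for h i j
  proof -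
    have hm: "h < 2 * k + 1" "i < 2 * k + 1" using hij by auto
    note sh = mod_shift[OF hm(1) r] mod_shift[OF hm(2) r] mod_shift[OF hij(3) r]
    consider "j + r < 2 * k + 1" | "i + r < 2 * k + 1" "2 * k + 1 \<le> j + r"
      | "h + r < 2 * k + 1" "2 * k + 1 \<le> i + r" | "2 * k + 1 \<le> h + r" by linarith
    then show ?thesis
    proof cases
      case 1 then show ?thesis unfolding sh using hij by (simp add: cc)
    next
      case 2
      have "ccw (s (j + r - (2 * k + 1))) (s (h + r)) (s (i + r))" by (rule cc) (use 2 hij r in linarith)+
      then show ?thesis unfolding sh using 2 hij by (simp add: ccw_rot[of "s (j + r - Suc (2 * k))"])
    next
      case 3
      have "ccw (s (i + r - (2 * k + 1))) (s (j + r - (2 * k + 1))) (s (h + r))"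
        by (rule cc) (use 3 hij r in linarith)+
      then show ?thesis unfolding sh using 3 hij by (simp add: ccw_rot[of "s (h + r)"])
    next
      case 4
      have "ccw (s (h + r - (2 * k + 1))) (s (i + r - (2 * k + 1))) (s (j + r - (2 * k + 1)))"
        by (rule cc) (use 4 hij r in linarith)+
      then show ?thesis unfolding sh using 4 hij by simp
    qed
  qed
  then show ?thesis using s lt by (auto simp: star_vertices_def)
qed

lemma star_edges_rotate:
  assumes r: "r < 2 * k + 1"
  shows "star_edges k (\<lambda>i. s ((i + r) mod (2 * k + 1))) = star_edges k s"
proof -
  let ?m = "2 * k + 1"
  let ?e = "\<lambda>j. {s j, s ((j + k) mod ?m)}"
  have "star_edges k (\<lambda>i. s ((i + r) mod ?m)) = (\<lambda>j. ?e ((j + r) mod ?m)) ` {..<?m}"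
    unfolding star_edges_def
  proof -
    have "((j + k) mod ?m + r) mod ?m = ((j + r) mod ?m + k) mod ?m" for j
      by (simp add: mod_simps add.commute add.left_commute)
    then show "{{s ((j + r) mod ?m), s (((j + k) mod ?m + r) mod ?m)} |j. j < ?m} = (\<lambda>j. ?e ((j + r) mod ?m)) ` {..<?m}"
      by auto
  qed
  also have "\<dots> = ?e ` ((\<lambda>j. (j + r) mod ?m) ` {..<?m})" by (simp add: image_image)
  also have "(\<lambda>j. (j + r) mod ?m) ` {..<?m} = {..<?m}"
  proof (rule endo_inj_surj)
    show "inj_on (\<lambda>j. (j + r) mod ?m) {..<?m}"
    proof (rule inj_onI)
      fix x y assume "x \<in> {..<?m}" "y \<in> {..<?m}" "(x + r) mod ?m = (y + r) mod ?m"
      then show "x = y" using mod_shift[of x ?m r] mod_shift[of y ?m r] r by (auto split: if_splits)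
    qed
  qed auto
  also have "?e ` {..<?m} = star_edges k s" unfolding star_edges_def by auto
  finally show ?thesis .
qed

text \<open>Any vertex can serve as the root: the star is rotated until it starts there, and its
  vertices are lifted into the period beginning at \<open>v\<close>, where counterclockwise order is
  the order of the integers.\<close>

lemma star_pos_of_vertices:
  assumes s: "star_vertices k C s" and k: "1 \<le> k" and j: "j < 2 * k + 1" "s j = vtx v"
  shows "\<exists>a b. star_pos k v a b \<and> star_edges k s = star_set k v a b \<and>
    s ((j + k) mod (2 * k + 1)) = vtx (a (k - 1)) \<and> s ((j + k + 1) mod (2 * k + 1)) = vtx (b 0)"
proof -
  define s' where "s' i = s ((i + j) mod (2 * k + 1))" for i
  have s': "star_vertices k C s'" "star_edges k s' = star_edges k s"
    using star_vertices_rotate[OF s j(1)] star_edges_rotate[OF j(1), of s] by (auto simp: s'_def[abs_def])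
  have s0: "s' 0 = vtx v" using j by (simp add: s'_def)
  have inC: "s' i \<in> C" if "i < 2 * k + 1" for i using s' that by (auto simp: star_vertices_def)
  have cc: "ccw (s' h) (s' i) (s' j)" if "h < i" "i < j" "j < 2 * k + 1" for h i j
    using s' that by (auto simp: star_vertices_def)
  have "\<exists>x. v \<le> x \<and> x < v + int n \<and> vtx x = s' i" if "i < 2 * k + 1" for i
    using vtx_surj[OF inC[OF that], of v] by metis
  then obtain p where p: "\<And>i. i < 2 * k + 1 \<Longrightarrow> v \<le> p i \<and> p i < v + int n \<and> vtx (p i) = s' i"
    by metis
  have pv: "v < p i" if "0 < i" "i < 2 * k + 1" for i
  proof -
    have "s' i \<noteq> s' 0"
    proof (cases "i = 2 * k")
      case True then show ?thesis using cc[of 0 1 i] k ccw_distinct that by fastforce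
    next
      case False then show ?thesis using cc[of 0 i "2 * k"] k ccw_distinct that by fastforce
    qed
    then show ?thesis using p[OF that(2)] s0 by (metis order_le_less)
  qed
  have pm: "p h < p i" if "0 < h" "h < i" "i < 2 * k + 1" for h i
  proof -
    have "ccw (vtx v) (vtx (p h)) (vtx (p i))" using cc[of 0 h i] that p[of h] p[of i] s0 by auto
    then show ?thesis using ccw_vtx_iff[of v "p h" "p i"] p[of h] p[of i] pv[of h] pv[of i] that by auto
  qed
  define a where "a i = p (Suc i)" for i
  define b where "b i = p (Suc (k + i))" for i
  have pos: "star_pos k v a b"
    unfolding star_pos_def a_def b_def
    using pm pv p by (auto intro!: pm pv)
  have eq: "vtx (star_seq k v a b i) = s' i" if "i < 2 * k + 1" for i
  proof -
    consider "i = 0" | "0 < i" "i \<le> k" | "k < i" by linarith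
    then show ?thesis using that p[of i] s0 by cases (auto simp: star_seq_def a_def b_def)
  qed
  have "star_edges k s' = star_edges k (\<lambda>j. vtx (star_seq k v a b j))"
    unfolding star_edges_image by (intro image_cong) (use eq in auto)
  then have "star_edges k s = star_set k v a b" using star_edges_star_seq[OF k] s' by simp
  moreover have "s ((j + k) mod (2 * k + 1)) = vtx (a (k - 1))" "s ((j + k + 1) mod (2 * k + 1)) = vtx (b 0)"
    using p[of k] p[of "Suc k"] k by (auto simp: s'_def a_def b_def add.commute add.left_commute)
  ultimately show ?thesis using pos by blast
qed

lemma Union_star_set:
  assumes "1 \<le> k"
  shows "\<Union>(star_set k v a b) = vtx ` ({v} \<union> a ` {..<k} \<union> b ` {..<k})"
proof -
  have "i < k \<Longrightarrow> vtx (b i) \<in> \<Union>(star_set k v a b) \<and> vtx (a i) \<in> \<Union>(star_set k v a b)" for i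
    unfolding star_set_def by blast
  moreover have "vtx v \<in> \<Union>(star_set k v a b)" unfolding star_set_def by blast
  moreover have "\<Union>(star_set k v a b) \<subseteq> vtx ` ({v} \<union> a ` {..<k} \<union> b ` {..<k})"
    unfolding star_set_def using assms by fastforce
  ultimately show ?thesis by auto
qed

lemma k_star_star_set:
  assumes "star_pos k v a b" "1 \<le> k"
  shows "k_star k C (star_set k v a b)"
  unfolding k_star_def
  using star_vertices_star_seq[OF assms(1)] star_edges_star_seq[OF assms(2)] by metis

lemma k_star_rooted:
  assumes S: "k_star k C S" and k: "1 \<le> k" and v: "vtx v \<in> \<Union>S"
  shows "\<exists>a b. star_pos k v a b \<and> S = star_set k v a b"
proof -
  obtain s where s: "star_vertices k C s" "S = star_edges k s" using S by (auto simp: k_star_def)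
  obtain i where "i < 2 * k + 1" "vtx v \<in> {s i, s ((i + k) mod (2 * k + 1))}"
    using v unfolding s(2) star_edges_def by blast
  moreover have "(i + k) mod (2 * k + 1) < 2 * k + 1" by simp
  ultimately obtain j where "j < 2 * k + 1" "s j = vtx v" by (metis insertE singletonD)
  then show ?thesis using star_pos_of_vertices[OF s(1) k] s(2) by metis
qed

lemma star_pos_vertices:
  assumes "star_pos k v a b"
  shows "inj_on vtx ({v} \<union> a ` {..<k} \<union> b ` {..<k})" "card ({v} \<union> a ` {..<k} \<union> b ` {..<k}) = 2 * k + 1"
    "inj_on a {..<k}" "inj_on b {..<k}"
proof -
  have m: "\<And>i j. i < j \<Longrightarrow> j < k \<Longrightarrow> a i < a j \<and> b i < b j"
    and r: "\<And>i j. i < k \<Longrightarrow> j < k \<Longrightarrow> v < a i \<and> a i < b j \<and> b j < v + int n"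
    using assms by (auto simp: star_pos_def)
  have "x \<in> {v} \<union> a ` {..<k} \<union> b ` {..<k} \<Longrightarrow> v \<le> x \<and> x < v + int n" for x
    using r n_ge_3 by fastforce
  then show "inj_on vtx ({v} \<union> a ` {..<k} \<union> b ` {..<k})"
    by (intro inj_onI) (auto intro: vtx_inj)
  show inj: "inj_on a {..<k}" "inj_on b {..<k}"
    using m by (auto intro!: linorder_inj_onI simp: less_le)
  have "({v} \<union> a ` {..<k}) \<inter> b ` {..<k} = {}" "{v} \<inter> a ` {..<k} = {}"
    using r by fastforce+
  then show "card ({v} \<union> a ` {..<k} \<union> b ` {..<k}) = 2 * k + 1"
    using inj by (simp add: card_Un_disjoint card_image)
qed

lemma card_Union_star:
  assumes S: "k_star k C S" and k: "1 \<le> k"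
  shows "card (\<Union>S) = 2 * k + 1" "\<Union>S \<subseteq> C"
proof -
  obtain s where s: "star_vertices k C s" "S = star_edges k s" using S by (auto simp: k_star_def)
  have "s 0 \<in> C" using s by (auto simp: star_vertices_def)
  then obtain v where v: "s 0 = vtx v" using range_vtx by blast
  obtain a b where ab: "star_pos k v a b" "S = star_set k v a b"
    using star_pos_of_vertices[OF s(1) k, of 0 v] v s(2) by auto
  show "card (\<Union>S) = 2 * k + 1"
    unfolding ab(2) Union_star_set[OF k] using star_pos_vertices[OF ab(1)] by (simp only: card_image)
  show "\<Union>S \<subseteq> C" unfolding ab(2) Union_star_set[OF k] by auto
qed

text \<open>Carries existence and uniqueness from lifted chords over to the \<open>k\<close>-stars
  of \<open>T\<close> whose angle at \<open>v\<close> contains the gap after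
  \<open>g\<close>.\<close>

lemma star_at_iff:
  assumes "lifted_triangulation (lift_edges T) (int n) k"
  shows "lifted_triangulation.star_at (lift_edges T) (int n) k v g a b \<longleftrightarrow>
    star_pos k v a b \<and> star_set k v a b \<subseteq> T \<and> (\<forall>i<k. a i \<le> g \<and> g < b i)"
proof -
  interpret L: lifted_triangulation "lift_edges T" "int n" k by (rule assms)
  show ?thesis
  proof
    assume st: "L.star_at v g a b"
    then have ch: "crossing_chain (lift_edges T) (int n) k a b"
      and rng: "\<And>j. j < k \<Longrightarrow> v < a j \<and> a j \<le> g \<and> g + 1 \<le> b j \<and> b j < v + int n"
      and ed: "\<And>i. Suc i < k \<Longrightarrow> lift_edges T (a i) (b (Suc i))" "lift_edges T v (a (k - 1))" "lift_edges T v (b 0)"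
      by (auto simp: L.star_at_def L.chain_at_def)
    have "v < a i \<and> a i < b j \<and> b j < v + int n" if "i < k" "j < k" for i j
      using rng[OF that(1)] rng[OF that(2)] by linarith
    then have "star_pos k v a b" using chain_strict_mono[OF ch] by (simp add: star_pos_def)
    moreover have "star_set k v a b \<subseteq> T"
      using ed chain_edge[OF ch] by (auto simp: star_set_def lift_edges_def)
    ultimately show "star_pos k v a b \<and> star_set k v a b \<subseteq> T \<and> (\<forall>i<k. a i \<le> g \<and> g < b i)"
      using rng by force
  next
    assume as: "star_pos k v a b \<and> star_set k v a b \<subseteq> T \<and> (\<forall>i<k. a i \<le> g \<and> g < b i)"
    then have m: "\<And>i j. i < j \<Longrightarrow> j < k \<Longrightarrow> a i < a j \<and> b i < b j"
      and r: "\<And>i j. i < k \<Longrightarrow> j < k \<Longrightarrow> v < a i \<and> a i < b j \<and> b j < v + int n"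
      by (auto simp: star_pos_def)
    have e: "lift_edges T (a i) (b j)" if "{vtx (a i), vtx (b j)} \<in> star_set k v a b" "i < k" "j < k" for i j
      using that as r[of i j] by (auto simp: lift_edges_def)
    have "L.chain_at v g (g + 1) a b"
    proof (rule L.chain_atI)
      fix j assume j: "j < k"
      show "lift_edges T (a j) (b j)" by (rule e) (use j in \<open>auto simp: star_set_def\<close>)
      show "v < a j \<and> a j \<le> g \<and> g + 1 \<le> b j \<and> b j < v + int n" using r[OF j j] as j by auto
    qed (use m in auto)
    moreover have "lift_edges T (a i) (b (Suc i))" if "Suc i < k" for i
      by (rule e) (use that in \<open>auto simp: star_set_def\<close>)
    moreover have "lift_edges T v (a (k - 1))" "lift_edges T v (b 0)"
      using as r[of "k - 1" 0] r[of 0 0] L.k_pos by (auto simp: lift_edges_def star_set_def)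
    ultimately show "L.star_at v g a b" by (auto simp: L.star_at_def)
  qed
qed

lemma star_of_triangulation_exists:
  assumes T: "k_triangulation k C T" and k: "1 \<le> k" and g: "v + int k \<le> g" "g < v + int n - int k"
  shows "\<exists>a b. star_pos k v a b \<and> star_set k v a b \<subseteq> T \<and> (\<forall>i<k. a i \<le> g \<and> g < b i)"
  using lifted_triangulation.star_exists[OF lifted_triangulation[OF T k] g]
  unfolding star_at_iff[OF lifted_triangulation[OF T k]] .

lemma star_of_triangulation_unique:
  assumes T: "k_triangulation k C T" and k: "1 \<le> k"
    and 1: "star_pos k v a b" "star_set k v a b \<subseteq> T" "\<forall>i<k. a i \<le> g \<and> g < b i"
    and 2: "star_pos k v c d" "star_set k v c d \<subseteq> T" "\<forall>i<k. c i \<le> g \<and> g < d i"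
  shows "star_set k v a b = star_set k v c d"
proof -
  have eq: "\<And>i. i < k \<Longrightarrow> c i = a i \<and> d i = b i"
    using lifted_triangulation.star_unique[OF lifted_triangulation[OF T k], of v g a b c d] 1 2
    unfolding star_at_iff[OF lifted_triangulation[OF T k]] by blast
  have "(\<lambda>i. {vtx (a i), vtx (b i)}) ` {..<k} = (\<lambda>i. {vtx (c i), vtx (d i)}) ` {..<k}"
    "(\<lambda>i. {vtx (a i), vtx (b (Suc i))}) ` {i. Suc i < k} = (\<lambda>i. {vtx (c i), vtx (d (Suc i))}) ` {i. Suc i < k}"
    by (rule image_cong; use eq in auto)+
  then show ?thesis using eq[of "k - 1"] eq[of 0] k unfolding star_set_def by simp
qed

lemma star_angle_empty:
  assumes T: "k_triangulation k C T" and k: "1 \<le> k"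
    and st: "star_pos k v a b" "star_set k v a b \<subseteq> T" and z: "\<forall>i<k. a i < z \<and> z < b i"
  shows "{vtx v, vtx z} \<notin> T"
proof -
  interpret L: lifted_triangulation "lift_edges T" "int n" k by (rule lifted_triangulation[OF T k])
  have "L.star_at v z a b" unfolding star_at_iff[OF lifted_triangulation[OF T k]] using st z by force
  then have c: "L.chain_at v z (z + 1) a b" by (simp add: L.star_at_def)
  have vz: "v < z" "z < v + int n" using st(1) z k by (force simp: star_pos_def)+
  then show ?thesis using L.chain_angle_empty[OF c z] by (auto simp: lift_edges_def)
qed

end

section \<open>Heights of points as functions of the angle\<close>

definition ht :: "complex \<Rightarrow> real \<Rightarrow> real" where
  "ht p t = unit_normal t \<bullet> p"

lemma ht_eq: "ht p t = cos t * Im p - sin t * Re p"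
  by (simp add: ht_def unit_normal_inner)

lemma ht_add_pi [simp]: "ht p (t + pi) = - ht p t"
  by (simp add: ht_eq)

lemma ht_add_int_pi: "ht p (t + of_int m * pi) = (if even m then ht p t else - ht p t)"
proof -
  have "sin (of_int m * pi) = 0" by (simp add: sin_zero_iff_int2)
  then show ?thesis
    by (auto simp: ht_eq cos_add sin_add cos_int_mult_pi[of m])
qed

lemma continuous_on_ht [continuous_intros]: "continuous_on A (ht p)"
  unfolding ht_eq[abs_def] by (intro continuous_intros)

text \<open>At a tie the vector from \<open>p\<close> to \<open>q\<close> has direction
  \<open>t\<close>, so height differences are signed areas divided by its signed length. This turns
  counts above and below a line through two vertices into counts of orientations.\<close>

lemma ht_diff_orient:
  assumes "ht p t = ht q t" "p \<noteq> q"
  obtains \<kappa> where "\<kappa> \<noteq> 0" "\<And>r. ht r t - ht p t = \<kappa> * orient p q r"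
proof -
  define l where "l = cos t * (Re q - Re p) + sin t * (Im q - Im p)"
  have perp: "cos t * (Im q - Im p) = sin t * (Re q - Re p)"
    using assms(1) by (simp add: ht_eq algebra_simps)
  have sc: "sin t * sin t + cos t * cos t = 1"
    using sin_cos_squared_add[of t] by (simp add: power2_eq_square)
  have re: "Re q - Re p = l * cos t"
  proof -
    have "l * cos t = (Re q - Re p) * (cos t * cos t) + sin t * (cos t * (Im q - Im p))"
      by (simp add: l_def algebra_simps)
    also have "\<dots> = (Re q - Re p) * (sin t * sin t + cos t * cos t)"
      unfolding perp by algebra
    finally show ?thesis unfolding sc by simp
  qed
  have im: "Im q - Im p = l * sin t"
  proof -
    have "l * sin t = cos t * (sin t * (Re q - Re p)) + (Im q - Im p) * (sin t * sin t)"
      by (simp add: l_def algebra_simps)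
    also have "\<dots> = (Im q - Im p) * (sin t * sin t + cos t * cos t)"
      unfolding perp[symmetric] by algebra
    finally show ?thesis unfolding sc by simp
  qed
  have "l \<noteq> 0"
  proof
    assume "l = 0"
    then have "p = q" using re im by (simp add: complex_eq_iff)
    then show False using assms by simp
  qed
  moreover have "orient p q r = l * (ht r t - ht p t)" for r
    unfolding orient_def re im by (simp add: ht_eq algebra_simps)
  ultimately show ?thesis using that[of "1 / l"] by simp
qed

text \<open>The difference of two heights is a sinusoid, determined by a zero and by its derivative
  there, which is \<open>K\<close>. Hence the duals of two points cross exactly once in the
  strip.\<close>

lemma ht_tie_sin:
  assumes "ht p t = ht q t" "p \<noteq> q"
  shows "\<exists>K. K \<noteq> 0 \<and> (\<forall>s. ht p s - ht q s = K * sin (s - t))"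
proof -
  define K where "K = - ((Im p - Im q) * sin t + (Re p - Re q) * cos t)"
  have perp: "cos t * (Im p - Im q) = sin t * (Re p - Re q)"
    using assms(1) by (simp add: ht_eq algebra_simps)
  have sc: "sin t * sin t + cos t * cos t = 1"
    using sin_cos_squared_add[of t] by (simp add: power2_eq_square)
  have D: "ht p s - ht q s = K * sin (s - t)" for s
  proof -
    have "K * sin (s - t) = cos s * ((Im p - Im q) * (sin t * sin t) + (cos t * (sin t * (Re p - Re q))))
       - sin s * ((Re p - Re q) * (cos t * cos t) + sin t * (cos t * (Im p - Im q)))"
      by (simp add: K_def sin_diff algebra_simps)
    also have "\<dots> = cos s * ((Im p - Im q) * (sin t * sin t) + (cos t * (cos t * (Im p - Im q))))
       - sin s * ((Re p - Re q) * (cos t * cos t) + sin t * (sin t * (Re p - Re q)))"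
      using perp by simp
    also have "\<dots> = (cos s * (Im p - Im q) - sin s * (Re p - Re q)) * (sin t * sin t + cos t * cos t)"
      by algebra
    finally show ?thesis unfolding sc by (simp add: ht_eq algebra_simps)
  qed
  have "K \<noteq> 0"
  proof
    assume "K = 0"
    then have eq: "ht p s = ht q s" for s using D[of s] by simp
    have "Im p = Im q" using eq[of 0] by (simp add: ht_eq)
    moreover have "Re p = Re q" using eq[of "pi / 2"] by (simp add: ht_eq)
    ultimately show False using assms(2) complex_eqI by blast
  qed
  then show ?thesis using D by blast
qed

lemma ht_tie_unique:
  assumes "ht p t = ht q t" "ht p s = ht q s" "p \<noteq> q"
  shows "\<exists>m::int. s = t + of_int m * pi"
proof -
  obtain K where "K \<noteq> 0" "ht p s - ht q s = K * sin (s - t)" using ht_tie_sin[OF assms(1,3)] by blast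
  then have "sin (s - t) = 0" using assms(2) by simp
  then obtain m :: int where "s - t = of_int m * pi" by (auto simp: sin_zero_iff_int2)
  then have "s = t + of_int m * pi" by linarith
  then show ?thesis by blast
qed

text \<open>The tie occurs when the line has the direction of \<open>q - p\<close>.\<close>

lemma ht_tie_ex: "\<exists>t. ht p t = ht q t"
proof -
  have z: "rcis (cmod (q - p)) (Arg (q - p)) = q - p" by (rule rcis_cmod_Arg)
  have "Re (q - p) = cmod (q - p) * cos (Arg (q - p))" "Im (q - p) = cmod (q - p) * sin (Arg (q - p))"
    by (metis z Re_rcis, metis z Im_rcis)
  then have "cos (Arg (q - p)) * Im (q - p) - sin (Arg (q - p)) * Re (q - p) = 0" by simp
  then have "ht p (Arg (q - p)) = ht q (Arg (q - p))" by (simp add: ht_eq algebra_simps)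
  then show ?thesis by blast
qed

lemma ht_tie_swap:
  assumes "ht p t = ht q t" "p \<noteq> q" "t - pi < y" "y < t" "t < z" "z < t + pi"
  shows "(ht p y - ht q y) * (ht p z - ht q z) < 0"
proof -
  obtain K where "K \<noteq> 0" and D: "\<And>s. ht p s - ht q s = K * sin (s - t)"
    using ht_tie_sin[OF assms(1,2)] by blast
  moreover have "sin (y - t) < 0"
    using sin_gt_zero[of "t - y"] assms sin_minus[of "t - y"] by simp
  moreover have "0 < sin (z - t)" using sin_gt_zero[of "z - t"] assms by simp
  ultimately have "0 < K * K" "sin (y - t) * sin (z - t) < 0"
    by (auto simp: mult_neg_pos zero_less_mult_iff)
  then have "(K * K) * (sin (y - t) * sin (z - t)) < 0" by (rule mult_pos_neg)
  then show ?thesis unfolding D by (simp add: mult_ac)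
qed

section \<open>Levels\<close>

text \<open>The \<open>j\<close>-th largest height at angle \<open>t\<close>, counted with
  multiplicity.\<close>

definition lev :: "complex set \<Rightarrow> nat \<Rightarrow> real \<Rightarrow> real" where
  "lev V j t = Max {ht v t | v. v \<in> V \<and> j \<le> card {w \<in> V. ht v t \<le> ht w t}}"

text \<open>The two counts, strictly above and weakly above, are the working description of a
  level.\<close>

lemma lev_unique:
  assumes "finite V" "card {w \<in> V. d < ht w t} < j" "j \<le> card {w \<in> V. d \<le> ht w t}"
    "card {w \<in> V. d' < ht w t} < j" "j \<le> card {w \<in> V. d' \<le> ht w t}"
  shows "d = d'"
proof -
  have "\<not> d < d'" if "card {w \<in> V. d < ht w t} < j" "j \<le> card {w \<in> V. d' \<le> ht w t}" for d d'
  proof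
    assume "d < d'"
    have "card {w \<in> V. d' \<le> ht w t} \<le> card {w \<in> V. d < ht w t}"
      using assms(1) \<open>d < d'\<close> by (intro card_mono) auto
    then show False using that by simp
  qed
  from this[OF assms(2,5)] this[OF assms(4,3)] show ?thesis by linarith
qed

lemma ex_minimizer:
  fixes f :: "'a \<Rightarrow> real"
  assumes "finite A" "A \<noteq> {}"
  shows "\<exists>m\<in>A. \<forall>w\<in>A. f m \<le> f w"
  using arg_min_if_finite(1)[OF assms, of f] arg_min_least[OF assms, of _ f] by auto

lemma lev_props:
  assumes V: "finite V" and j: "1 \<le> j" "j \<le> card V"
  shows "\<exists>v\<in>V. lev V j t = ht v t" "card {w \<in> V. lev V j t < ht w t} < j"
    "j \<le> card {w \<in> V. lev V j t \<le> ht w t}"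
proof -
  define A where "A = {v \<in> V. j \<le> card {w \<in> V. ht v t \<le> ht w t}}"
  have lev: "lev V j t = Max ((\<lambda>v. ht v t) ` A)"
    unfolding lev_def A_def by (rule arg_cong[of _ _ Max]) auto
  have finA: "finite A" using V by (simp add: A_def)
  have "A \<noteq> {}"
  proof -
    have "V \<noteq> {}" using j by auto
    then obtain m where m: "m \<in> V" "\<And>w. w \<in> V \<Longrightarrow> ht m t \<le> ht w t"
      using ex_minimizer[OF V, of "\<lambda>v. ht v t"] by blast
    then have "{w \<in> V. ht m t \<le> ht w t} = V" by auto
    then have "m \<in> A" using m j by (simp add: A_def)
    then show ?thesis by blast
  qed
  then have "lev V j t \<in> (\<lambda>v. ht v t) ` A"
    unfolding lev using finA by (intro Max_in) auto
  then obtain v where v: "v \<in> A" "lev V j t = ht v t" by blast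
  then show "\<exists>v\<in>V. lev V j t = ht v t" "j \<le> card {w \<in> V. lev V j t \<le> ht w t}" by (auto simp: A_def)
  show "card {w \<in> V. lev V j t < ht w t} < j"
  proof (rule ccontr)
    let ?B = "{w \<in> V. lev V j t < ht w t}"
    assume "\<not> card ?B < j"
    then have "j \<le> card ?B" "0 < card ?B" using j by linarith+
    then have B: "j \<le> card ?B" "?B \<noteq> {}" "finite ?B" by (auto simp only: card_gt_0_iff)
    then obtain m where m: "m \<in> ?B" "\<And>w. w \<in> ?B \<Longrightarrow> ht m t \<le> ht w t"
      using ex_minimizer[OF B(3,2), of "\<lambda>v. ht v t"] by blast
    then have "?B \<subseteq> {w \<in> V. ht m t \<le> ht w t}" by auto
    then have "j \<le> card {w \<in> V. ht m t \<le> ht w t}" using B V card_mono[of "{w \<in> V. ht m t \<le> ht w t}" ?B] by auto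
    then have "m \<in> A" using m by (auto simp: A_def)
    then have "ht m t \<le> lev V j t" unfolding lev using finA by (intro Max_ge) auto
    then show False using m by auto
  qed
qed

lemma lev_eqI:
  assumes V: "finite V" and "card {w \<in> V. d < ht w t} < j" "j \<le> card {w \<in> V. d \<le> ht w t}"
  shows "lev V j t = d"
proof -
  have "j \<le> card V" using assms(3) card_mono[OF V, of "{w \<in> V. d \<le> ht w t}"] by auto
  moreover have "1 \<le> j" using assms(2) by auto
  ultimately show ?thesis using lev_unique[OF V] lev_props[OF V, of j t] assms by blast
qed

lemma card_compl_ht:
  assumes "finite V"
  shows "card {w \<in> V. ht w t < d} = card V - card {w \<in> V. d \<le> ht w t}"
    "card {w \<in> V. ht w t \<le> d} = card V - card {w \<in> V. d < ht w t}"
proof -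
  have "{w \<in> V. ht w t < d} = V - {w \<in> V. d \<le> ht w t}" "{w \<in> V. ht w t \<le> d} = V - {w \<in> V. d < ht w t}"
    by auto
  then show "card {w \<in> V. ht w t < d} = card V - card {w \<in> V. d \<le> ht w t}"
    "card {w \<in> V. ht w t \<le> d} = card V - card {w \<in> V. d < ht w t}"
    using assms by (auto simp: card_Diff_subset)
qed

text \<open>Turning the line by \<open>pi\<close> reverses the order of heights, so counting from
  the top becomes counting from the bottom. The median of an odd set is therefore
  antiperiodic.\<close>

lemma lev_add_pi:
  assumes V: "finite V" and j: "1 \<le> j" "j \<le> card V"
  shows "lev V j (t + pi) = - lev V (card V + 1 - j) t"
proof (rule lev_eqI[OF V])
  let ?d = "lev V (card V + 1 - j) t"
  have p: "card {w \<in> V. ?d < ht w t} < card V + 1 - j" "card V + 1 - j \<le> card {w \<in> V. ?d \<le> ht w t}"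
    using lev_props[OF V, of "card V + 1 - j" t] j by auto
  have e: "{w \<in> V. - ?d < ht w (t + pi)} = {w \<in> V. ht w t < ?d}"
    "{w \<in> V. - ?d \<le> ht w (t + pi)} = {w \<in> V. ht w t \<le> ?d}" by auto
  show "card {w \<in> V. - ?d < ht w (t + pi)} < j" "j \<le> card {w \<in> V. - ?d \<le> ht w (t + pi)}"
    unfolding e card_compl_ht[OF V, of t ?d] using p j by linarith+
qed

text \<open>If the level dropped by \<open>e\<close> or more, all points weakly above the old level
  would lie strictly above the new one, contradicting the counts.\<close>

lemma lev_close:
  assumes V: "finite V" and j: "1 \<le> j" "j \<le> card V" and "\<And>v. v \<in> V \<Longrightarrow> \<bar>ht v s - ht v t\<bar> < e"
  shows "\<bar>lev V j s - lev V j t\<bar> < e"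
proof -
  have "lev V j t - e < lev V j s" if cl: "\<And>v. v \<in> V \<Longrightarrow> \<bar>ht v s - ht v t\<bar> < e" for s t
  proof (rule ccontr)
    assume "\<not> lev V j t - e < lev V j s"
    then have "{w \<in> V. lev V j t \<le> ht w t} \<subseteq> {w \<in> V. lev V j s < ht w s}"
      using cl by fastforce
    then have "card {w \<in> V. lev V j t \<le> ht w t} \<le> card {w \<in> V. lev V j s < ht w s}"
      using V by (intro card_mono) auto
    then show False using lev_props(2)[OF V j, of s] lev_props(3)[OF V j, of t] by simp
  qed
  from this[of s t] this[of t s] assms(4) show ?thesis by (simp add: abs_minus_commute abs_less_iff)
qed

lemma continuous_on_lev:
  assumes V: "finite V" and j: "1 \<le> j" "j \<le> card V"
  shows "continuous_on A (lev V j)"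
proof -
  have "continuous (at t) (lev V j)" for t
    unfolding continuous_at tendsto_iff
  proof (intro allI impI)
    fix e :: real assume e: "0 < e"
    have "\<forall>\<^sub>F s in at t. \<forall>v\<in>V. dist (ht v s) (ht v t) < e"
    proof (rule eventually_ball_finite[OF V], rule ballI)
      fix v
      have "continuous (at t) (ht v)" using continuous_on_ht[of UNIV v] by (simp add: continuous_on_eq_continuous_at)
      then show "\<forall>\<^sub>F s in at t. dist (ht v s) (ht v t) < e"
        unfolding continuous_at tendsto_iff using e by blast
    qed
    then show "\<forall>\<^sub>F s in at t. dist (lev V j s) (lev V j t) < e"
      by eventually_elim (use lev_close[OF V j] in \<open>auto simp: dist_real_def\<close>)
  qed
  then show ?thesis by (simp add: continuous_at_imp_continuous_on)
qed

definition curve :: "complex set \<Rightarrow> (real \<Rightarrow> real) \<Rightarrow> bool" where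
  "curve V f \<longleftrightarrow> continuous_on UNIV f \<and> (\<forall>t. f (t + pi) = - f t) \<and> (\<forall>t. \<exists>v\<in>V. f t = ht v t)"

lemma curve_lev:
  assumes "finite V" "card V = 2 * k + 1"
  shows "curve V (lev V (k + 1))"
  using continuous_on_lev[of V "k + 1"] lev_add_pi[of V "k + 1"] lev_props(1)[of V "k + 1"] assms
  by (auto simp: curve_def)

lemma curve_mono: "curve V f \<Longrightarrow> V \<subseteq> W \<Longrightarrow> curve W f"
  unfolding curve_def by blast

lemma antiperiodic_int:
  assumes "\<And>t. f (t + pi) = - (f t :: real)"
  shows "f (t + of_int m * pi) = (if even m then f t else - f t)"
proof -
  have "f (s + 2 * pi) = f s" for s
    using assms[of s] assms[of "s + pi"] by (simp add: algebra_simps)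
  then have nat: "f (s + of_nat i * pi) = (if even i then f s else - f s)" for s i
  proof (induction i)
    case (Suc i)
    then show ?case using assms[of "s + of_nat i * pi"] by (simp add: algebra_simps)
  qed simp
  show ?thesis
  proof (cases "0 \<le> m")
    case True then show ?thesis using nat[of t "nat m"] by (simp add: even_nat_iff)
  next
    case False
    then show ?thesis using nat[of "t + of_int m * pi" "nat (- m)"] by (auto simp: even_nat_iff algebra_simps)
  qed
qed

text \<open>The value taken on a punctured neighbourhood of each point depends locally constantly on
  that point, hence is constant on the real line, against antiperiodicity. The neighbourhoods are
  punctured so that isolated touching points do not count as sign changes.\<close>

lemma antiperiodic_sign_change:
  fixes \<sigma> :: "real \<Rightarrow> real"
  assumes anti: "\<And>t. \<sigma> (t + pi) = - \<sigma> t"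
    and loc: "\<And>t. \<exists>c. c \<noteq> 0 \<and> (\<forall>\<^sub>F s in at t. \<sigma> s = c)"
  shows False
proof -
  obtain \<tau> where \<tau>: "\<And>t. \<tau> t \<noteq> 0" "\<And>t. \<forall>\<^sub>F s in at t. \<sigma> s = \<tau> t" using loc by metis
  have uniq: "c = d" if "\<forall>\<^sub>F s in at t. \<sigma> s = c" "\<forall>\<^sub>F s in at t. \<sigma> s = d" for t :: real and c d
  proof -
    have "\<forall>\<^sub>F s in at t. c = d" using that by eventually_elim simp
    then show ?thesis by (simp add: eventually_const_iff)
  qed
  have "\<forall>\<^sub>F s in nhds t. \<tau> s = \<tau> t" for t
  proof -
    have "\<forall>\<^sub>F s in nhds t. s \<noteq> t \<longrightarrow> \<sigma> s = \<tau> t" using \<tau>(2)[of t] by (simp add: eventually_at_filter)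
    then have "\<forall>\<^sub>F s in nhds t. \<forall>\<^sub>F r in nhds s. r \<noteq> t \<longrightarrow> \<sigma> r = \<tau> t" by (simp add: eventually_eventually)
    then show ?thesis
    proof eventually_elim
      case (elim s)
      show ?case
      proof (cases "s = t")
        case False
        then have "\<forall>\<^sub>F r in nhds s. r \<noteq> t" by (rule t1_space_nhds)
        with elim have "\<forall>\<^sub>F r in nhds s. \<sigma> r = \<tau> t" by eventually_elim simp
        then have "\<forall>\<^sub>F r in at s. \<sigma> r = \<tau> t" by (simp add: eventually_at_filter eventually_mono)
        then show ?thesis using uniq \<tau>(2) by blast
      qed simp
    qed
  qed
  then have loc_const: "\<exists>U. open U \<and> t \<in> U \<and> (\<forall>s\<in>U. \<tau> s = \<tau> t)" for t
    unfolding eventually_nhds by blast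
  have "open {s. P (\<tau> s)}" for P
    unfolding open_subopen[of "{s. P (\<tau> s)}"] using loc_const by fastforce
  from this[of "\<lambda>x. x = \<tau> 0"] this[of "\<lambda>x. x \<noteq> \<tau> 0"]
  have "open {s. \<tau> s = \<tau> 0}" "closed {s. \<tau> s = \<tau> 0}"
    by (auto simp: closed_def Collect_neg_eq[symmetric])
  then have "{s. \<tau> s = \<tau> 0} = UNIV" using clopen[of "{s. \<tau> s = \<tau> 0}"] by auto
  then have const: "\<tau> s = \<tau> 0" for s by auto
  obtain d1 where d1: "0 < d1" "\<And>s. s \<noteq> 0 \<Longrightarrow> dist s 0 < d1 \<Longrightarrow> \<sigma> s = \<tau> 0"
    using \<tau>(2)[of 0] by (auto simp: eventually_at)
  obtain d2 where d2: "0 < d2" "\<And>s. s \<noteq> pi \<Longrightarrow> dist s pi < d2 \<Longrightarrow> \<sigma> s = \<tau> 0"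
    using \<tau>(2)[of pi] const[of pi] by (auto simp: eventually_at)
  define s where "s = min d1 d2 / 2"
  have "\<sigma> s = \<tau> 0" "\<sigma> (s + pi) = \<tau> 0"
    using d1 d2 by (auto simp: s_def dist_real_def)
  then show False using anti[of s] \<tau>(1)[of 0] by simp
qed

text \<open>Where heights are distinct, the finitely many closed sets on which \<open>f\<close>
  agrees with the height of a given point are disjoint, and a connected set meets only one of
  them.\<close>

lemma const_on_connected:
  assumes I: "connected I" "I \<noteq> {}" and V: "finite V" and f: "curve V f"
    and inj: "\<And>y. y \<in> I \<Longrightarrow> inj_on (\<lambda>v. ht v y) V"
  shows "\<exists>p\<in>V. \<forall>y\<in>I. f y = ht p y"
proof -
  obtain y0 where y0: "y0 \<in> I" using I by blast
  obtain p where p: "p \<in> V" "f y0 = ht p y0" using f by (auto simp: curve_def)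
  have cf: "continuous_on UNIV f" using f by (simp add: curve_def)
  define A where "A q = {y. f y = ht q y}" for q
  have clA: "closed (A q)" for q unfolding A_def by (intro closed_Collect_eq cf continuous_on_ht)
  define B where "B = (\<Union>q\<in>V - {p}. A q)"
  have clB: "closed B" unfolding B_def using V clA by (intro closed_UN) auto
  have cov: "I \<subseteq> A p \<union> B" using f unfolding A_def B_def curve_def by blast
  have dis: "A p \<inter> B \<inter> I = {}"
    using inj p unfolding A_def B_def inj_on_def by fastforce
  have "A p \<inter> I \<noteq> {}" using y0 p by (auto simp: A_def)
  then have "B \<inter> I = {}" using I(1) clA[of p] clB cov dis unfolding connected_closed by blast
  then have "\<forall>y\<in>I. f y = ht p y" using cov by (auto simp: A_def)
  then show ?thesis using p by blast
qed

context ngon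
begin

lemma no_triple_tie:
  assumes "p \<in> C" "q \<in> C" "r \<in> C" "p \<noteq> q" "p \<noteq> r" "q \<noteq> r" "ht p t = ht q t"
  shows "ht r t \<noteq> ht p t"
proof -
  obtain \<kappa> where "\<kappa> \<noteq> 0" "\<And>r. ht r t - ht p t = \<kappa> * orient p q r"
    using ht_diff_orient[OF assms(7,4)] by blast
  then show ?thesis using no_three_collinear[OF assms(1-6)] by (metis eq_iff_diff_eq_0 mult_eq_0_iff)
qed

text \<open>Within the radius \<open>e\<close> only points tied at \<open>t\<close> can change their
  order; being below \<open>pi\<close>, the radius admits no further tie of such a pair.\<close>

definition good :: "real \<Rightarrow> real \<Rightarrow> bool" where
  "good t e \<longleftrightarrow> 0 < e \<and> e < pi \<and>
     (\<forall>s. \<bar>s - t\<bar> < e \<longrightarrow> (\<forall>p\<in>C. \<forall>q\<in>C. ht p t < ht q t \<longrightarrow> ht p s < ht q s))"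

lemma good_ex: "\<exists>e. good t e"
proof -
  have "\<forall>\<^sub>F s in nhds t. \<forall>p\<in>C. \<forall>q\<in>C. ht p t < ht q t \<longrightarrow> ht p s < ht q s"
  proof (intro eventually_ball_finite[OF fin_C] ballI)
    fix p q
    show "\<forall>\<^sub>F s in nhds t. ht p t < ht q t \<longrightarrow> ht p s < ht q s"
    proof (cases "ht p t < ht q t")
      case True
      have "open {s. ht p s < ht q s}" by (intro open_Collect_less continuous_on_ht)
      then show ?thesis using True by (auto simp: eventually_nhds)
    qed simp
  qed
  then obtain e where e: "0 < e" "\<And>s. dist s t < e \<Longrightarrow> \<forall>p\<in>C. \<forall>q\<in>C. ht p t < ht q t \<longrightarrow> ht p s < ht q s"
    unfolding eventually_nhds_metric by blast
  have "good t (min e (pi / 2))"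
    unfolding good_def
  proof (intro conjI allI impI)
    show "0 < min e (pi / 2)" "min e (pi / 2) < pi" using e(1) pi_gt_zero by linarith+
    fix s assume "\<bar>s - t\<bar> < min e (pi / 2)"
    then show "\<forall>p\<in>C. \<forall>q\<in>C. ht p t < ht q t \<longrightarrow> ht p s < ht q s"
      using e(2)[of s] by (simp add: dist_real_def)
  qed
  then show ?thesis by blast
qed

lemma good_less: "good t e \<Longrightarrow> \<bar>s - t\<bar> < e \<Longrightarrow> p \<in> C \<Longrightarrow> q \<in> C \<Longrightarrow> ht p t < ht q t \<Longrightarrow> ht p s < ht q s"
  by (simp add: good_def)

lemma good_swap:
  assumes "good t e" "ht p t = ht q t" "p \<noteq> q" "t - e < y" "y < t" "t < z" "z < t + e"
  shows "(ht p y - ht q y) * (ht p z - ht q z) < 0"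
  by (rule ht_tie_swap[OF assms(2,3)]) (use assms in \<open>auto simp: good_def\<close>)

lemma good_generic:
  assumes g: "good t e" and s: "\<bar>s - t\<bar> < e" "s \<noteq> t"
  shows "inj_on (\<lambda>v. ht v s) C"
proof (rule inj_onI, rule ccontr)
  fix p q assume pq: "p \<in> C" "q \<in> C" "ht p s = ht q s" "p \<noteq> q"
  then have tie: "ht p t = ht q t"
    using good_less[OF g s(1), of p q] good_less[OF g s(1), of q p] by force
  show False
  proof (cases "s < t")
    case True
    then show False using good_swap[OF g tie pq(4), of s "t + e / 2"] pq s g by (auto simp: good_def)
  next
    case False
    then show False using good_swap[OF g tie pq(4), of "t - e / 2" s] pq s g by (auto simp: good_def)
  qed
qed

text \<open>On either side of \<open>t\<close> no two heights coincide, so the curve follows a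
  single point there; closedness of the agreement sets carries both descriptions to \<open>t\<close>
  itself.\<close>

lemma germs:
  assumes g: "good t e" and V: "V \<subseteq> C" and f: "curve V f"
  obtains p q where "p \<in> V" "q \<in> V" "f t = ht p t" "f t = ht q t"
    "\<And>y. t - e < y \<Longrightarrow> y < t \<Longrightarrow> f y = ht p y" "\<And>y. t < y \<Longrightarrow> y < t + e \<Longrightarrow> f y = ht q y"
proof -
  have e: "0 < e" using g by (simp add: good_def)
  have fV: "finite V" using V fin_C finite_subset by blast
  have inj: "inj_on (\<lambda>v. ht v y) V" if "\<bar>y - t\<bar> < e" "y \<noteq> t" for y
    using good_generic[OF g that] V inj_on_subset by blast
  have cf: "continuous_on UNIV f" using f by (simp add: curve_def)
  have lim: "f t = ht p t" if "\<forall>y\<in>I. f y = ht p y" "t \<in> closure I" for p I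
  proof -
    have "closed {y. f y = ht p y}" by (intro closed_Collect_eq cf continuous_on_ht)
    moreover have "I \<subseteq> {y. f y = ht p y}" using that by auto
    ultimately have "closure I \<subseteq> {y. f y = ht p y}" by (rule closure_minimal[rotated])
    then show ?thesis using that by auto
  qed
  obtain p where p: "p \<in> V" "\<forall>y\<in>{t - e<..<t}. f y = ht p y"
    using const_on_connected[of "{t - e<..<t}" V f] fV f inj e by force
  obtain q where q: "q \<in> V" "\<forall>y\<in>{t<..<t + e}. f y = ht q y"
    using const_on_connected[of "{t<..<t + e}" V f] fV f inj e by force
  have "f t = ht p t" by (rule lim[OF p(2)]) (use e in simp)
  moreover have "f t = ht q t" by (rule lim[OF q(2)]) (use e in simp)
  ultimately show ?thesis using that[of p q] p q by auto
qed

end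

section \<open>Pseudolines and subsets of the Moebius strip in coordinates\<close>

lemma mk_line_shift: "mk_line (t + of_int m * pi) (if even m then d else - d) = mk_line t d"
  using mk_line_eq_iff[of t d "t + of_int m * pi" "if even m then d else - d"] by auto

lemma mk_line_add_pi: "mk_line (t + pi) (- d) = mk_line t d"
  using mk_line_shift[of t 1 d] by simp

lemma continuous_on_mk_line: "continuous_on A (case_prod mk_line)"
proof -
  have "continuous_on UNIV (case_prod mk_line)"
    by (auto simp: continuous_on_open_vimage open_line_def)
  then show ?thesis using continuous_on_subset by blast
qed

lemma continuous_on_mk_line_comp:
  assumes "continuous_on A f" "continuous_on A g"
  shows "continuous_on A (\<lambda>x. mk_line (f x) (g x))"
  using continuous_on_compose2[OF continuous_on_mk_line continuous_on_Pair[OF assms] subset_UNIV]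
  by simp

lemma mem_represented:
  assumes "represents f L" shows "mk_line t d \<in> L \<longleftrightarrow> d = f t"
proof
  have anti: "f (x + pi) = - f x" for x using assms by (simp add: represents_def)
  assume "mk_line t d \<in> L"
  then obtain s where "mk_line t d = mk_line s (f s)" using assms by (auto simp: represents_def)
  then obtain m :: int where "s = t + of_int m * pi" "f s = (if even m then d else - d)"
    by (auto simp: mk_line_eq_iff)
  then show "d = f t" using antiperiodic_int[of f t m, OF anti] by (auto split: if_splits)
qed (use assms in \<open>auto simp: represents_def\<close>)

lemma represents_unique: "represents f L \<Longrightarrow> represents g L \<Longrightarrow> f = g"
  by (rule ext) (metis mem_represented)

lemma represents_eq: "represents f L \<Longrightarrow> represents f M \<Longrightarrow> L = M"
  by (simp add: represents_def)

lemma represents_curve: "curve V f \<Longrightarrow> represents f (range (\<lambda>x. mk_line x (f x)))"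
  by (simp add: curve_def represents_def)

lemma represents_dual_point: "represents (ht p) (dual_point p)"
proof -
  have "dual_point p = range (\<lambda>x. mk_line x (ht p x))"
  proof
    show "dual_point p \<subseteq> range (\<lambda>x. mk_line x (ht p x))"
    proof
      fix l assume l: "l \<in> dual_point p"
      obtain t d where td: "l = mk_line t d" by (rule line_exhaust)
      then have "ht p t = d" using l by (simp add: dual_point_def line_points_def ht_def)
      then show "l \<in> range (\<lambda>x. mk_line x (ht p x))" using td by auto
    qed
  qed (auto simp: dual_point_def line_points_def ht_def)
  then show ?thesis by (simp add: represents_def continuous_on_ht)
qed

definition lines_of :: "(real \<Rightarrow> real set) \<Rightarrow> line set" where
  "lines_of F = {mk_line t d | t d. d \<in> F t}"

text \<open>Compatibility with the identification of \<open>(t, d)\<close> and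
  \<open>(t + pi, - d)\<close>; for such families membership, openness and closedness in the strip
  can be tested in the plane of parameters.\<close>

definition antiper :: "(real \<Rightarrow> real set) \<Rightarrow> bool" where
  "antiper F \<longleftrightarrow> (\<forall>t d. d \<in> F (t + pi) \<longleftrightarrow> - d \<in> F t)"

lemma antiper_int:
  assumes "antiper F"
  shows "d \<in> F (t + of_int m * pi) \<longleftrightarrow> (if even m then d else - d) \<in> F t"
proof -
  have st: "d \<in> F (s + pi) \<longleftrightarrow> - d \<in> F s" for d s using assms by (simp add: antiper_def)
  have nat: "d \<in> F (s + of_nat i * pi) \<longleftrightarrow> (if even i then d else - d) \<in> F s" for d s i
  proof (induction i arbitrary: d)
    case (Suc i)
    have "d \<in> F (s + of_nat (Suc i) * pi) \<longleftrightarrow> - d \<in> F (s + of_nat i * pi)"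
      using st[of d "s + of_nat i * pi"] by (simp add: algebra_simps)
    then show ?case using Suc[of "- d"] by simp
  qed simp
  show ?thesis
  proof (cases "0 \<le> m")
    case True then show ?thesis using nat[of d t "nat m"] by (simp add: even_nat_iff)
  next
    case False
    define i where "i = nat (- m)"
    have i: "real_of_int m = - real i" "even i \<longleftrightarrow> even m" using False by (auto simp: i_def even_nat_iff)
    have e: "t + of_int m * pi + of_nat i * pi = t" by (simp add: i)
    show ?thesis
      using nat[of "if even m then d else - d" "t + of_int m * pi" i] unfolding e i(2) by (simp split: if_splits)
  qed
qed

lemma mem_lines_of:
  assumes "antiper F" shows "mk_line t d \<in> lines_of F \<longleftrightarrow> d \<in> F t"
proof
  assume "mk_line t d \<in> lines_of F"
  then obtain s e where "mk_line t d = mk_line s e" and e: "e \<in> F s" by (auto simp: lines_of_def)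
  then obtain m :: int where m: "s = t + of_int m * pi" "e = (if even m then d else - d)"
    by (auto simp: mk_line_eq_iff)
  then show "d \<in> F t" using e antiper_int[OF assms, of e t m] by (auto split: if_splits)
qed (auto simp: lines_of_def)

lemma vimage_lines_of: "antiper F \<Longrightarrow> case_prod mk_line -` lines_of F = {(t, d). d \<in> F t}"
  by (auto simp: mem_lines_of)

lemma open_lines_of: "antiper F \<Longrightarrow> open (lines_of F) \<longleftrightarrow> open {(t, d). d \<in> F t}"
  by (simp add: open_line_def vimage_lines_of)

lemma closed_lines_of: "antiper F \<Longrightarrow> closed (lines_of F) \<longleftrightarrow> closed {(t, d). d \<in> F t}"
  unfolding closed_def open_line_def by (simp add: vimage_Compl vimage_lines_of)

lemma abs_ht_le: "\<bar>ht p t\<bar> \<le> norm p"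
  using Cauchy_Schwarz_ineq2[of "unit_normal t" p] by (simp add: ht_def unit_normal_def norm_mult)

lemma lev_antimono:
  assumes "finite V" "1 \<le> i" "i \<le> j" "j \<le> card V"
  shows "lev V j t \<le> lev V i t"
proof (rule ccontr)
  assume "\<not> lev V j t \<le> lev V i t"
  then have "card {w \<in> V. lev V j t \<le> ht w t} \<le> card {w \<in> V. lev V i t < ht w t}"
    using assms by (intro card_mono) auto
  then show False using lev_props(2)[of V i t] lev_props(3)[of V j t] assms by linarith
qed

lemma card_ge_lev_generic:
  assumes V: "finite V" "1 \<le> j" "j \<le> card V" and inj: "inj_on (\<lambda>v. ht v t) V"
  shows "card {w \<in> V. lev V j t \<le> ht w t} = j"
proof -
  obtain v where v: "v \<in> V" "lev V j t = ht v t" using lev_props(1)[OF V] by blast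
  have "{w \<in> V. lev V j t \<le> ht w t} = insert v {w \<in> V. lev V j t < ht w t}"
    using v inj by (force simp: inj_on_def order.order_iff_strict)
  then have "card {w \<in> V. lev V j t \<le> ht w t} = Suc (card {w \<in> V. lev V j t < ht w t})"
    using V v by simp
  then show ?thesis using lev_props(2,3)[OF V, of t] by linarith
qed

context ngon
begin

text \<open>A closed form for what is left after removing \<open>k\<close> levels. Each removal
  takes away the highest and the lowest remaining order statistic together, because a half turn
  exchanges them and they form one level of the strip.\<close>

definition kernel :: "nat \<Rightarrow> line set" where
  "kernel k = lines_of (\<lambda>t. {lev C j t | j. k + 1 \<le> j \<and> j \<le> n - k})"

lemma antiper_levels: "antiper (\<lambda>t. {lev C j t | j. k + 1 \<le> j \<and> j \<le> n - k})"
  unfolding antiper_def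
proof (intro allI iffI)
  fix t d
  have sh: "lev C j (t + pi) = - lev C (n + 1 - j) t" if "k + 1 \<le> j" "j \<le> n - k" for j
    using lev_add_pi[OF fin_C, of j t] that card_C by simp
  show "- d \<in> {lev C j t |j. k + 1 \<le> j \<and> j \<le> n - k}" if d: "d \<in> {lev C j (t + pi) |j. k + 1 \<le> j \<and> j \<le> n - k}"
  proof -
    obtain j where j: "k + 1 \<le> j" "j \<le> n - k" "d = lev C j (t + pi)" using d by blast
    have "- d = lev C (n + 1 - j) t" using sh[OF j(1,2)] j(3) by simp
    moreover have "k + 1 \<le> n + 1 - j" "n + 1 - j \<le> n - k" using j by linarith+
    ultimately show ?thesis by blast
  qed
  show "d \<in> {lev C j (t + pi) |j. k + 1 \<le> j \<and> j \<le> n - k}" if d: "- d \<in> {lev C j t |j. k + 1 \<le> j \<and> j \<le> n - k}"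
  proof -
    obtain j where j: "k + 1 \<le> j" "j \<le> n - k" "- d = lev C j t" using d by blast
    have r: "k + 1 \<le> n + 1 - j" "n + 1 - j \<le> n - k" using j by linarith+
    have "n + 1 - (n + 1 - j) = j" using j by linarith
    then have "d = lev C (n + 1 - j) (t + pi)" using sh[OF r] j(3) by simp
    then show ?thesis using r by blast
  qed
qed

lemma mem_kernel: "mk_line t d \<in> kernel k \<longleftrightarrow> (\<exists>j. k + 1 \<le> j \<and> j \<le> n - k \<and> d = lev C j t)"
  unfolding kernel_def mem_lines_of[OF antiper_levels] by blast

lemma closed_kernel: "closed (kernel k)"
proof -
  have "{(t, d). d \<in> {lev C j t | j. k + 1 \<le> j \<and> j \<le> n - k}} =
      (\<Union>j\<in>{k + 1..n - k}. {x. snd x = lev C j (fst x)})" by auto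
  moreover have "closed (\<Union>j\<in>{k + 1..n - k}. {x. snd x = lev C j (fst x)})"
  proof (intro closed_UN ballI)
    fix j assume "j \<in> {k + 1..n - k}"
    then have "continuous_on UNIV (lev C j)" using continuous_on_lev[OF fin_C, of j] card_C by auto
    then have "continuous_on UNIV (\<lambda>x :: real \<times> real. lev C j (fst x))"
      by (rule continuous_on_compose2) (auto intro: continuous_intros)
    then show "closed {x :: real \<times> real. snd x = lev C j (fst x)}"
      by (intro closed_Collect_eq continuous_intros)
  qed simp
  ultimately show ?thesis unfolding kernel_def closed_lines_of[OF antiper_levels] by simp
qed

lemma support_dual_points: "support (dual_points C) = kernel 0"
proof -
  have "mk_line t d \<in> support (dual_points C) \<longleftrightarrow> mk_line t d \<in> kernel 0" for t d
  proof -
    have "mk_line t d \<in> support (dual_points C) \<longleftrightarrow> (\<exists>p\<in>C. d = ht p t)"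
      using mem_represented[OF represents_dual_point] by (auto simp: support_def dual_points_def)
    also have "\<dots> \<longleftrightarrow> (\<exists>j. 1 \<le> j \<and> j \<le> n \<and> d = lev C j t)"
    proof
      assume "\<exists>p\<in>C. d = ht p t"
      then obtain p where p: "p \<in> C" "d = ht p t" by blast
      have "{w \<in> C. d < ht w t} \<subset> {w \<in> C. d \<le> ht w t}" using p by auto
      then have lt: "card {w \<in> C. d < ht w t} < card {w \<in> C. d \<le> ht w t}"
        using fin_C by (intro psubset_card_mono) auto
      then have "lev C (card {w \<in> C. d \<le> ht w t}) t = d" by (intro lev_eqI[OF fin_C]) auto
      moreover have "card {w \<in> C. d \<le> ht w t} \<le> n" using fin_C card_C card_mono[of C] by auto
      ultimately show "\<exists>j. 1 \<le> j \<and> j \<le> n \<and> d = lev C j t" using lt by (intro exI[of _ "card {w \<in> C. d \<le> ht w t}"]) auto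
    next
      assume "\<exists>j. 1 \<le> j \<and> j \<le> n \<and> d = lev C j t"
      then show "\<exists>p\<in>C. d = ht p t" using lev_props(1)[OF fin_C] card_C by auto
    qed
    finally show ?thesis by (simp add: mem_kernel)
  qed
  then show ?thesis by (metis line_exhaust subsetI subset_antisym)
qed

lemma lev_bounded: "1 \<le> j \<Longrightarrow> j \<le> n \<Longrightarrow> \<bar>lev C j t\<bar> \<le> (\<Sum>v\<in>C. norm v)"
proof -
  assume "1 \<le> j" "j \<le> n"
  then obtain v where v: "v \<in> C" "lev C j t = ht v t" using lev_props(1)[OF fin_C, of j t] card_C by auto
  have "norm v \<le> (\<Sum>v\<in>C. norm v)" using v fin_C by (intro member_le_sum) auto
  then show ?thesis using v abs_ht_le[of v t] by simp
qed

text \<open>The strip has one end only: the region below level \<open>n - k\<close> is the region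
  above level \<open>k + 1\<close> seen after a half turn.\<close>

definition outer :: "nat \<Rightarrow> line set" where
  "outer k = lines_of (\<lambda>t. {d. lev C (k + 1) t < d \<or> d < lev C (n - k) t})"

definition outer_closed :: "nat \<Rightarrow> line set" where
  "outer_closed k = lines_of (\<lambda>t. {d. lev C (k + 1) t \<le> d \<or> d \<le> lev C (n - k) t})"

context
  fixes k :: nat assumes kn: "k + 1 \<le> n - k"
begin

lemma kn': "1 \<le> k + 1" "k + 1 \<le> card C" "1 \<le> n - k" "n - k \<le> card C"
  using kn card_C by auto

lemma top_bottom: "lev C (k + 1) (t + pi) = - lev C (n - k) t" "lev C (n - k) (t + pi) = - lev C (k + 1) t"
  using lev_add_pi[OF fin_C kn'(1,2), of t] lev_add_pi[OF fin_C kn'(3,4), of t] kn card_C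
  by (auto simp: Suc_diff_le)

lemma antiper_outer:
  "antiper (\<lambda>t. {d. lev C (k + 1) t < d \<or> d < lev C (n - k) t})"
  "antiper (\<lambda>t. {d. lev C (k + 1) t \<le> d \<or> d \<le> lev C (n - k) t})"
  unfolding antiper_def mem_Collect_eq top_bottom by auto

lemma mem_outer:
  "mk_line t d \<in> outer k \<longleftrightarrow> lev C (k + 1) t < d \<or> d < lev C (n - k) t"
  "mk_line t d \<in> outer_closed k \<longleftrightarrow> lev C (k + 1) t \<le> d \<or> d \<le> lev C (n - k) t"
  unfolding outer_def outer_closed_def using mem_lines_of antiper_outer by auto

lemma cont_top_bottom:
  "continuous_on UNIV (\<lambda>x :: real \<times> real. lev C (k + 1) (fst x))"
  "continuous_on UNIV (\<lambda>x :: real \<times> real. lev C (n - k) (fst x))"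
  using continuous_on_lev[OF fin_C kn'(1,2), of UNIV] continuous_on_lev[OF fin_C kn'(3,4), of UNIV]
  by (auto intro: continuous_on_compose2[OF _ continuous_on_fst[OF continuous_on_id]])

lemma open_outer: "open (outer k)"
proof -
  have "{(t, d). d \<in> {d. lev C (k + 1) t < d \<or> d < lev C (n - k) t}} =
     {x. lev C (k + 1) (fst x) < snd x} \<union> {x. snd x < lev C (n - k) (fst x)}" by auto
  moreover have "open \<dots>"
    by (intro open_Un open_Collect_less cont_top_bottom continuous_intros)
  ultimately show ?thesis unfolding outer_def open_lines_of[OF antiper_outer(1)] by simp
qed

lemma closed_outer_closed: "closed (outer_closed k)"
proof -
  have "{(t, d). d \<in> {d. lev C (k + 1) t \<le> d \<or> d \<le> lev C (n - k) t}} =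
     {x. lev C (k + 1) (fst x) \<le> snd x} \<union> {x. snd x \<le> lev C (n - k) (fst x)}" by auto
  moreover have "closed \<dots>"
    by (intro closed_Un closed_Collect_le cont_top_bottom continuous_intros)
  ultimately show ?thesis unfolding outer_closed_def closed_lines_of[OF antiper_outer(2)] by simp
qed

lemma outer_eq_image: "outer k = case_prod mk_line ` {(t, d). lev C (k + 1) t < d}"
proof
  show "case_prod mk_line ` {(t, d). lev C (k + 1) t < d} \<subseteq> outer k" using mem_outer by auto
  show "outer k \<subseteq> case_prod mk_line ` {(t, d). lev C (k + 1) t < d}"
  proof
    fix l assume l: "l \<in> outer k"
    obtain t d where td: "l = mk_line t d" by (rule line_exhaust)
    consider "lev C (k + 1) t < d" | "lev C (k + 1) (t + pi) < - d"
      using l td mem_outer top_bottom by auto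
    then show "l \<in> case_prod mk_line ` {(t, d). lev C (k + 1) t < d}"
    proof cases
      case 1 then show ?thesis using td by auto
    next
      case 2 then show ?thesis using td mk_line_add_pi[of t d] by (auto intro!: image_eqI[of _ _ "(t + pi, - d)"])
    qed
  qed
qed

text \<open>By \<open>outer_eq_image\<close> the part above level \<open>k + 1\<close> suffices, and
  it is a half-plane sheared by a continuous function.\<close>

lemma connected_outer: "connected (outer k)"
proof -
  have "{(t, d). lev C (k + 1) t < d} = (\<lambda>x. (fst x, lev C (k + 1) (fst x) + snd x)) ` (UNIV \<times> {0<..})"
  proof (intro set_eqI iffI)
    fix x assume "x \<in> {(t, d). lev C (k + 1) t < d}"
    then show "x \<in> (\<lambda>x. (fst x, lev C (k + 1) (fst x) + snd x)) ` (UNIV \<times> {0<..})"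
      by (intro image_eqI[of _ _ "(fst x, snd x - lev C (k + 1) (fst x))"]) (auto split: prod.splits)
  qed auto
  moreover have "connected ((\<lambda>x. (fst x, lev C (k + 1) (fst x) + snd x)) ` ((UNIV :: real set) \<times> {0::real<..}))"
    by (intro connected_continuous_image connected_Times continuous_intros
        continuous_on_subset[OF cont_top_bottom(1)]) auto
  ultimately have "connected {(t, d). lev C (k + 1) t < d}" by simp
  then show ?thesis unfolding outer_eq_image
    by (intro connected_continuous_image continuous_on_mk_line)
qed

lemma kernel_between: "mk_line t d \<in> kernel k \<Longrightarrow> lev C (n - k) t \<le> d \<and> d \<le> lev C (k + 1) t"
  using lev_antimono[OF fin_C, of "k + 1"] lev_antimono[OF fin_C, of _ "n - k"] kn card_C
  by (auto simp: mem_kernel)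

lemma outer_closed_cases: "l \<in> outer_closed k \<Longrightarrow> l \<in> outer k \<or> l \<in> kernel k"
proof -
  assume l: "l \<in> outer_closed k"
  obtain t d where "l = mk_line t d" by (rule line_exhaust)
  then show ?thesis using l kn unfolding mem_outer mem_kernel
    by (metis mem_outer mem_kernel le_less order_refl)
qed

lemma outer_subset: "outer k \<subseteq> - kernel k"
proof
  fix l assume "l \<in> outer k"
  moreover obtain t d where "l = mk_line t d" by (rule line_exhaust)
  ultimately show "l \<in> - kernel k" using kernel_between[of t d] by (auto simp: mem_outer)
qed

lemma outer_subset_closed: "outer k \<subseteq> outer_closed k"
proof
  fix l assume "l \<in> outer k"
  moreover obtain t d where "l = mk_line t d" by (rule line_exhaust)
  ultimately show "l \<in> outer_closed k" by (auto simp: mem_outer)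
qed

text \<open>\<open>outer k\<close> is open, \<open>outer_closed k\<close> is closed, and the two
  coincide outside the kernel, so a connected set that avoids the kernel cannot leave
  \<open>outer k\<close>.\<close>

lemma outer_in_components: "outer k \<in> components (- kernel k)"
  unfolding in_components_maximal
proof (intro conjI allI impI)
  have "mk_line 0 (lev C (k + 1) 0 + 1) \<in> outer k" by (simp add: mem_outer)
  then show ne: "outer k \<noteq> {}" by blast
  show "outer k \<subseteq> - kernel k" by (rule outer_subset)
  show "connected (outer k)" by (rule connected_outer)
  fix D assume D: "D \<noteq> {} \<and> outer k \<subseteq> D \<and> D \<subseteq> - kernel k \<and> connected D"
  then have "D \<subseteq> outer k \<union> - outer_closed k" using outer_closed_cases by blast
  moreover have "outer k \<inter> - outer_closed k \<inter> D = {}" using outer_subset_closed by blast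
  moreover have "outer k \<inter> D \<noteq> {}" using ne D by blast
  ultimately have "- outer_closed k \<inter> D = {}"
    using D open_outer closed_outer_closed unfolding connected_def by (metis open_Compl)
  then show "D = outer k" using D outer_closed_cases by blast
qed

text \<open>Any other component lies between the levels \<open>n - k\<close> and
  \<open>k + 1\<close>, where heights are bounded.\<close>

lemma external_face_kernel: "external_face (kernel k) = outer k"
proof -
  have ub: "\<not> bounded {d. \<exists>\<theta>. mk_line \<theta> d \<in> outer k}"
  proof
    assume "bounded {d. \<exists>\<theta>. mk_line \<theta> d \<in> outer k}"
    then obtain B where B: "\<And>d. (\<exists>\<theta>. mk_line \<theta> d \<in> outer k) \<Longrightarrow> \<bar>d\<bar> \<le> B"
      unfolding bounded_real by blast
    have "mk_line 0 (max (lev C (k + 1) 0) B + 1 + \<bar>B\<bar>) \<in> outer k" by (auto simp: mem_outer)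
    then show False using B by fastforce
  qed
  have "F = outer k" if F: "F \<in> components (- kernel k)" "\<not> bounded {d. \<exists>\<theta>. mk_line \<theta> d \<in> F}" for F
  proof (rule ccontr)
    assume "F \<noteq> outer k"
    then have dis: "F \<inter> outer k = {}" using F(1) outer_in_components components_nonoverlap by blast
    have "\<bar>d\<bar> \<le> (\<Sum>v\<in>C. norm v)" if "mk_line t d \<in> F" for t d
    proof -
      have "mk_line t d \<notin> outer k" using that dis by blast
      then have "lev C (n - k) t \<le> d" "d \<le> lev C (k + 1) t" by (auto simp: mem_outer)
      moreover have "\<bar>lev C (n - k) t\<bar> \<le> (\<Sum>v\<in>C. norm v)" "\<bar>lev C (k + 1) t\<bar> \<le> (\<Sum>v\<in>C. norm v)"
        by (rule lev_bounded; use kn in linarith)+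
      ultimately show ?thesis by linarith
    qed
    then have "bounded {d. \<exists>\<theta>. mk_line \<theta> d \<in> F}" unfolding bounded_real by blast
    then show False using F by blast
  qed
  then show ?thesis unfolding external_face_def using outer_in_components ub by blast
qed

lemma closure_outer: "closure (outer k) = outer_closed k"
proof
  show "closure (outer k) \<subseteq> outer_closed k"
    by (rule closure_minimal[OF outer_subset_closed closed_outer_closed])
  show "outer_closed k \<subseteq> closure (outer k)"
  proof
    fix l assume l: "l \<in> outer_closed k"
    obtain t d where td: "l = mk_line t d" by (rule line_exhaust)
    have up: "mk_line t d \<in> closure (outer k)" if "lev C (k + 1) t \<le> d" for t d
    proof -
      have "mk_line t ` closure {lev C (k + 1) t<..} \<subseteq> closure (outer k)"
      proof (rule image_closure_subset)
        show "continuous_on (closure {lev C (k + 1) t<..}) (mk_line t)"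
          by (rule continuous_on_mk_line_comp) (auto intro: continuous_intros)
        show "mk_line t ` {lev C (k + 1) t<..} \<subseteq> closure (outer k)"
          using closure_subset by (fastforce simp: mem_outer)
      qed simp
      then show ?thesis using that by auto
    qed
    consider "lev C (k + 1) t \<le> d" | "lev C (k + 1) (t + pi) \<le> - d"
      using l td mem_outer top_bottom by auto
    then show "l \<in> closure (outer k)"
      using up[of t d] up[of "t + pi" "- d"] td mk_line_add_pi[of t d] by cases auto
  qed
qed

lemma mem_first_level:
  "mk_line t d \<in> first_level (kernel k) \<longleftrightarrow> d = lev C (k + 1) t \<or> d = lev C (n - k) t"
proof -
  have "lev C (n - k) t \<le> lev C (k + 1) t" using lev_antimono[OF fin_C, of "k + 1" "n - k" t] kn card_C by auto
  then show ?thesis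
    unfolding first_level_def external_face_kernel frontier_def closure_outer interior_open[OF open_outer]
    by (auto simp: mem_outer)
qed

text \<open>For the inclusion from right to left: just after any angle all heights are distinct, so
  an inner level avoids the two removed ones there. Its point at the angle itself is a limit, and
  this is where the closure in \<open>remove_first_level\<close> enters.\<close>

lemma remove_first_level_kernel: "remove_first_level (kernel k) = kernel (k + 1)"
  unfolding remove_first_level_def
proof
  have "l \<in> kernel (k + 1)" if l: "l \<in> kernel k - first_level (kernel k)" for l
  proof -
    obtain t d where td: "l = mk_line t d" by (rule line_exhaust)
    then obtain j where j: "k + 1 \<le> j" "j \<le> n - k" "d = lev C j t" using l by (auto simp: mem_kernel)
    have "j \<noteq> k + 1" "j \<noteq> n - k" using l td j by (auto simp: mem_first_level)
    then have "k + 1 + 1 \<le> j" "j \<le> n - (k + 1)" using j by auto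
    then show ?thesis using j(3) unfolding td mem_kernel by blast
  qed
  then show "closure (kernel k - first_level (kernel k)) \<subseteq> kernel (k + 1)"
    by (intro closure_minimal closed_kernel) blast
  show "kernel (k + 1) \<subseteq> closure (kernel k - first_level (kernel k))"
  proof
    fix l assume l: "l \<in> kernel (k + 1)"
    obtain t d where td: "l = mk_line t d" by (rule line_exhaust)
    then obtain j where j: "k + 1 + 1 \<le> j" "j \<le> n - (k + 1)" "d = lev C j t" using l by (auto simp: mem_kernel)
    obtain e where e: "good t e" using good_ex by blast
    then have e0: "0 < e" by (simp add: good_def)
    have "(\<lambda>s. mk_line s (lev C j s)) ` closure {t<..<t + e} \<subseteq> closure (kernel k - first_level (kernel k))"
    proof (rule image_closure_subset)
      show "continuous_on (closure {t<..<t + e}) (\<lambda>s. mk_line s (lev C j s))"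
        using j card_C by (intro continuous_on_mk_line_comp continuous_on_lev fin_C continuous_intros) auto
      have "mk_line s (lev C j s) \<in> kernel k - first_level (kernel k)" if "s \<in> {t<..<t + e}" for s
      proof -
        have inj: "inj_on (\<lambda>v. ht v s) C" using good_generic[OF e, of s] that by auto
        have c: "card {w \<in> C. lev C i s \<le> ht w s} = i" if "1 \<le> i" "i \<le> n" for i
          using card_ge_lev_generic[OF fin_C _ _ inj] that card_C by auto
        have "i = j" if "lev C j s = lev C i s" "1 \<le> i" "i \<le> n" for i
          using c[OF that(2,3)] c[of j] j unfolding that(1)[symmetric] by simp
        from this[of "k + 1"] this[of "n - k"]
        have "lev C j s \<noteq> lev C (k + 1) s" "lev C j s \<noteq> lev C (n - k) s" using j kn by linarith+
        moreover have "mk_line s (lev C j s) \<in> kernel k" unfolding mem_kernel using j by (intro exI[of _ j]) auto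
        ultimately show ?thesis by (simp add: mem_first_level)
      qed
      then show "(\<lambda>s. mk_line s (lev C j s)) ` {t<..<t + e} \<subseteq> closure (kernel k - first_level (kernel k))"
        using closure_subset by blast
    qed simp
    moreover have "t \<in> closure {t<..<t + e}" using e0 by simp
    ultimately show "l \<in> closure (kernel k - first_level (kernel k))" using td j by auto
  qed
qed

end

lemma remove_levels_eq_kernel: "remove_levels k (support (dual_points C)) = kernel k"
proof (induction k)
  case 0 then show ?case by (simp add: remove_levels_def support_dual_points)
next
  case (Suc k)
  have "remove_levels (Suc k) (support (dual_points C)) = remove_first_level (kernel k)"
    using Suc by (simp add: remove_levels_def)
  also have "\<dots> = kernel (k + 1)"
  proof (cases "k + 1 \<le> n - k")
    case True then show ?thesis by (rule remove_first_level_kernel)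
  next
    case False
    then have "kernel k = {}" "kernel (k + 1) = {}" by (auto simp: kernel_def lines_of_def)
    then show ?thesis by (simp add: remove_first_level_def)
  qed
  finally show ?case by simp
qed

text \<open>A line occupies an interval of level indices, from one more than the number of vertices
  strictly above it to the number weakly above; it is in the kernel exactly if this interval meets
  \<open>{k + 1..n - k}\<close>.\<close>

lemma ht_mem_kernel:
  assumes "2 * k + 1 \<le> n" "p \<in> C"
  shows "mk_line t (ht p t) \<in> kernel k \<longleftrightarrow>
    k < card {w \<in> C. ht p t \<le> ht w t} \<and> k < card {w \<in> C. ht w t \<le> ht p t}"
proof -
  let ?d = "ht p t"
  have c: "card {w \<in> C. ht w t \<le> ?d} = n - card {w \<in> C. ?d < ht w t}"
    using card_compl_ht[OF fin_C, of t ?d] card_C by simp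
  have le: "card {w \<in> C. ?d < ht w t} \<le> n" using card_mono[OF fin_C] card_C by auto
  have lt: "card {w \<in> C. ?d < ht w t} < card {w \<in> C. ?d \<le> ht w t}"
    using fin_C assms by (intro psubset_card_mono) auto
  show ?thesis
  proof
    assume "mk_line t ?d \<in> kernel k"
    then obtain j where j: "k + 1 \<le> j" "j \<le> n - k" "?d = lev C j t" by (auto simp: mem_kernel)
    have "card {w \<in> C. ?d < ht w t} < j" "j \<le> card {w \<in> C. ?d \<le> ht w t}"
      unfolding j(3) using lev_props(2,3)[OF fin_C, of j t] j card_C by auto
    then show "k < card {w \<in> C. ?d \<le> ht w t} \<and> k < card {w \<in> C. ht w t \<le> ?d}"
      unfolding c using j by linarith
  next
    assume as: "k < card {w \<in> C. ?d \<le> ht w t} \<and> k < card {w \<in> C. ht w t \<le> ?d}"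
    \<comment> \<open>The least index of that interval that is at least
      \<open>k + 1\<close>.\<close>
    define j where "j = max (card {w \<in> C. ?d < ht w t} + 1) (k + 1)"
    have "card {w \<in> C. ?d < ht w t} < j" "j \<le> card {w \<in> C. ?d \<le> ht w t}" using lt as by (auto simp: j_def)
    then have "lev C j t = ?d" by (rule lev_eqI[OF fin_C])
    moreover have "k + 1 \<le> j" "j \<le> n - k" using as le assms unfolding c by (auto simp: j_def)
    ultimately show "mk_line t ?d \<in> kernel k" unfolding mem_kernel by metis
  qed
qed

section \<open>Heights relative to a vertex, and star curves as medians\<close>

definition rel_ht :: "real \<Rightarrow> int \<Rightarrow> int \<Rightarrow> real" where
  "rel_ht t v i = ht (vtx i) t - ht (vtx v) t"

text \<open>Seen from \<open>v\<close>, the vertex \<open>j\<close> lies in the cone spanned by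
  \<open>i\<close> and \<open>l\<close>, with ratios of signed areas as coefficients (Cramer's
  rule). Hence along \<open>v + 1, ..., v + n - 1\<close> relative heights change sign at most
  once.\<close>

lemma rel_ht_between:
  assumes "v < i" "i < j" "j < l" "l < v + int n"
  obtains \<alpha> \<beta> where "0 < \<alpha>" "0 < \<beta>" "rel_ht t v j = \<alpha> * rel_ht t v i + \<beta> * rel_ht t v l"
proof -
  let ?o = "\<lambda>i j. orient (vtx v) (vtx i) (vtx j)"
  have pos: "0 < ?o i j" "0 < ?o j l" "0 < ?o i l"
    using ccw_vtx[of v i j] ccw_vtx[of v j l] ccw_vtx[of v i l] assms by (auto simp: ccw_iff)
  have "rel_ht t v j * ?o i l = rel_ht t v i * ?o j l + rel_ht t v l * ?o i j"
    by (simp add: rel_ht_def orient_def ht_eq algebra_simps)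
  then have "rel_ht t v j = (?o j l / ?o i l) * rel_ht t v i + (?o i j / ?o i l) * rel_ht t v l"
    using pos by (simp add: field_simps)
  then show ?thesis using that[of "?o j l / ?o i l" "?o i j / ?o i l"] pos by simp
qed

lemma rel_ht_pos_between:
  assumes "v < i" "i < j" "j < l" "l < v + int n"
    and "0 \<le> s * rel_ht t v i" "0 \<le> s * rel_ht t v l"
  shows "0 \<le> s * rel_ht t v j" "0 < s * rel_ht t v i \<or> 0 < s * rel_ht t v l \<Longrightarrow> 0 < s * rel_ht t v j"
proof -
  obtain \<alpha> \<beta> where ab: "0 < \<alpha>" "0 < \<beta>" "rel_ht t v j = \<alpha> * rel_ht t v i + \<beta> * rel_ht t v l"
    using rel_ht_between[OF assms(1-4)] by blast
  have eq: "s * rel_ht t v j = \<alpha> * (s * rel_ht t v i) + \<beta> * (s * rel_ht t v l)"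
    unfolding ab(3) by (simp add: algebra_simps)
  show "0 \<le> s * rel_ht t v j" unfolding eq using ab assms by simp
  show "0 < s * rel_ht t v j" if "0 < s * rel_ht t v i \<or> 0 < s * rel_ht t v l"
    using that
  proof
    assume "0 < s * rel_ht t v i"
    then show ?thesis unfolding eq using ab assms by (intro add_pos_nonneg) auto
  next
    assume "0 < s * rel_ht t v l"
    then show ?thesis unfolding eq using ab assms by (intro add_nonneg_pos) auto
  qed
qed

lemma rel_ht_neg_between:
  assumes "v < i" "i < j" "j < l" "l < v + int n"
    and "s * rel_ht t v i \<le> 0" "s * rel_ht t v l \<le> 0"
  shows "s * rel_ht t v j \<le> 0" "s * rel_ht t v i < 0 \<or> s * rel_ht t v l < 0 \<Longrightarrow> s * rel_ht t v j < 0"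
  using rel_ht_pos_between[OF assms(1-4), of "- s" t] assms by auto

lemma rel_ht_nonzero:
  assumes "inj_on (\<lambda>w. ht w t) C" "v < i" "i < v + int n"
  shows "rel_ht t v i \<noteq> 0"
proof -
  have "vtx i \<noteq> vtx v" using vtx_inj[of i v v] assms by auto
  then show ?thesis using assms(1) by (auto simp: rel_ht_def inj_on_def)
qed

text \<open>A line through \<open>v\<close> and no other vertex cuts the cyclic order after
  \<open>g\<close>; the sign \<open>s\<close> is normalised so that the part from
  \<open>v + 1\<close> to \<open>g\<close> is the negative one.\<close>

definition gap_at :: "real \<Rightarrow> int \<Rightarrow> real \<Rightarrow> int \<Rightarrow> bool" where
  "gap_at t v s g \<longleftrightarrow> (s = 1 \<or> s = - 1) \<and> v \<le> g \<and> g < v + int n \<and>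
     (\<forall>i. v < i \<longrightarrow> i < v + int n \<longrightarrow>
        (s * rel_ht t v i < 0 \<longleftrightarrow> i \<le> g) \<and> (0 < s * rel_ht t v i \<longleftrightarrow> g < i))"

lemma gap_generic:
  assumes inj: "inj_on (\<lambda>w. ht w t) C"
  shows "\<exists>s g. gap_at t v s g"
proof -
  define s :: real where "s = (if rel_ht t v (v + 1) < 0 then 1 else - 1)"
  have s: "s = 1 \<or> s = - 1" by (simp add: s_def)
  have nz: "s * rel_ht t v i \<noteq> 0" if "v < i" "i < v + int n" for i
    using rel_ht_nonzero[OF inj that] s by auto
  have one: "s * rel_ht t v (v + 1) < 0"
    using rel_ht_nonzero[OF inj, of v "v + 1"] n_ge_3 by (auto simp: s_def)
  define P where "P = {i. v < i \<and> i < v + int n \<and> s * rel_ht t v i < 0}"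
  have P1: "v + 1 \<in> P" using one n_ge_3 by (auto simp: P_def)
  have finP: "finite P" by (rule finite_subset[of _ "{v..v + int n}"]) (auto simp: P_def)
  define g where "g = Max P"
  have gP: "g \<in> P" unfolding g_def by (rule Max_in[OF finP]) (use P1 in blast)
  have neg: "s * rel_ht t v i < 0" if i: "v < i" "i \<le> g" for i
  proof -
    consider "i = v + 1" | "i = g" | "v + 1 < i" "i < g" using i by linarith
    then show ?thesis
    proof cases
      case 3
      then show ?thesis using rel_ht_neg_between(2)[of v "v + 1" i g s t] one gP by (auto simp: P_def)
    qed (use one gP in \<open>auto simp: P_def\<close>)
  qed
  have npos: "\<not> s * rel_ht t v i < 0" if "g < i" "i < v + int n" "v < i" for i
  proof
    assume "s * rel_ht t v i < 0"
    then have "i \<in> P" using that by (simp add: P_def)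
    then have "i \<le> g" unfolding g_def by (rule Max_ge[OF finP])
    then show False using that by simp
  qed
  have "(s * rel_ht t v i < 0 \<longleftrightarrow> i \<le> g) \<and> (0 < s * rel_ht t v i \<longleftrightarrow> g < i)"
    if i: "v < i" "i < v + int n" for i
  proof (cases "i \<le> g")
    case True then show ?thesis using neg[of i] i by auto
  next
    case False
    then have "\<not> s * rel_ht t v i < 0" using npos i by simp
    then show ?thesis using nz[OF i] False by linarith
  qed
  then have "gap_at t v s g" using gP s by (auto simp: gap_at_def P_def)
  then show ?thesis by blast
qed

lemma gap_at_signs:
  assumes "gap_at t v s g"
  shows "s = 1 \<or> s = - 1" "v \<le> g" "g < v + int n"
    "v < i \<Longrightarrow> i < v + int n \<Longrightarrow> s * rel_ht t v i < 0 \<longleftrightarrow> i \<le> g"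
    "v < i \<Longrightarrow> i < v + int n \<Longrightarrow> 0 < s * rel_ht t v i \<longleftrightarrow> g < i"
  using assms by (auto simp: gap_at_def)

abbreviation star_vs :: "nat \<Rightarrow> int \<Rightarrow> (nat \<Rightarrow> int) \<Rightarrow> (nat \<Rightarrow> int) \<Rightarrow> complex set" where
  "star_vs k v a b \<equiv> vtx ` ({v} \<union> a ` {..<k} \<union> b ` {..<k})"

lemma star_pos_range:
  assumes "star_pos k v a b" "i < k"
  shows "v < a i" "a i < v + int n" "v < b i" "b i < v + int n" "a i < b i"
proof -
  have "v < a i \<and> a i < b i \<and> b i < v + int n" using assms by (auto simp: star_pos_def)
  then show "v < a i" "a i < v + int n" "v < b i" "b i < v + int n" "a i < b i" by auto
qed

lemma star_pos_sep: "star_pos k v a b \<Longrightarrow> i < k \<Longrightarrow> j < k \<Longrightarrow> a i < b j"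
  and star_pos_mono: "star_pos k v a b \<Longrightarrow> i < j \<Longrightarrow> j < k \<Longrightarrow> a i < a j \<and> b i < b j"
  by (auto simp: star_pos_def)

lemma card_star_sides:
  assumes st: "star_pos k v a b"
  shows "card ((vtx \<circ> a) ` {..<k}) = k" "card ((vtx \<circ> b) ` {..<k}) = k"
    "vtx v \<notin> (vtx \<circ> a) ` {..<k}" "vtx v \<notin> (vtx \<circ> b) ` {..<k}"
    "(vtx \<circ> a) ` {..<k} \<inter> (vtx \<circ> b) ` {..<k} = {}"
proof -
  note inj = star_pos_vertices[OF st]
  have ia: "inj_on (vtx \<circ> a) {..<k}" "inj_on (vtx \<circ> b) {..<k}"
    by (auto intro!: comp_inj_on inj(3,4) inj_on_subset[OF inj(1)])
  then show "card ((vtx \<circ> a) ` {..<k}) = k" "card ((vtx \<circ> b) ` {..<k}) = k"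
    by (simp_all only: card_image card_lessThan)
  have ne: "vtx v \<noteq> vtx i" if "v < i" "i < v + int n" for i using vtx_inj[of v i v] that by auto
  show "vtx v \<notin> (vtx \<circ> a) ` {..<k}" "vtx v \<notin> (vtx \<circ> b) ` {..<k}"
  proof -
    have "vtx v \<noteq> vtx (a i)" "vtx v \<noteq> vtx (b i)" if "i < k" for i
      using ne star_pos_range[OF st that] by blast+
    then show "vtx v \<notin> (vtx \<circ> a) ` {..<k}" "vtx v \<notin> (vtx \<circ> b) ` {..<k}" by auto
  qed
  have "vtx (a i) \<noteq> vtx (b j)" if "i < k" "j < k" for i j
    using vtx_inj[of "a i" "b j" v] star_pos_range[OF st that(1)] star_pos_range[OF st that(2)]
      star_pos_sep[OF st that] by auto
  then show "(vtx \<circ> a) ` {..<k} \<inter> (vtx \<circ> b) ` {..<k} = {}" by auto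
qed

text \<open>The vertex \<open>v\<close> has \<open>k\<close> star vertices weakly on each side, so
  its height is the median.\<close>

lemma lev_star_of_split:
  assumes st: "star_pos k v a b" and s: "s = 1 \<or> s = (- 1 :: real)"
    and split: "\<And>i. i < k \<Longrightarrow> s * rel_ht t v (a i) \<le> 0 \<and> 0 \<le> s * rel_ht t v (b i)"
  shows "lev (star_vs k v a b) (k + 1) t = ht (vtx v) t"
proof (rule lev_eqI)
  let ?d = "ht (vtx v) t" and ?A = "(vtx \<circ> a) ` {..<k}" and ?B = "(vtx \<circ> b) ` {..<k}"
  let ?V = "star_vs k v a b"
  have V: "?V = insert (vtx v) (?A \<union> ?B)" by auto
  define Up where "Up = (if s = 1 then ?B else ?A)"
  define Dn where "Dn = (if s = 1 then ?A else ?B)"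
  have VU: "?V = insert (vtx v) (Up \<union> Dn)" unfolding V Up_def Dn_def by auto
  have up: "?d \<le> ht w t" if "w \<in> Up" for w
    using that s split by (auto simp: Up_def rel_ht_def split: if_splits)
  have dn: "ht w t \<le> ?d" if "w \<in> Dn" for w
    using that s split by (auto simp: Dn_def rel_ht_def split: if_splits)
  have c: "card Up = k" "vtx v \<notin> Up" "finite Up"
    using card_star_sides[OF st] by (auto simp: Up_def)
  show "finite ?V" by simp
  have "{w \<in> ?V. ?d < ht w t} \<subseteq> Up"
  proof
    fix w assume w: "w \<in> {w \<in> ?V. ?d < ht w t}"
    then have "w \<in> insert (vtx v) (Up \<union> Dn)" unfolding VU by blast
    then show "w \<in> Up" using w dn[of w] by auto
  qed
  then have "card {w \<in> ?V. ?d < ht w t} \<le> card Up" using c by (intro card_mono) auto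
  then show "card {w \<in> ?V. ?d < ht w t} < k + 1" using c by simp
  have "insert (vtx v) Up \<subseteq> {w \<in> ?V. ?d \<le> ht w t}" using VU up by auto
  then have "card (insert (vtx v) Up) \<le> card {w \<in> ?V. ?d \<le> ht w t}" by (intro card_mono) auto
  then show "k + 1 \<le> card {w \<in> ?V. ?d \<le> ht w t}" using c by simp
qed

text \<open>It suffices to look at the two sides of the angle at \<open>v\<close>: if some
  \<open>a i\<close> were on the wrong side, then \<open>a (k - 1)\<close>, which lies between it
  and \<open>b 0\<close>, would be there too, by \<open>rel_ht_pos_between\<close>; likewise for
  \<open>b i\<close>.\<close>

lemma split_of_middle:
  assumes st: "star_pos k v a b" and k: "1 \<le> k"
    and mid: "s * rel_ht t v (a (k - 1)) \<le> 0" "0 \<le> s * rel_ht t v (b 0)" and i: "i < k"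
  shows "s * rel_ht t v (a i) \<le> 0 \<and> 0 \<le> s * rel_ht t v (b i)"
proof
  have k1: "k - 1 < k" "0 < k" using k by auto
  note ra = star_pos_range[OF st k1(1)] and rb = star_pos_range[OF st k1(2)]
  note sep = star_pos_sep[OF st k1]
  note ri = star_pos_range[OF st i]
  show "s * rel_ht t v (a i) \<le> 0"
  proof (cases "i = k - 1")
    case False
    then have lt: "a i < a (k - 1)" using star_pos_mono[OF st, of i "k - 1"] i by auto
    show ?thesis
    proof (rule ccontr)
      assume "\<not> ?thesis"
      then have "0 < s * rel_ht t v (a (k - 1))"
        using rel_ht_pos_between(2)[OF ri(1) lt sep rb(4), of s t] mid by auto
      then show False using mid by simp
    qed
  qed (use mid in simp)
  show "0 \<le> s * rel_ht t v (b i)"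
  proof (cases "i = 0")
    case False
    then have lt: "b 0 < b i" using star_pos_mono[OF st, of 0 i] i by auto
    show ?thesis
    proof (rule ccontr)
      assume "\<not> ?thesis"
      then have "s * rel_ht t v (b 0) < 0"
        using rel_ht_neg_between(2)[OF ra(1) sep lt ri(4), of s t] mid by auto
      then show False using mid by simp
    qed
  qed (use mid in simp)
qed

text \<open>If \<open>a (k - 1)\<close> and \<open>b 0\<close> were strictly on the same side, the
  single sign change would put all \<open>a\<close> or all \<open>b\<close> there too. With the
  other middle vertex this makes \<open>k + 1\<close> vertices strictly on one side of the
  median.\<close>

lemma split_of_lev_star:
  assumes st: "star_pos k v a b" and k: "1 \<le> k"
    and med: "lev (star_vs k v a b) (k + 1) t = ht (vtx v) t"
  shows "\<exists>s :: real. (s = 1 \<or> s = - 1) \<and> (\<forall>i<k. s * rel_ht t v (a i) \<le> 0 \<and> 0 \<le> s * rel_ht t v (b i))"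
proof -
  let ?V = "star_vs k v a b" and ?d = "ht (vtx v) t"
  have k1: "k - 1 < k" "0 < k" using k by auto
  note ra = star_pos_range[OF st k1(1)] and rb = star_pos_range[OF st k1(2)]
  note sep = star_pos_sep[OF st k1]
  have fV: "finite ?V" by simp
  have cV: "card ?V = 2 * k + 1" using star_pos_vertices[OF st] by (simp only: card_image)
  have cU: "card {w \<in> ?V. ?d < ht w t} < k + 1" "k + 1 \<le> card {w \<in> ?V. ?d \<le> ht w t}"
    using lev_props(2,3)[OF fV, of "k + 1" t] cV unfolding med by auto
  have cD: "card {w \<in> ?V. ht w t < ?d} < k + 1"
    using card_compl_ht(1)[OF fV, of t ?d] cU cV by simp
  have few: False if s: "s = 1 \<or> s = - 1" and W: "W \<subseteq> ?V" "card W = k + 1"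
    and pos: "\<And>w. w \<in> W \<Longrightarrow> 0 < s * (ht w t - ?d)" for s :: real and W
  proof -
    have "W \<subseteq> {w \<in> ?V. ?d < ht w t} \<or> W \<subseteq> {w \<in> ?V. ht w t < ?d}" using s W(1) pos by fastforce
    then have "card W \<le> card {w \<in> ?V. ?d < ht w t} \<or> card W \<le> card {w \<in> ?V. ht w t < ?d}"
      by (auto intro!: card_mono)
    then show False using cU cD W by auto
  qed
  have both: "\<not> (0 < s * rel_ht t v (a (k - 1)) \<and> 0 < s * rel_ht t v (b 0))" if s: "s = 1 \<or> s = - 1" for s :: real
  proof
    assume xy: "0 < s * rel_ht t v (a (k - 1)) \<and> 0 < s * rel_ht t v (b 0)"
    have "(\<forall>i<k. 0 < s * rel_ht t v (a i)) \<or> (\<forall>j<k. 0 < s * rel_ht t v (b j))"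
    proof (rule ccontr)
      assume "\<not> ?thesis"
      then obtain i j where ij: "i < k" "j < k" "s * rel_ht t v (a i) \<le> 0" "s * rel_ht t v (b j) \<le> 0"
        by force
      have "i \<noteq> k - 1" using ij xy by auto
      then have "a i < a (k - 1)" using star_pos_mono[OF st, of i "k - 1"] ij by auto
      then have "s * rel_ht t v (a (k - 1)) \<le> 0"
        using rel_ht_neg_between(1)[of v "a i" "a (k - 1)" "b j" s t] star_pos_range[OF st ij(1)]
          star_pos_range[OF st ij(2)] star_pos_sep[OF st k1(1) ij(2)] ij by auto
      then show False using xy by simp
    qed
    then show False
    proof
      assume "\<forall>i<k. 0 < s * rel_ht t v (a i)"
      moreover have "card (insert (vtx (b 0)) ((vtx \<circ> a) ` {..<k})) = k + 1"
      proof -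
        have "vtx (b 0) \<in> (vtx \<circ> b) ` {..<k}" using k1 by auto
        then have "vtx (b 0) \<notin> (vtx \<circ> a) ` {..<k}" using card_star_sides(5)[OF st] by blast
        then show ?thesis using card_star_sides(1)[OF st] by simp
      qed
      ultimately show False using few[OF s, of "insert (vtx (b 0)) ((vtx \<circ> a) ` {..<k})"] xy k1
        by (auto simp: rel_ht_def)
    next
      assume "\<forall>i<k. 0 < s * rel_ht t v (b i)"
      moreover have "card (insert (vtx (a (k - 1))) ((vtx \<circ> b) ` {..<k})) = k + 1"
      proof -
        have "vtx (a (k - 1)) \<in> (vtx \<circ> a) ` {..<k}" using k1 by auto
        then have "vtx (a (k - 1)) \<notin> (vtx \<circ> b) ` {..<k}" using card_star_sides(5)[OF st] by blast
        then show ?thesis using card_star_sides(2)[OF st] by simp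
      qed
      ultimately show False using few[OF s, of "insert (vtx (a (k - 1))) ((vtx \<circ> b) ` {..<k})"] xy k1
        by (auto simp: rel_ht_def)
    qed
  qed
  obtain s :: real where s: "s = 1 \<or> s = - 1" "s * rel_ht t v (a (k - 1)) \<le> 0" "0 \<le> s * rel_ht t v (b 0)"
  proof (cases "rel_ht t v (a (k - 1)) \<le> 0")
    case True
    show ?thesis
    proof (cases "0 \<le> rel_ht t v (b 0)")
      case True then show ?thesis using that[of 1] \<open>rel_ht t v (a (k - 1)) \<le> 0\<close> by simp
    next
      case False
      then have "rel_ht t v (a (k - 1)) = 0" using both[of "- 1"] True by simp
      then show ?thesis using that[of "- 1"] False by simp
    qed
  next
    case False
    then have "rel_ht t v (b 0) \<le> 0" using both[of 1] by simp
    then show ?thesis using that[of "- 1"] False by simp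
  qed
  then show ?thesis using split_of_middle[OF st k s(2,3)] by blast
qed

lemma curve_value: "curve V f \<Longrightarrow> \<exists>w\<in>V. f t = ht w t"
  by (simp add: curve_def)

definition med :: "nat \<Rightarrow> complex set set \<Rightarrow> real \<Rightarrow> real" where
  "med k S = lev (\<Union>S) (k + 1)"

lemma curve_med:
  assumes "k_star k C S" "1 \<le> k"
  shows "curve (\<Union>S) (med k S)" "curve C (med k S)"
proof -
  show "curve (\<Union>S) (med k S)"
    unfolding med_def using card_Union_star[OF assms] fin_C finite_subset by (intro curve_lev) auto
  then show "curve C (med k S)" using card_Union_star[OF assms] curve_mono by blast
qed

lemma med_star_set: "1 \<le> k \<Longrightarrow> med k (star_set k v a b) = lev (star_vs k v a b) (k + 1)"
  by (simp only: med_def Union_star_set)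

lemma med_rooted:
  assumes S: "k_star k C S" and k: "1 \<le> k"
  obtains v a b where "star_pos k v a b" "S = star_set k v a b" "med k S t = ht (vtx v) t"
proof -
  obtain w where w: "w \<in> \<Union>S" "med k S t = ht w t"
    using curve_value[OF curve_med(1)[OF assms]] by blast
  then have "w \<in> range vtx" using card_Union_star(2)[OF assms] range_vtx by blast
  then obtain v where v: "vtx v = w" by blast
  then show ?thesis using k_star_rooted[OF S k, of v] w that by blast
qed

text \<open>A line through the vertex \<open>v\<close> bisects the angle at \<open>v\<close> exactly
  if at most \<open>k\<close> vertices of the star lie strictly on either side, by
  \<open>split_of_middle\<close>, \<open>lev_star_of_split\<close> and
  \<open>split_of_lev_star\<close>.\<close>

lemma dual_star_eq:
  assumes S: "k_star k C S" and k: "1 \<le> k"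
  shows "dual_star k C S = range (\<lambda>t. mk_line t (med k S t))"
proof
  show "dual_star k C S \<subseteq> range (\<lambda>t. mk_line t (med k S t))"
  proof
    fix l assume "l \<in> dual_star k C S"
    then obtain s j where s: "star_vertices k C s" "S = star_edges k s" "j < 2 * k + 1" "s j \<in> points_on l"
      and sep: "separates l (s ((j + k + 1) mod (2 * k + 1))) (s ((j + k) mod (2 * k + 1)))"
      by (auto simp: dual_star_def)
    have "s j \<in> C" using s by (auto simp: star_vertices_def)
    then obtain v where v: "s j = vtx v" using range_vtx by blast
    obtain a b where ab: "star_pos k v a b" "S = star_set k v a b"
      "s ((j + k) mod (2 * k + 1)) = vtx (a (k - 1))" "s ((j + k + 1) mod (2 * k + 1)) = vtx (b 0)"
      using star_pos_of_vertices[OF s(1) k s(3) v] s(2) by blast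
    obtain t d where l: "l = mk_line t d" and d: "ht (vtx (b 0)) t \<le> d" "d \<le> ht (vtx (a (k - 1))) t"
      using sep ab by (auto simp: separates_def ht_def)
    have dv: "ht (vtx v) t = d" using s(4) v l by (simp add: line_points_def ht_def)
    have "lev (star_vs k v a b) (k + 1) t = ht (vtx v) t"
      by (rule lev_star_of_split[OF ab(1), of "- 1"], simp, rule split_of_middle[OF ab(1) k])
        (use d dv in \<open>auto simp: rel_ht_def\<close>)
    then have "med k S t = d" using dv by (simp only: ab(2) med_star_set[OF k])
    then show "l \<in> range (\<lambda>t. mk_line t (med k S t))" using l by auto
  qed
  show "range (\<lambda>t. mk_line t (med k S t)) \<subseteq> dual_star k C S"
  proof
    fix l assume "l \<in> range (\<lambda>t. mk_line t (med k S t))"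
    then obtain t where l: "l = mk_line t (med k S t)" by blast
    obtain v a b where ab: "star_pos k v a b" "S = star_set k v a b" and m: "med k S t = ht (vtx v) t"
      using med_rooted[OF S k] by blast
    have "lev (star_vs k v a b) (k + 1) t = ht (vtx v) t" using m by (simp only: ab(2) med_star_set[OF k])
    then obtain s :: real where s: "s = 1 \<or> s = - 1"
      "\<forall>i<k. s * rel_ht t v (a i) \<le> 0 \<and> 0 \<le> s * rel_ht t v (b i)"
      using split_of_lev_star[OF ab(1) k] by blast
    have mid: "s * rel_ht t v (a (k - 1)) \<le> 0" "0 \<le> s * rel_ht t v (b 0)" using s(2) k by auto
    have "separates l (vtx (b 0)) (vtx (a (k - 1)))"
    proof (cases "s = 1")
      case True
      \<comment> \<open>\<open>separates\<close> asks for \<open>b 0\<close> below and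
        \<open>a (k - 1)\<close> above; for \<open>s = 1\<close> this holds after a half
        turn.\<close>
      have "l = mk_line (t + pi) (- med k S t)" using l mk_line_add_pi[of t "med k S t"] by simp
      moreover have "ht (vtx (b 0)) (t + pi) \<le> - med k S t" "- med k S t \<le> ht (vtx (a (k - 1))) (t + pi)"
        using mid True m by (auto simp: rel_ht_def)
      ultimately show ?thesis unfolding separates_def ht_def by blast
    next
      case False
      then have "ht (vtx (b 0)) t \<le> med k S t" "med k S t \<le> ht (vtx (a (k - 1))) t"
        using mid s(1) m by (auto simp: rel_ht_def)
      then show ?thesis using l unfolding separates_def ht_def by blast
    qed
    moreover have "vtx v \<in> points_on l" using l m by (simp add: line_points_def ht_def)
    ultimately show "l \<in> dual_star k C S"
      unfolding dual_star_def mem_Collect_eq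
      by (intro exI[of _ "\<lambda>j. vtx (star_seq k v a b j)"] exI[of _ 0])
        (use star_vertices_star_seq[OF ab(1)] star_edges_star_seq[OF k, of v a b] ab k in
          \<open>auto simp: star_seq_def\<close>)
  qed
qed

lemma med_in_kernel:
  assumes S: "k_star k C S" and k: "1 \<le> k"
  shows "mk_line t (med k S t) \<in> kernel k"
proof -
  note c = card_Union_star[OF S k]
  have fS: "finite (\<Union>S)" using c fin_C finite_subset by blast
  have n: "2 * k + 1 \<le> n" using c card_C fin_C card_mono by metis
  obtain w where w: "w \<in> \<Union>S" "med k S t = ht w t"
    using curve_value[OF curve_med(1)[OF assms]] by blast
  have p: "card {u \<in> \<Union>S. med k S t < ht u t} < k + 1" "k + 1 \<le> card {u \<in> \<Union>S. med k S t \<le> ht u t}"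
    unfolding med_def using lev_props(2,3)[OF fS, of "k + 1" t] c by auto
  have "card {u \<in> \<Union>S. med k S t \<le> ht u t} \<le> card {u \<in> C. med k S t \<le> ht u t}"
    "card {u \<in> \<Union>S. ht u t \<le> med k S t} \<le> card {u \<in> C. ht u t \<le> med k S t}"
    using c fin_C by (auto intro!: card_mono)
  moreover have "k + 1 \<le> card {u \<in> \<Union>S. ht u t \<le> med k S t}"
    using card_compl_ht(2)[OF fS, of t "med k S t"] p c by auto
  ultimately show ?thesis
    using ht_mem_kernel[OF n, of w t] w p c by auto
qed

lemma star_split_generic:
  assumes st: "star_pos k v a b" and k: "1 \<le> k" and inj: "inj_on (\<lambda>w. ht w t) C"
    and m: "med k (star_set k v a b) t = ht (vtx v) t"
    and gap: "gap_at t v s g"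
  shows "\<forall>i<k. a i \<le> g \<and> g < b i"
proof -
  note g = gap_at_signs(1)[OF gap] gap_at_signs(4,5)[OF gap]
  obtain s' :: real where s': "s' = 1 \<or> s' = - 1"
    "\<forall>i<k. s' * rel_ht t v (a i) \<le> 0 \<and> 0 \<le> s' * rel_ht t v (b i)"
    using split_of_lev_star[OF st k] m unfolding med_star_set[OF k] by blast
  have nz: "s' * rel_ht t v (a i) \<noteq> 0" "s' * rel_ht t v (b i) \<noteq> 0" if "i < k" for i
    using rel_ht_nonzero[OF inj] star_pos_range[OF st that] s' by auto
  have strict: "s' * rel_ht t v (a i) < 0" "0 < s' * rel_ht t v (b i)" if "i < k" for i
    using s'(2) nz[OF that] that by (auto simp: less_le)
  have "s' = s"
  proof (rule ccontr)
    assume "s' \<noteq> s"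
    then have e: "s' = - s" using s' g(1) by auto
    have "0 < k" using k by simp
    note r = star_pos_range[OF st \<open>0 < k\<close>]
    have "g < a 0" using strict(1)[OF \<open>0 < k\<close>] g(3)[OF r(1,2)] e by auto
    moreover have "b 0 \<le> g" using strict(2)[OF \<open>0 < k\<close>] g(2)[OF r(3,4)] e by auto
    ultimately show False using r by linarith
  qed
  show ?thesis
  proof (intro allI impI)
    fix i assume i: "i < k"
    note r = star_pos_range[OF st i]
    show "a i \<le> g \<and> g < b i"
      using strict[OF i] g(2)[OF r(1,2)] g(3)[OF r(3,4)] \<open>s' = s\<close> by simp
  qed
qed

text \<open>Both stars can be rooted at the vertex on the line and are split there by the same gap,
  so uniqueness of the star in an angle applies.\<close>

lemma star_through_unique:
  assumes T: "k_triangulation k C T" and k: "1 \<le> k"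
    and S: "k_star k C S" "S \<subseteq> T" and R: "k_star k C R" "R \<subseteq> T"
    and inj: "inj_on (\<lambda>w. ht w t) C" and eq: "med k S t = med k R t"
  shows "S = R"
proof -
  obtain v a b where S': "star_pos k v a b" "S = star_set k v a b" "med k S t = ht (vtx v) t"
    using med_rooted[OF S(1) k] by blast
  obtain w where w: "w \<in> \<Union>R" "med k R t = ht w t"
    using curve_value[OF curve_med(1)[OF R(1) k]] by blast
  have "w = vtx v" using inj w S'(3) eq card_Union_star[OF R(1) k] by (auto simp: inj_on_def)
  then obtain c d where R': "star_pos k v c d" "R = star_set k v c d"
    using k_star_rooted[OF R(1) k, of v] w by blast
  obtain s g where g: "gap_at t v s g" using gap_generic[OF inj] by blast
  have "\<forall>i<k. a i \<le> g \<and> g < b i"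
    using star_split_generic[OF S'(1) k inj _ g] S' by blast
  moreover have "\<forall>i<k. c i \<le> g \<and> g < d i"
    using star_split_generic[OF R'(1) k inj _ g] R' S' eq by metis
  ultimately show ?thesis
    using star_of_triangulation_unique[OF T k S'(1)] S' R' S R by metis
qed

text \<open>A kernel line through \<open>v\<close> has at least \<open>k + 1\<close> vertices,
  \<open>v\<close> included, weakly on each side; this gives the bounds on the gap that
  \<open>star_of_triangulation_exists\<close> requires.\<close>

lemma star_through_exists:
  assumes T: "k_triangulation k C T" and k: "1 \<le> k"
    and inj: "inj_on (\<lambda>w. ht w t) C" and d: "mk_line t d \<in> kernel k"
  shows "\<exists>S. k_star k C S \<and> S \<subseteq> T \<and> med k S t = d"
proof -
  obtain j where j: "k + 1 \<le> j" "j \<le> n - k" "d = lev C j t" using d by (auto simp: mem_kernel)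
  then have n: "2 * k + 1 \<le> n" by linarith
  have "1 \<le> j" "j \<le> card C" using j card_C by auto
  then obtain p where p: "p \<in> C" "d = ht p t" using lev_props(1)[OF fin_C, of j t] j(3) by blast
  have "p \<in> range vtx" using p(1) range_vtx by simp
  then obtain v where v: "p = vtx v" by blast
  have cc: "k < card {w \<in> C. d \<le> ht w t}" "k < card {w \<in> C. ht w t \<le> d}"
    using d ht_mem_kernel[OF n p(1), of t] p by auto
  obtain s g where gap: "gap_at t v s g" using gap_generic[OF inj] by blast
  note g = gap_at_signs[OF gap]
  have mem_C: "w \<in> C \<Longrightarrow> \<exists>i. w = vtx i \<and> v \<le> i \<and> i < v + int n" for w
    using vtx_surj[of w v] by metis
  have lo: "{w \<in> C. s * (ht w t - d) \<le> 0} \<subseteq> vtx ` {v..g}"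
  proof
    fix w assume w: "w \<in> {w \<in> C. s * (ht w t - d) \<le> 0}"
    then obtain i where i: "w = vtx i" "v \<le> i" "i < v + int n" using mem_C by auto
    show "w \<in> vtx ` {v..g}"
    proof (cases "i = v")
      case False
      then have "\<not> g < i" using g(5)[of i] i w p v by (auto simp: rel_ht_def)
      then show ?thesis using i by auto
    qed (use i g in auto)
  qed
  have hi: "{w \<in> C. 0 \<le> s * (ht w t - d)} \<subseteq> vtx ` insert v {g<..<v + int n}"
  proof
    fix w assume w: "w \<in> {w \<in> C. 0 \<le> s * (ht w t - d)}"
    then obtain i where i: "w = vtx i" "v \<le> i" "i < v + int n" using mem_C by auto
    show "w \<in> vtx ` insert v {g<..<v + int n}"
    proof (cases "i = v")
      case False
      then have "\<not> i \<le> g" using g(4)[of i] i w p v by (auto simp: rel_ht_def)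
      then show ?thesis using i by auto
    qed (use i in auto)
  qed
  have "card {w \<in> C. s * (ht w t - d) \<le> 0} \<le> card {v..g}"
    using card_mono[OF _ lo] card_image_le[of "{v..g}" vtx] by simp
  moreover have "card {w \<in> C. 0 \<le> s * (ht w t - d)} \<le> card (insert v {g<..<v + int n})"
    using card_mono[OF _ hi] card_image_le[of "insert v {g<..<v + int n}" vtx] by simp
  moreover have "k < card {w \<in> C. s * (ht w t - d) \<le> 0}" "k < card {w \<in> C. 0 \<le> s * (ht w t - d)}"
    using cc g(1) by auto
  ultimately have "int k < g - v + 1" "int k < v + int n - g"
    using g(2,3) by (auto simp: card_insert_if)
  then obtain a b where ab: "star_pos k v a b" "star_set k v a b \<subseteq> T" "\<forall>i<k. a i \<le> g \<and> g < b i"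
    using star_of_triangulation_exists[OF T k, of v g] by auto
  have "lev (star_vs k v a b) (k + 1) t = ht (vtx v) t"
  proof (rule lev_star_of_split[OF ab(1) g(1)])
    fix i assume i: "i < k"
    show "s * rel_ht t v (a i) \<le> 0 \<and> 0 \<le> s * rel_ht t v (b i)"
      using g(4)[of "a i"] g(5)[of "b i"] star_pos_range[OF ab(1) i] ab(3) i by auto
  qed
  then have "med k (star_set k v a b) t = d" using p v by (simp only: med_star_set[OF k])
  then show ?thesis using k_star_star_set[OF ab(1) k] ab(2) by blast
qed

end

section \<open>Crossings and contacts of antiperiodic functions\<close>

definition meet :: "real \<Rightarrow> (real \<Rightarrow> real) \<Rightarrow> (real \<Rightarrow> real) \<Rightarrow> real \<Rightarrow> bool" where
  "meet s f g t \<longleftrightarrow> f t = g t \<and>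
     (\<exists>\<epsilon>>0. \<forall>y\<in>{t - \<epsilon><..<t}. \<forall>z\<in>{t<..<t + \<epsilon>}. 0 < s * ((f y - g y) * (f z - g z)))"

text \<open>The parameter of \<open>meet\<close> is the sign required of the product of the
  differences before and after, so that facts about crossings and contacts are proved
  together.\<close>

abbreviation "crossing_at \<equiv> meet (- 1)"
abbreviation "contact_at \<equiv> meet 1"

lemma meet_sym: "meet s f g t \<longleftrightarrow> meet s g f t"
proof -
  have "(f y - g y) * (f z - g z) = (g y - f y) * (g z - f z)" for y z by algebra
  then show ?thesis unfolding meet_def by metis
qed

lemma meet_add_pi:
  assumes f: "\<And>t. f (t + pi) = - f t" and g: "\<And>t. g (t + pi) = - g t"
  shows "meet s f g (t + pi) \<longleftrightarrow> meet s f g t"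
proof -
  have f': "f t = - f (t - pi)" and g': "g t = - g (t - pi)" for t
    using f[of "t - pi"] g[of "t - pi"] by simp_all
  have one: "meet s f g (t + pi)" if m: "meet s f g t" for t
  proof -
    obtain \<epsilon> where e: "0 < \<epsilon>" "\<And>y z. t - \<epsilon> < y \<Longrightarrow> y < t \<Longrightarrow> t < z \<Longrightarrow> z < t + \<epsilon> \<Longrightarrow> 0 < s * ((f y - g y) * (f z - g z))"
      using m by (auto simp: meet_def)
    have "0 < s * ((f y - g y) * (f z - g z))" if "t + pi - \<epsilon> < y" "y < t + pi" "t + pi < z" "z < t + pi + \<epsilon>" for y z
    proof -
      have "0 < s * ((f (y - pi) - g (y - pi)) * (f (z - pi) - g (z - pi)))"
        by (rule e(2)) (use that in auto)
      also have "(f (y - pi) - g (y - pi)) * (f (z - pi) - g (z - pi)) = (f y - g y) * (f z - g z)"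
        unfolding f'[of y] f'[of z] g'[of y] g'[of z] by algebra
      finally show ?thesis .
    qed
    then show ?thesis using m e(1) f g by (auto simp: meet_def)
  qed
  have two: "meet s f g t" if m: "meet s f g (t + pi)" for t
  proof -
    obtain \<epsilon> where e: "0 < \<epsilon>" "\<And>y z. t + pi - \<epsilon> < y \<Longrightarrow> y < t + pi \<Longrightarrow> t + pi < z \<Longrightarrow> z < t + pi + \<epsilon> \<Longrightarrow>
        0 < s * ((f y - g y) * (f z - g z))"
      using m by (auto simp: meet_def)
    have "0 < s * ((f y - g y) * (f z - g z))" if "t - \<epsilon> < y" "y < t" "t < z" "z < t + \<epsilon>" for y z
    proof -
      have "0 < s * ((f (y + pi) - g (y + pi)) * (f (z + pi) - g (z + pi)))"
        by (rule e(2)) (use that in auto)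
      also have "(f (y + pi) - g (y + pi)) * (f (z + pi) - g (z + pi)) = (f y - g y) * (f z - g z)"
        unfolding f g by algebra
      finally show ?thesis .
    qed
    then show ?thesis using m e(1) f g by (auto simp: meet_def)
  qed
  show ?thesis using one two by blast
qed

lemma meet_int:
  assumes f: "\<And>t. f (t + pi) = - f t" and g: "\<And>t. g (t + pi) = - g t"
  shows "meet s f g (t + of_int m * pi) \<longleftrightarrow> meet s f g t"
proof -
  \<comment> \<open>As the family does not depend on \<open>d\<close>, \<open>antiper\<close> only
    says that the property is invariant under adding \<open>pi\<close>, and
    \<open>antiper_int\<close> does the induction.\<close>
  define F :: "real \<Rightarrow> real set" where "F t = {d. meet s f g t}" for t
  have "antiper F" by (simp add: antiper_def F_def meet_add_pi[where f = f and g = g, OF f g])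
  from antiper_int[OF this, of 0 t m] show ?thesis by (simp add: F_def split: if_splits)
qed

lemma represents_antiper: "represents f L \<Longrightarrow> f (t + pi) = - f t"
  by (simp add: represents_def)

lemma
  assumes "represents f L" "represents g M"
  shows crossing_point_iff: "crossing_point L M P \<longleftrightarrow> (\<exists>t. P = mk_line t (f t) \<and> crossing_at f g t)"
    and contact_point_iff: "contact_point L M P \<longleftrightarrow> (\<exists>t. P = mk_line t (f t) \<and> contact_at f g t)"
proof -
  have u: "(\<exists>f' g' x. represents f' L \<and> represents g' M \<and> Q f' g' x) \<longleftrightarrow> (\<exists>x. Q f g x)" for Q
    using assms represents_unique by metis
  show "crossing_point L M P \<longleftrightarrow> (\<exists>t. P = mk_line t (f t) \<and> crossing_at f g t)"
    unfolding crossing_point_def u meet_def by simp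
  show "contact_point L M P \<longleftrightarrow> (\<exists>t. P = mk_line t (f t) \<and> contact_at f g t)"
    unfolding contact_point_def u meet_def by simp
qed

lemma
  assumes r: "represents f L" "represents g M"
  shows crossing_point_mk_line: "crossing_point L M (mk_line t (f t)) \<longleftrightarrow> crossing_at f g t"
    and contact_point_mk_line: "contact_point L M (mk_line t (f t)) \<longleftrightarrow> contact_at f g t"
proof -
  have "meet s f g t" if eq: "mk_line t (f t) = mk_line t' (f t')" and m: "meet s f g t'" for s t'
  proof -
    obtain m :: int where "t' = t + of_int m * pi" using eq by (auto simp: mk_line_eq_iff)
    then show ?thesis using m meet_int[of f g s t m] represents_antiper[OF r(1)] represents_antiper[OF r(2)]
      by auto
  qed
  then show "crossing_point L M (mk_line t (f t)) \<longleftrightarrow> crossing_at f g t"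
    "contact_point L M (mk_line t (f t)) \<longleftrightarrow> contact_at f g t"
    unfolding crossing_point_iff[OF r] contact_point_iff[OF r] by blast+
qed

lemma mk_line_value_shift:
  assumes "\<And>t. f (t + pi) = - f t"
  shows "mk_line (t + of_int m * pi) (f (t + of_int m * pi)) = mk_line t (f t)"
  unfolding antiperiodic_int[of f, OF assms] by (rule mk_line_shift)

text \<open>Points on the curve of \<open>f\<close> correspond to angles modulo \<open>pi\<close>;
  this is the form in which crossings are counted.\<close>

lemma ex1_crossing_point_iff:
  assumes r: "represents f L" "represents g M"
  shows "(\<exists>!P. crossing_point L M P) \<longleftrightarrow>
    (\<exists>t. crossing_at f g t) \<and> (\<forall>t t'. crossing_at f g t \<longrightarrow> crossing_at f g t' \<longrightarrow> (\<exists>m::int. t' = t + of_int m * pi))"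
    (is "?L \<longleftrightarrow> ?R")
proof
  assume ?L
  then obtain P where P: "crossing_point L M P" "\<And>Q. crossing_point L M Q \<Longrightarrow> Q = P" by blast
  then obtain t0 where "crossing_at f g t0" using crossing_point_iff[OF r] by blast
  moreover have "\<exists>m::int. t' = t + of_int m * pi" if "crossing_at f g t" "crossing_at f g t'" for t t'
  proof -
    have "mk_line t (f t) = mk_line t' (f t')"
      using P(2) crossing_point_mk_line[OF r] that by metis
    then show ?thesis by (auto simp: mk_line_eq_iff)
  qed
  ultimately show ?R by blast
next
  assume R: ?R
  then obtain t where t: "crossing_at f g t" by blast
  show ?L
  proof (rule ex1I[of _ "mk_line t (f t)"])
    show "crossing_point L M (mk_line t (f t))" using t crossing_point_mk_line[OF r] by simp
    fix Q assume "crossing_point L M Q"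
    then obtain t' where t': "Q = mk_line t' (f t')" "crossing_at f g t'" using crossing_point_iff[OF r] by blast
    then obtain m :: int where "t' = t + of_int m * pi" using R t by blast
    then show "Q = mk_line t (f t)" using t' mk_line_value_shift[of f t m] represents_antiper[OF r(1)] by simp
  qed
qed

lemma curve_antiper: "curve V f \<Longrightarrow> f (t + pi) = - f t"
  by (simp add: curve_def)

context ngon
begin

definition germ :: "(real \<Rightarrow> real) \<Rightarrow> real \<Rightarrow> real \<Rightarrow> complex \<Rightarrow> complex \<Rightarrow> bool" where
  "germ f t e p q \<longleftrightarrow> p \<in> C \<and> q \<in> C \<and> f t = ht p t \<and> f t = ht q t \<and>
     (\<forall>y. t - e < y \<longrightarrow> y < t \<longrightarrow> f y = ht p y) \<and> (\<forall>y. t < y \<longrightarrow> y < t + e \<longrightarrow> f y = ht q y)"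

lemma germ_ex:
  assumes "good t e" "curve V f" "V \<subseteq> C"
  obtains p q where "germ f t e p q" "p \<in> V" "q \<in> V"
proof (rule germs[OF assms(1,3,2)])
  fix p q
  assume a: "p \<in> V" "q \<in> V" "f t = ht p t" "f t = ht q t"
    "\<And>y. t - e < y \<Longrightarrow> y < t \<Longrightarrow> f y = ht p y" "\<And>y. t < y \<Longrightarrow> y < t + e \<Longrightarrow> f y = ht q y"
  then have "germ f t e p q" using assms(3) unfolding germ_def by blast
  then show thesis using that a by blast
qed

lemma germD:
  assumes "germ f t e p q"
  shows "p \<in> C" "q \<in> C" "f t = ht p t" "f t = ht q t"
    "t - e < y \<Longrightarrow> y < t \<Longrightarrow> f y = ht p y" "t < y \<Longrightarrow> y < t + e \<Longrightarrow> f y = ht q y"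
  using assms by (auto simp: germ_def)

lemma two_at_tie:
  assumes "p \<in> C" "q \<in> C" "r \<in> C" "p \<noteq> q" "ht p t = d" "ht q t = d" "ht r t = d"
  shows "r = p \<or> r = q"
  using no_triple_tie[of p q r t] assms by auto

text \<open>At most two vertices are level at \<open>t\<close>, so both curves use the same two
  vertices before and after. The heights of these two cross at \<open>t\<close>; curves that stay on
  their vertices therefore cross, and curves that exchange them touch.\<close>

lemma meet_germs:
  assumes g: "good t e" and f: "germ f t e p p'" and h: "germ h t e q q'" and eq: "f t = h t"
    and ne: "p \<noteq> q" "p' \<noteq> q'"
  shows "(p' = p \<and> q' = q \<or> p' = q \<and> q' = p) \<and> (crossing_at f h t \<longleftrightarrow> p' = p) \<and> (contact_at f h t \<longleftrightarrow> p' = q)"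
proof -
  have e: "0 < e" using g by (simp add: good_def)
  note F = germD[OF f] and H = germD[OF h]
  have "p' = p \<or> p' = q" "q' = p \<or> q' = q"
    using two_at_tie[of p q p' t "f t"] two_at_tie[of p q q' t "f t"] F(1-4) H(1-4) ne eq by auto
  then have cases: "p' = p \<and> q' = q \<or> p' = q \<and> q' = p" using ne by auto
  have tie: "ht p t = ht q t" using F(3) H(3) eq by simp
  have sw: "(ht p y - ht q y) * (ht p z - ht q z) < 0" if "t - e < y" "y < t" "t < z" "z < t + e" for y z
    by (rule good_swap[OF g tie ne(1) that])
  have excl: False if m: "crossing_at f h t" "contact_at f h t"
  proof -
    obtain e1 where e1: "0 < e1" "\<forall>y\<in>{t - e1<..<t}. \<forall>z\<in>{t<..<t + e1}. 0 < - 1 * ((f y - h y) * (f z - h z))"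
      using m(1) unfolding meet_def by blast
    obtain e2 where e2: "0 < e2" "\<forall>y\<in>{t - e2<..<t}. \<forall>z\<in>{t<..<t + e2}. 0 < 1 * ((f y - h y) * (f z - h z))"
      using m(2) unfolding meet_def by blast
    define d where "d = min e1 e2 / 2"
    have d: "0 < d" "d < e1" "d < e2" using e1 e2 by (auto simp: d_def)
    have "0 < - 1 * ((f (t - d) - h (t - d)) * (f (t + d) - h (t + d)))" using e1(2) d by simp
    moreover have "0 < 1 * ((f (t - d) - h (t - d)) * (f (t + d) - h (t + d)))" using e2(2) d by simp
    ultimately show False by linarith
  qed
  show ?thesis
    using cases
  proof
    assume c: "p' = p \<and> q' = q"
    have "crossing_at f h t"
      unfolding meet_def
    proof (intro conjI eq exI[of _ e] e ballI)
      fix y z assume "y \<in> {t - e<..<t}" "z \<in> {t<..<t + e}"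
      then show "0 < - 1 * ((f y - h y) * (f z - h z))"
        using F(5)[of y] F(6)[of z] H(5)[of y] H(6)[of z] sw[of y z] c by simp
    qed
    then show ?thesis using c excl ne by auto
  next
    assume c: "p' = q \<and> q' = p"
    have "contact_at f h t"
      unfolding meet_def
    proof (intro conjI eq exI[of _ e] e ballI)
      fix y z assume yz: "y \<in> {t - e<..<t}" "z \<in> {t<..<t + e}"
      then have "(f y - h y) * (f z - h z) = - ((ht p y - ht q y) * (ht p z - ht q z))"
        using F(5)[of y] F(6)[of z] H(5)[of y] H(6)[of z] c by (simp add: algebra_simps)
      then show "0 < 1 * ((f y - h y) * (f z - h z))" using sw[of y z] yz by simp
    qed
    then show ?thesis using c excl ne by auto
  qed
qed

lemma meet_germs_ne:
  assumes g: "good t e" and f: "germ f t e p p'" and h: "germ h t e q q'" and m: "meet s f h t"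
  shows "p \<noteq> q" "p' \<noteq> q'"
proof -
  obtain \<epsilon> where e1: "0 < \<epsilon>" "\<forall>y\<in>{t - \<epsilon><..<t}. \<forall>z\<in>{t<..<t + \<epsilon>}. 0 < s * ((f y - h y) * (f z - h z))"
    using m unfolding meet_def by blast
  have e: "0 < e" using g by (simp add: good_def)
  define d where "d = min \<epsilon> e / 2"
  have d: "0 < d" "d < \<epsilon>" "d < e" using e1 e by (auto simp: d_def)
  have "0 < s * ((f (t - d) - h (t - d)) * (f (t + d) - h (t + d)))" using e1(2) d by simp
  then have "f (t - d) \<noteq> h (t - d)" "f (t + d) \<noteq> h (t + d)" by auto
  then show "p \<noteq> q" "p' \<noteq> q'"
    using germD(5)[OF f, of "t - d"] germD(5)[OF h, of "t - d"] germD(6)[OF f, of "t + d"] germD(6)[OF h, of "t + d"] d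
    by auto
qed

section \<open>Families of curves covering the kernel\<close>

text \<open>What arrangements supported by the kernel and the star curves of a triangulation have in
  common. Injectivity is asked only at angles without ties, since curves may meet at ties. Single
  crossing is kept apart in \<open>cross_once\<close> because for stars it is derived from this
  much.\<close>

definition net :: "nat \<Rightarrow> (real \<Rightarrow> real) set \<Rightarrow> bool" where
  "net k F \<longleftrightarrow> (\<forall>f\<in>F. curve C f) \<and> (\<forall>t d. mk_line t d \<in> kernel k \<longleftrightarrow> (\<exists>f\<in>F. f t = d)) \<and>
     (\<forall>t. inj_on (\<lambda>w. ht w t) C \<longrightarrow> inj_on (\<lambda>f. f t) F)"

definition cross_once :: "(real \<Rightarrow> real) set \<Rightarrow> bool" where
  "cross_once F \<longleftrightarrow> (\<forall>f\<in>F. \<forall>g\<in>F. f \<noteq> g \<longrightarrow> (\<exists>t. crossing_at f g t) \<and>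
     (\<forall>t t'. crossing_at f g t \<longrightarrow> crossing_at f g t' \<longrightarrow> (\<exists>m::int. t' = t + of_int m * pi)))"

lemma netD:
  assumes "net k F"
  shows "f \<in> F \<Longrightarrow> curve C f" "mk_line t d \<in> kernel k \<longleftrightarrow> (\<exists>f\<in>F. f t = d)"
    "inj_on (\<lambda>w. ht w t) C \<Longrightarrow> f \<in> F \<Longrightarrow> g \<in> F \<Longrightarrow> f t = g t \<Longrightarrow> f = g"
  using assms by (auto simp: net_def inj_on_def)

lemma generic_ex: "\<exists>t. inj_on (\<lambda>w. ht w t) C"
proof -
  obtain e where "good 0 e" using good_ex by blast
  then show ?thesis using good_generic[of 0 e "e / 2"] by (auto simp: good_def)
qed

lemma kernel_generic_card:
  assumes "inj_on (\<lambda>w. ht w t) C"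
  shows "finite {d. mk_line t d \<in> kernel k}" "card {d. mk_line t d \<in> kernel k} = n - 2 * k"
proof -
  have eq: "{d. mk_line t d \<in> kernel k} = (\<lambda>j. lev C j t) ` {k + 1..n - k}"
    by (auto simp: mem_kernel)
  have "inj_on (\<lambda>j. lev C j t) {k + 1..n - k}"
  proof (rule inj_onI)
    fix i j assume ij: "i \<in> {k + 1..n - k}" "j \<in> {k + 1..n - k}" "lev C i t = lev C j t"
    have c: "card {w \<in> C. lev C i t \<le> ht w t} = i" if "i \<in> {k + 1..n - k}" for i
    proof (rule card_ge_lev_generic[OF fin_C _ _ assms])
      show "1 \<le> i" "i \<le> card C" using that card_C by auto
    qed
    show "i = j" using c[OF ij(1)] c[OF ij(2)] unfolding ij(3) by (rule trans[OF sym])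
  qed
  then show "card {d. mk_line t d \<in> kernel k} = n - 2 * k" unfolding eq by (simp add: card_image)
  show "finite {d. mk_line t d \<in> kernel k}" unfolding eq by simp
qed

text \<open>Evaluation at an angle without ties is a bijection onto the kernel lines of that angle,
  one for each level from \<open>k + 1\<close> to \<open>n - k\<close>.\<close>

lemma card_net:
  assumes F: "net k F"
  shows "finite F" "card F = n - 2 * k"
proof -
  obtain t where t: "inj_on (\<lambda>w. ht w t) C" using generic_ex by blast
  have "bij_betw (\<lambda>f. f t) F {d. mk_line t d \<in> kernel k}"
    using netD[OF F] t by (auto simp: bij_betw_def inj_on_def)
  then show "finite F" "card F = n - 2 * k"
    using kernel_generic_card[OF t] by (metis bij_betw_finite, metis bij_betw_same_card)
qed

lemma net_germs_ne:
  assumes F: "net k F" and fh: "f \<in> F" "h \<in> F" "f \<noteq> h" and g: "good t e"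
    and ge: "germ f t e p p'" "germ h t e q q'"
  shows "p \<noteq> q" "p' \<noteq> q'"
proof -
  have e: "0 < e" using g by (simp add: good_def)
  have "f (t - e / 2) \<noteq> h (t - e / 2)" "f (t + e / 2) \<noteq> h (t + e / 2)"
    using netD(3)[OF F good_generic[OF g, of "t - e / 2"] fh(1,2)]
      netD(3)[OF F good_generic[OF g, of "t + e / 2"] fh(1,2)] fh(3) e by auto
  then show "p \<noteq> q" "p' \<noteq> q'"
    using germD(5)[OF ge(1), of "t - e / 2"] germD(5)[OF ge(2), of "t - e / 2"]
      germD(6)[OF ge(1), of "t + e / 2"] germD(6)[OF ge(2), of "t + e / 2"] e by auto
qed

lemma net_meet:
  assumes F: "net k F" and fh: "f \<in> F" "h \<in> F" "f \<noteq> h" "f t = h t"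
  shows "crossing_at f h t \<noteq> contact_at f h t"
proof -
  obtain e where g: "good t e" using good_ex by blast
  obtain p p' where f: "germ f t e p p'" using germ_ex[OF g netD(1)[OF F fh(1)]] by blast
  obtain q q' where h: "germ h t e q q'" using germ_ex[OF g netD(1)[OF F fh(2)]] by blast
  note ne = net_germs_ne[OF F fh(1-3) g f h]
  show ?thesis using meet_germs[OF g f h fh(4) ne] ne by auto
qed

definition on_line :: "real \<Rightarrow> real \<Rightarrow> complex set" where
  "on_line t d = {w \<in> C. ht w t = d}"

text \<open>Meeting points are recorded by the vertices on the line, which makes crossings and
  contacts of different nets comparable as sets of edges.\<close>

definition meets :: "real \<Rightarrow> (real \<Rightarrow> real) set \<Rightarrow> complex set set" where
  "meets s F = {on_line t (f t) | f g t. f \<in> F \<and> g \<in> F \<and> f \<noteq> g \<and> meet s f g t}"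

text \<open>The complement of the short edges among all edges; these turn out to be the edges at
  which two curves of a net meet.\<close>

definition relevant :: "nat \<Rightarrow> complex set set" where
  "relevant k = {{p, q} | p q. p \<in> C \<and> q \<in> C \<and> p \<noteq> q \<and>
     k \<le> card {r \<in> C. ccw p q r} \<and> k \<le> card {r \<in> C. ccw q p r}}"

lemma on_line_pair: "p \<in> C \<Longrightarrow> q \<in> C \<Longrightarrow> p \<noteq> q \<Longrightarrow> ht p t = d \<Longrightarrow> ht q t = d \<Longrightarrow> on_line t d = {p, q}"
  unfolding on_line_def using two_at_tie[of p q _ t d] by blast

lemma on_line_shift:
  "on_line (t + of_int m * pi) (if even m then d else - d) = on_line t d"
  unfolding on_line_def ht_add_int_pi by auto

lemma relevant_iff:
  assumes pq: "p \<in> C" "q \<in> C" "p \<noteq> q" "ht p t = ht q t"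
  shows "{p, q} \<in> relevant k \<longleftrightarrow> k \<le> card {r \<in> C. ht p t < ht r t} \<and> k \<le> card {r \<in> C. ht r t < ht p t}"
proof -
  have sw: "ccw b a r \<longleftrightarrow> orient a b r < 0" for a b r
    by (simp add: ccw_iff orient_def algebra_simps)
  obtain \<kappa> where \<kappa>: "\<kappa> \<noteq> 0" "\<And>r. ht r t - ht p t = \<kappa> * orient p q r" using ht_diff_orient[OF pq(4,3)] by blast
  have "{p, q} \<in> relevant k \<longleftrightarrow> k \<le> card {r \<in> C. ccw p q r} \<and> k \<le> card {r \<in> C. ccw q p r}"
    using pq unfolding relevant_def by (auto simp: doubleton_eq_iff)
  also have "\<dots> \<longleftrightarrow> k \<le> card {r \<in> C. ht p t < ht r t} \<and> k \<le> card {r \<in> C. ht r t < ht p t}"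
  proof (cases "0 < \<kappa>")
    case True
    have "0 < \<kappa> * orient p q r \<longleftrightarrow> ccw p q r" "\<kappa> * orient p q r < 0 \<longleftrightarrow> ccw q p r" for r
      using True sw[of q p r] by (simp_all add: ccw_iff zero_less_mult_iff mult_less_0_iff)
    then have "ht p t < ht r t \<longleftrightarrow> ccw p q r" "ht r t < ht p t \<longleftrightarrow> ccw q p r" for r
      unfolding \<kappa>(2)[symmetric] by simp_all
    then show ?thesis by simp
  next
    case False
    then have "\<kappa> < 0" using \<kappa>(1) by simp
    then have "0 < \<kappa> * orient p q r \<longleftrightarrow> ccw q p r" "\<kappa> * orient p q r < 0 \<longleftrightarrow> ccw p q r" for r
      using sw[of q p r] by (simp_all add: ccw_iff zero_less_mult_iff mult_less_0_iff)
    then have "ht p t < ht r t \<longleftrightarrow> ccw q p r" "ht r t < ht p t \<longleftrightarrow> ccw p q r" for r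
      unfolding \<kappa>(2)[symmetric] by simp_all
    then show ?thesis by auto
  qed
  finally show ?thesis .
qed

text \<open>Shortly after \<open>t\<close>, the lines through \<open>p\<close> and through
  \<open>q\<close> still have the \<open>k\<close> vertices above and the \<open>k\<close> below, so
  both are in the kernel and lie on two different curves. Any curve through the tie follows
  \<open>p\<close> or \<open>q\<close> there and is one of these two.\<close>

lemma relevant_strands:
  assumes F: "net k F" and pq: "p \<in> C" "q \<in> C" "p \<noteq> q" "ht p t = ht q t"
    and rel: "{p, q} \<in> relevant k"
  shows "\<exists>f\<in>F. \<exists>h\<in>F. f \<noteq> h \<and> f t = ht p t \<and> h t = ht p t \<and> (\<forall>l\<in>F. l t = ht p t \<longrightarrow> l = f \<or> l = h)"
proof -
  obtain e where g: "good t e" using good_ex by blast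
  have e: "0 < e" using g by (simp add: good_def)
  define y where "y = t + e / 2"
  have y: "\<bar>y - t\<bar> < e" "t < y" "y < t + e" "y \<noteq> t" using e by (auto simp: y_def)
  have inj: "inj_on (\<lambda>w. ht w y) C" by (rule good_generic[OF g y(1,4)])
  have A: "k \<le> card {r \<in> C. ht p t < ht r t}" "k \<le> card {r \<in> C. ht r t < ht p t}"
    using relevant_iff[OF pq] rel by auto
  have n: "2 * k + 1 \<le> n"
  proof -
    have "{r \<in> C. ht p t < ht r t} \<inter> {r \<in> C. ht r t < ht p t} = {}" by auto
    then have "card ({r \<in> C. ht p t < ht r t} \<union> {r \<in> C. ht r t < ht p t}) = card {r \<in> C. ht p t < ht r t} + card {r \<in> C. ht r t < ht p t}"
      using fin_C by (intro card_Un_disjoint) auto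
    moreover have "insert p ({r \<in> C. ht p t < ht r t} \<union> {r \<in> C. ht r t < ht p t}) \<subseteq> C" using pq by auto
    then have "card (insert p ({r \<in> C. ht p t < ht r t} \<union> {r \<in> C. ht r t < ht p t})) \<le> n"
      using card_mono[OF fin_C] card_C by metis
    moreover have "card (insert p ({r \<in> C. ht p t < ht r t} \<union> {r \<in> C. ht r t < ht p t})) =
        card ({r \<in> C. ht p t < ht r t} \<union> {r \<in> C. ht r t < ht p t}) + 1" using fin_C by simp
    ultimately show ?thesis using A by linarith
  qed
  have ex: "\<exists>f\<in>F. f y = ht u y \<and> f t = ht p t" if u: "u \<in> C" "ht u t = ht p t" for u
  proof -
    have "{r \<in> C. ht p t < ht r t} \<subseteq> {w \<in> C. ht u y < ht w y}" "{r \<in> C. ht r t < ht p t} \<subseteq> {w \<in> C. ht w y < ht u y}"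
      using good_less[OF g y(1)] u by auto
    then have "insert u {r \<in> C. ht p t < ht r t} \<subseteq> {w \<in> C. ht u y \<le> ht w y}"
      "insert u {r \<in> C. ht r t < ht p t} \<subseteq> {w \<in> C. ht w y \<le> ht u y}" using u(1) by auto
    then have "card (insert u {r \<in> C. ht p t < ht r t}) \<le> card {w \<in> C. ht u y \<le> ht w y}"
      "card (insert u {r \<in> C. ht r t < ht p t}) \<le> card {w \<in> C. ht w y \<le> ht u y}"
      using fin_C by (auto intro!: card_mono)
    moreover have "card (insert u {r \<in> C. ht p t < ht r t}) = card {r \<in> C. ht p t < ht r t} + 1"
      "card (insert u {r \<in> C. ht r t < ht p t}) = card {r \<in> C. ht r t < ht p t} + 1"
      using fin_C u by auto
    ultimately have "mk_line y (ht u y) \<in> kernel k" using ht_mem_kernel[OF n u(1)] A by auto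
    then obtain f where f: "f \<in> F" "f y = ht u y" using netD(2)[OF F] by blast
    obtain a a' where ge: "germ f t e a a'" using germ_ex[OF g netD(1)[OF F f(1)]] by blast
    have "ht a' y = ht u y" using germD(6)[OF ge y(2,3)] f by simp
    then have "a' = u" using inj germD(2)[OF ge] u(1) by (auto simp: inj_on_def)
    then show ?thesis using f germD(4)[OF ge] u(2) by auto
  qed
  obtain f where f: "f \<in> F" "f y = ht p y" "f t = ht p t" using ex[OF pq(1)] by auto
  obtain h where h: "h \<in> F" "h y = ht q y" "h t = ht p t" using ex[OF pq(2)] pq by auto
  have "ht p y \<noteq> ht q y" using inj pq by (auto simp: inj_on_def)
  then have "f \<noteq> h" using f h by auto
  moreover have "l = f \<or> l = h" if l: "l \<in> F" "l t = ht p t" for l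
  proof -
    obtain a a' where ge: "germ l t e a a'" using germ_ex[OF g netD(1)[OF F l(1)]] by blast
    have "a' = p \<or> a' = q"
      by (rule two_at_tie[OF pq(1,2) germD(2)[OF ge] pq(3) refl pq(4)[symmetric]])
        (use germD(4)[OF ge] l(2) in simp)
    then have "l y = f y \<or> l y = h y" using germD(6)[OF ge y(2,3)] f h by auto
    then show ?thesis using netD(3)[OF F inj l(1)] f(1) h(1) by blast
  qed
  ultimately show ?thesis using f h by blast
qed

text \<open>Shortly after \<open>t\<close> the two curves follow different vertices. The kernel
  condition for the upper one gives \<open>k\<close> vertices strictly above, that for the lower one
  \<open>k\<close> strictly below; as no third vertex is on the line at \<open>t\<close>, these
  counts hold at \<open>t\<close>.\<close>

lemma net_meet_relevant:
  assumes F: "net k F" and fh: "f \<in> F" "h \<in> F" "f \<noteq> h" "f t = h t"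
  obtains p q where "p \<in> C" "q \<in> C" "p \<noteq> q" "ht p t = f t" "ht q t = f t" "{p, q} \<in> relevant k"
    "on_line t (f t) = {p, q}"
proof -
  obtain e where g: "good t e" using good_ex by blast
  have e: "0 < e" using g by (simp add: good_def)
  define y where "y = t + e / 2"
  have y: "\<bar>y - t\<bar> < e" "t < y" "y < t + e" "y \<noteq> t" using e by (auto simp: y_def)
  obtain p0 p where f: "germ f t e p0 p" using germ_ex[OF g netD(1)[OF F fh(1)]] by blast
  obtain q0 q where h: "germ h t e q0 q" using germ_ex[OF g netD(1)[OF F fh(2)]] by blast
  have ne: "p \<noteq> q" using net_germs_ne[OF F fh(1-3) g f h] by simp
  note C = germD(2)[OF f] germD(2)[OF h]
  have tie: "ht p t = f t" "ht q t = f t" using germD(4)[OF f] germD(4)[OF h] fh(4) by auto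
  have ker: "mk_line y (ht p y) \<in> kernel k" "mk_line y (ht q y) \<in> kernel k"
    using netD(2)[OF F] fh germD(6)[OF f y(2,3)] germD(6)[OF h y(2,3)] by metis+
  then have n: "2 * k + 1 \<le> n" by (auto simp: mem_kernel)
  have key: "k \<le> card {r \<in> C. f t < ht r t} \<and> k \<le> card {r \<in> C. ht r t < f t}"
    if "ht u y < ht w y" "u = p \<and> w = q \<or> u = q \<and> w = p" for u w
  proof -
    have u: "u \<in> C" "ht u t = f t" "mk_line y (ht u y) \<in> kernel k" "w \<in> C" "ht w t = f t" "mk_line y (ht w y) \<in> kernel k" "u \<noteq> w"
      using that C tie ker ne by auto
    have oth: "ht r t \<noteq> f t" if "r \<in> C" "r \<noteq> u" "r \<noteq> w" for r
      using no_triple_tie[of u w r t] u that by auto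
    have "{r \<in> C. ht w y \<le> ht r y} \<subseteq> insert w {r \<in> C. f t < ht r t}"
    proof
      fix r assume r: "r \<in> {r \<in> C. ht w y \<le> ht r y}"
      show "r \<in> insert w {r \<in> C. f t < ht r t}"
      proof (cases "r = w")
        case False
        moreover have "r \<noteq> u" using r that by auto
        ultimately have "ht r t \<noteq> f t" using oth r by auto
        moreover have "\<not> ht r t < ht w t" using good_less[OF g y(1), of r w] r u by auto
        ultimately show ?thesis using r u by auto
      qed simp
    qed
    then have "card {r \<in> C. ht w y \<le> ht r y} \<le> card (insert w {r \<in> C. f t < ht r t})"
      using fin_C by (intro card_mono) auto
    also have "\<dots> \<le> card {r \<in> C. f t < ht r t} + 1" using fin_C by (simp add: card_insert_if)
    finally have 1: "k \<le> card {r \<in> C. f t < ht r t}" using ht_mem_kernel[OF n u(4)] u(6) by auto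
    have "{r \<in> C. ht r y \<le> ht u y} \<subseteq> insert u {r \<in> C. ht r t < f t}"
    proof
      fix r assume r: "r \<in> {r \<in> C. ht r y \<le> ht u y}"
      show "r \<in> insert u {r \<in> C. ht r t < f t}"
      proof (cases "r = u")
        case False
        moreover have "r \<noteq> w" using r that by auto
        ultimately have "ht r t \<noteq> f t" using oth r by auto
        moreover have "\<not> ht u t < ht r t" using good_less[OF g y(1), of u r] r u by auto
        ultimately show ?thesis using r u by auto
      qed simp
    qed
    then have "card {r \<in> C. ht r y \<le> ht u y} \<le> card (insert u {r \<in> C. ht r t < f t})"
      using fin_C by (intro card_mono) auto
    also have "\<dots> \<le> card {r \<in> C. ht r t < f t} + 1" using fin_C by (simp add: card_insert_if)
    finally have 2: "k \<le> card {r \<in> C. ht r t < f t}" using ht_mem_kernel[OF n u(1)] u(3) by auto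
    show ?thesis using 1 2 by blast
  qed
  have "ht p y \<noteq> ht q y" using good_generic[OF g y(1,4)] C ne by (auto simp: inj_on_def)
  then have "ht p y < ht q y \<or> ht q y < ht p y" by linarith
  then have "k \<le> card {r \<in> C. f t < ht r t} \<and> k \<le> card {r \<in> C. ht r t < f t}" using key by blast
  then have "{p, q} \<in> relevant k" using relevant_iff[OF C ne, of t] tie by simp
  then show ?thesis using that[OF C ne tie] on_line_pair[OF C ne tie] by simp
qed

lemma relevant_eq_meets:
  assumes F: "net k F"
  shows "relevant k = meets (- 1) F \<union> meets 1 F"
proof
  show "meets (- 1) F \<union> meets 1 F \<subseteq> relevant k"
  proof
    fix x assume "x \<in> meets (- 1) F \<union> meets 1 F"
    then obtain s f g t where "x = on_line t (f t)" "f \<in> F" "g \<in> F" "f \<noteq> g" "meet s f g t"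
      unfolding meets_def by blast
    moreover from this have "f t = g t" by (simp add: meet_def)
    ultimately show "x \<in> relevant k" using net_meet_relevant[OF F, of f g t] by metis
  qed
  show "relevant k \<subseteq> meets (- 1) F \<union> meets 1 F"
  proof
    fix x assume x: "x \<in> relevant k"
    then obtain p q where pq: "x = {p, q}" "p \<in> C" "q \<in> C" "p \<noteq> q" by (auto simp: relevant_def)
    obtain t where t: "ht p t = ht q t" using ht_tie_ex by blast
    obtain f h where fh: "f \<in> F" "h \<in> F" "f \<noteq> h" "f t = ht p t" "h t = ht p t"
      using relevant_strands[OF F pq(2-4) t] x pq(1) by metis
    then have "crossing_at f h t \<or> contact_at f h t" using net_meet[OF F fh(1-3)] by auto
    moreover have "x = on_line t (f t)"
      unfolding pq(1) by (rule on_line_pair[OF pq(2-4), symmetric]) (use t fh in simp_all)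
    ultimately show "x \<in> meets (- 1) F \<union> meets 1 F" using fh unfolding meets_def by blast
  qed
qed

text \<open>An edge determines the angle of its line modulo \<open>pi\<close>, and by
  \<open>relevant_strands\<close> the two curves through it. This injectivity underlies the
  counting.\<close>

lemma strands_unique:
  assumes F: "net k F" and 1: "f \<in> F" "g \<in> F" "f \<noteq> g" "f t = g t"
    and 2: "f' \<in> F" "g' \<in> F" "f' \<noteq> g'" "f' t' = g' t'"
    and eq: "on_line t (f t) = on_line t' (f' t')"
  shows "{f, g} = {f', g'} \<and> (\<exists>m::int. t' = t + of_int m * pi)"
proof -
  obtain p q where pq: "p \<in> C" "q \<in> C" "p \<noteq> q" "ht p t = f t" "ht q t = f t" "{p, q} \<in> relevant k"
    "on_line t (f t) = {p, q}" using net_meet_relevant[OF F 1] by blast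
  have "p \<in> on_line t' (f' t')" "q \<in> on_line t' (f' t')" using pq(7) eq by auto
  then have pq': "ht p t' = f' t'" "ht q t' = f' t'" by (auto simp: on_line_def)
  then obtain m :: int where m: "t' = t + of_int m * pi" using ht_tie_unique[of p t q t'] pq by auto
  have anti: "l t' = (if even m then l t else - l t)" if "l \<in> F" for l
    unfolding m by (rule antiperiodic_int) (rule curve_antiper[OF netD(1)[OF F that]])
  have "ht p t' = (if even m then ht p t else - ht p t)" unfolding m by (rule ht_add_int_pi)
  then have at: "f' t = ht p t" "g' t = ht p t"
    using anti[OF 2(1)] anti[OF 2(2)] 2(4) pq'(1) by (auto split: if_splits)
  obtain a b where ab: "\<forall>l\<in>F. l t = ht p t \<longrightarrow> l = a \<or> l = b"
    using relevant_strands[OF F pq(1-3) _ pq(6), of t] pq(4,5) by auto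
  have "f t = ht p t" "g t = ht p t" using pq 1 by auto
  then have "f \<in> {a, b}" "g \<in> {a, b}" "f' \<in> {a, b}" "g' \<in> {a, b}" using ab 1 2 at by auto
  then have "{f, g} = {f', g'}" using 1(3) 2(3) by auto
  then show ?thesis using m by blast
qed

lemma meets_disjoint:
  assumes F: "net k F"
  shows "meets (- 1) F \<inter> meets 1 F = {}"
proof (rule ccontr)
  assume "meets (- 1) F \<inter> meets 1 F \<noteq> {}"
  then obtain x where x: "x \<in> meets (- 1) F" "x \<in> meets 1 F" by blast
  obtain f g t where 1: "x = on_line t (f t)" "f \<in> F" "g \<in> F" "f \<noteq> g" "meet (- 1) f g t"
    using x(1) unfolding meets_def by blast
  obtain f' g' t' where 2: "x = on_line t' (f' t')" "f' \<in> F" "g' \<in> F" "f' \<noteq> g'" "meet 1 f' g' t'"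
    using x(2) unfolding meets_def by blast
  have e: "f t = g t" "f' t' = g' t'" using 1 2 by (auto simp: meet_def)
  have "{f, g} = {f', g'} \<and> (\<exists>m::int. t' = t + of_int m * pi)"
    by (rule strands_unique[OF F 1(2-4) e(1) 2(2-4) e(2)]) (use 1 2 in simp)
  then obtain m :: int where m: "{f, g} = {f', g'}" "t' = t + of_int m * pi" by blast
  have "meet 1 f' g' t"
    using 2(5) unfolding m(2) meet_int[where f = f' and g = g', OF curve_antiper[OF netD(1)[OF F 2(2)]] curve_antiper[OF netD(1)[OF F 2(3)]]] .
  then have "meet 1 f g t" using m(1) meet_sym by (auto simp: doubleton_eq_iff)
  then show False using net_meet[OF F 1(2-4) e(1)] 1(5) by blast
qed

text \<open>Pairs of curves correspond one-to-one to crossing edges: a pair has a single crossing by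
  \<open>cross_once\<close>, and an edge determines its pair by
  \<open>strands_unique\<close>.\<close>

lemma card_crossings:
  assumes F: "net k F" and once: "cross_once F"
  shows "finite (meets (- 1) F)" "card (meets (- 1) F) = (n - 2 * k) choose 2"
proof -
  define P where "P = {X. X \<subseteq> F \<and> card X = 2}"
  have finF: "finite F" "card F = n - 2 * k" using card_net[OF F] by auto
  have cP: "card P = (n - 2 * k) choose 2" unfolding P_def using n_subsets[OF finF(1), of 2] finF by simp
  have finP: "finite P" unfolding P_def using finF by simp
  have "\<exists>x f g t. X = {f, g} \<and> x = on_line t (f t) \<and> f \<in> F \<and> g \<in> F \<and> f \<noteq> g \<and> meet (- 1) f g t" if X: "X \<in> P" for X
  proof -
    obtain f g where fg: "X = {f, g}" "f \<noteq> g" using X unfolding P_def by (auto simp: card_2_iff)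
    then have "f \<in> F" "g \<in> F" using X by (auto simp: P_def)
    moreover then obtain t where "meet (- 1) f g t" using once fg(2) unfolding cross_once_def by blast
    ultimately show ?thesis using fg by blast
  qed
  then obtain \<phi> where \<phi>: "\<And>X. X \<in> P \<Longrightarrow> \<exists>f g t. X = {f, g} \<and> \<phi> X = on_line t (f t) \<and> f \<in> F \<and> g \<in> F \<and> f \<noteq> g \<and> meet (- 1) f g t"
    by metis
  have inj: "inj_on \<phi> P"
  proof (rule inj_onI)
    fix X Y assume XY: "X \<in> P" "Y \<in> P" "\<phi> X = \<phi> Y"
    obtain f g t where 1: "X = {f, g}" "\<phi> X = on_line t (f t)" "f \<in> F" "g \<in> F" "f \<noteq> g" "meet (- 1) f g t"
      using \<phi>[OF XY(1)] by blast
    obtain f' g' t' where 2: "Y = {f', g'}" "\<phi> Y = on_line t' (f' t')" "f' \<in> F" "g' \<in> F" "f' \<noteq> g'" "meet (- 1) f' g' t'"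
      using \<phi>[OF XY(2)] by blast
    have e: "f t = g t" "f' t' = g' t'" using 1 2 by (auto simp: meet_def)
    show "X = Y" using strands_unique[OF F 1(3-5) e(1) 2(3-5) e(2)] 1 2 XY(3) by simp
  qed
  have "\<phi> ` P = meets (- 1) F"
  proof
    show "\<phi> ` P \<subseteq> meets (- 1) F"
    proof
      fix x assume "x \<in> \<phi> ` P"
      then obtain X where "X \<in> P" "x = \<phi> X" by blast
      then show "x \<in> meets (- 1) F" using \<phi>[of X] unfolding meets_def by blast
    qed
    show "meets (- 1) F \<subseteq> \<phi> ` P"
    proof
      fix x assume "x \<in> meets (- 1) F"
      then obtain f g t where 1: "x = on_line t (f t)" "f \<in> F" "g \<in> F" "f \<noteq> g" "meet (- 1) f g t"
        unfolding meets_def by blast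
      then have XP: "{f, g} \<in> P" by (simp add: P_def)
      obtain f' g' t' where 2: "{f, g} = {f', g'}" "\<phi> {f, g} = on_line t' (f' t')" "f' \<in> F" "g' \<in> F" "f' \<noteq> g'" "meet (- 1) f' g' t'"
        using \<phi>[OF XP] by blast
      have "meet (- 1) f g t'" using 2 meet_sym by (auto simp: doubleton_eq_iff)
      then obtain m :: int where m: "t' = t + of_int m * pi" using once 1 unfolding cross_once_def by blast
      have "f' t' = f t'" using 2 by (auto simp: doubleton_eq_iff meet_def)
      also have "f t' = (if even m then f t else - f t)"
        unfolding m by (rule antiperiodic_int) (rule curve_antiper[OF netD(1)[OF F 1(2)]])
      finally have "\<phi> {f, g} = x" unfolding 2(2) 1(1) m using on_line_shift[of t m "f t"] by simp
      then show "x \<in> \<phi> ` P" using XP by blast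
    qed
  qed
  then show "finite (meets (- 1) F)" "card (meets (- 1) F) = (n - 2 * k) choose 2"
    using finite_imageI[OF finP, of \<phi>] cP card_image[OF inj] by simp_all
qed

lemma finite_relevant: "finite (relevant k)"
proof (rule finite_subset)
  show "relevant k \<subseteq> Pow C" by (auto simp: relevant_def)
qed (simp add: fin_C)

text \<open>The contacts are what the \<open>(n - 2 * k) choose 2\<close> crossings leave of the
  relevant edges, and both numbers depend only on \<open>C\<close> and \<open>k\<close>.\<close>

lemma card_contacts_eq:
  assumes "net k F" "cross_once F" "net k G" "cross_once G"
  shows "card (meets 1 F) = card (meets 1 G)"
proof -
  have "card (meets 1 F) = card (relevant k) - ((n - 2 * k) choose 2)" if F: "net k F" "cross_once F" for F
  proof -
    have "meets 1 F \<subseteq> relevant k" using relevant_eq_meets[OF F(1)] by blast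
    then have "finite (meets 1 F)" using finite_relevant finite_subset by blast
    then have "card (relevant k) = card (meets (- 1) F) + card (meets 1 F)"
      unfolding relevant_eq_meets[OF F(1)]
      using card_crossings[OF F] meets_disjoint[OF F(1)] by (intro card_Un_disjoint) auto
    then show ?thesis using card_crossings[OF F] by simp
  qed
  then show ?thesis using assms by metis
qed

lemma meet_cont_sign:
  assumes f: "curve V f" and g: "curve V g" and nz: "f t \<noteq> g t"
  shows "\<forall>\<^sub>F s in at t. sgn (f s - g s) = sgn (f t - g t)"
proof -
  have c: "continuous_on UNIV (\<lambda>s. f s - g s)" using f g by (auto simp: curve_def intro: continuous_intros)
  have "\<forall>\<^sub>F s in nhds t. sgn (f s - g s) = sgn (f t - g t)"
  proof (cases "0 < f t - g t")
    case True
    have "open {s. 0 < f s - g s}" by (intro open_Collect_less c continuous_intros)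
    then have "\<forall>\<^sub>F s in nhds t. 0 < f s - g s" using True unfolding eventually_nhds by blast
    then show ?thesis using True by (auto elim: eventually_mono)
  next
    case False
    then have neg: "f t - g t < 0" using nz by simp
    have "open {s. f s - g s < 0}" by (intro open_Collect_less c continuous_intros)
    then have "\<forall>\<^sub>F s in nhds t. f s - g s < 0" using neg unfolding eventually_nhds by blast
    then show ?thesis using neg by (auto elim: eventually_mono)
  qed
  then show ?thesis by (simp add: eventually_at_filter eventually_mono)
qed

lemma contact_sign:
  assumes "contact_at f g t"
  shows "\<exists>c. c \<noteq> 0 \<and> (\<forall>\<^sub>F s in at t. sgn (f s - g s) = c)"
proof -
  obtain \<epsilon> where e: "0 < \<epsilon>" "\<forall>y\<in>{t - \<epsilon><..<t}. \<forall>z\<in>{t<..<t + \<epsilon>}. 0 < 1 * ((f y - g y) * (f z - g z))"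
    using assms unfolding meet_def by blast
  have pos: "0 < (f y - g y) * (f z - g z)" if "t - \<epsilon> < y" "y < t" "t < z" "z < t + \<epsilon>" for y z
    using e(2) that by simp
  define u where "u = f (t + \<epsilon> / 2) - g (t + \<epsilon> / 2)"
  define w where "w = f (t - \<epsilon> / 2) - g (t - \<epsilon> / 2)"
  have wu: "0 < w * u" unfolding u_def w_def by (rule pos) (use e in auto)
  have "sgn (f s - g s) = sgn u" if "s \<noteq> t" "dist s t < \<epsilon>" for s
  proof (cases "s < t")
    case True
    then have "0 < (f s - g s) * u" unfolding u_def by (intro pos) (use that e in \<open>auto simp: dist_real_def\<close>)
    then show ?thesis by (auto simp: zero_less_mult_iff)
  next
    case False
    then have "0 < w * (f s - g s)" unfolding w_def by (intro pos) (use that e in \<open>auto simp: dist_real_def\<close>)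
    then show ?thesis using wu by (auto simp: zero_less_mult_iff)
  qed
  then have "\<forall>\<^sub>F s in at t. sgn (f s - g s) = sgn u" using e(1) unfolding eventually_at by blast
  moreover have "sgn u \<noteq> 0" using wu by (auto simp: sgn_zero_iff)
  ultimately show ?thesis by blast
qed

text \<open>If the curves only touched, the sign of their difference would be constant and nonzero
  on a punctured neighbourhood of every angle, against
  \<open>antiperiodic_sign_change\<close>.\<close>

lemma net_crossing_ex:
  assumes F: "net k F" and fg: "f \<in> F" "g \<in> F" "f \<noteq> g"
  shows "\<exists>t. crossing_at f g t"
proof (rule ccontr)
  assume no: "\<nexists>t. crossing_at f g t"
  note c = netD(1)[OF F fg(1)] netD(1)[OF F fg(2)]
  show False
  proof (rule antiperiodic_sign_change[of "\<lambda>s. sgn (f s - g s)"])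
    fix t
    have "f (t + pi) - g (t + pi) = - (f t - g t)" using curve_antiper[OF c(1)] curve_antiper[OF c(2)] by simp
    then show "sgn (f (t + pi) - g (t + pi)) = - sgn (f t - g t)" by (simp only: sgn_minus)
    show "\<exists>c. c \<noteq> 0 \<and> (\<forall>\<^sub>F s in at t. sgn (f s - g s) = c)"
    proof (cases "f t = g t")
      case True
      then have "contact_at f g t" using net_meet[OF F fg] no by blast
      then show ?thesis by (rule contact_sign)
    next
      case False
      then show ?thesis using meet_cont_sign[OF c] by (intro exI[of _ "sgn (f t - g t)"]) (auto simp: sgn_zero_iff)
    qed
  qed
qed

definition graph_line :: "(real \<Rightarrow> real) \<Rightarrow> line set" where
  "graph_line f = range (\<lambda>x. mk_line x (f x))"

lemma represents_graph_line: "curve V f \<Longrightarrow> represents f (graph_line f)"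
  unfolding graph_line_def by (rule represents_curve)

lemma arrangement_of_net:
  assumes F: "net k F" and once: "cross_once F"
  shows "pseudoline_arrangement (graph_line ` F)" "support (graph_line ` F) = kernel k"
proof -
  have rep: "represents f (graph_line f)" if "f \<in> F" for f
    using represents_graph_line[OF netD(1)[OF F that]] .
  show "pseudoline_arrangement (graph_line ` F)"
    unfolding pseudoline_arrangement_def
  proof (intro conjI ballI impI)
    show "finite (graph_line ` F)" using card_net[OF F] by simp
    show "pseudoline L" if "L \<in> graph_line ` F" for L using that rep by (auto simp: pseudoline_def)
    fix L M assume LM: "L \<in> graph_line ` F" "M \<in> graph_line ` F" "L \<noteq> M"
    obtain f where f: "f \<in> F" "L = graph_line f" using LM(1) by blast
    obtain g where g: "g \<in> F" "M = graph_line g" using LM(2) by blast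
    have ne: "f \<noteq> g" using f g LM by auto
    note r = rep[OF f(1)] rep[OF g(1)]
    show "\<exists>!P. crossing_point L M P"
      unfolding f(2) g(2) ex1_crossing_point_iff[OF r] using once f g ne unfolding cross_once_def by blast
    fix P assume P: "P \<in> L \<inter> M"
    obtain t d where td: "P = mk_line t d" by (rule line_exhaust)
    have "d = f t" "d = g t" using P mem_represented[OF r(1)] mem_represented[OF r(2)] unfolding td f(2) g(2) by auto
    then have "crossing_at f g t \<or> contact_at f g t" using net_meet[OF F f(1) g(1) ne] by auto
    then show "crossing_point L M P \<or> contact_point L M P"
      unfolding td f(2) g(2) \<open>d = f t\<close> using crossing_point_mk_line[OF r] contact_point_mk_line[OF r] by blast
  qed
  have "mk_line t d \<in> support (graph_line ` F) \<longleftrightarrow> mk_line t d \<in> kernel k" for t d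
    unfolding netD(2)[OF F] support_def using mem_represented[OF rep] by auto
  then show "support (graph_line ` F) = kernel k" by (metis line_exhaust subsetI subset_antisym)
qed

text \<open>Injectivity rests on the isolation of common points in an arrangement: two curves equal
  at \<open>t\<close> cross or touch there, so they follow different vertices just before
  \<open>t\<close>, and these are tied at \<open>t\<close>.\<close>

lemma net_of_arrangement:
  assumes arr: "pseudoline_arrangement \<Lambda>" and supp: "support \<Lambda> = kernel k"
  defines "F \<equiv> {f. \<exists>L\<in>\<Lambda>. represents f L}"
  shows "net k F" "cross_once F"
proof -
  have on: "mk_line t (f t) \<in> L" if "represents f L" for f L t using mem_represented[OF that] by simp
  have cur: "curve C f" if f: "f \<in> F" for f
  proof -
    obtain L where L: "L \<in> \<Lambda>" "represents f L" using f by (auto simp: F_def)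
    have "\<exists>v\<in>C. f t = ht v t" for t
    proof -
      have "mk_line t (f t) \<in> kernel k" using on[OF L(2)] L(1) supp by (auto simp: support_def)
      then obtain j where "k + 1 \<le> j" "j \<le> n - k" "f t = lev C j t" by (auto simp: mem_kernel)
      then show ?thesis using lev_props(1)[OF fin_C, of j t] card_C by auto
    qed
    then show ?thesis using L(2) by (auto simp: curve_def represents_def)
  qed
  have ne: "L \<noteq> M" if "represents f L" "represents g M" "f \<noteq> g" for f g L M
    using that represents_unique by blast
  show "net k F"
    unfolding net_def
  proof (intro conjI ballI allI impI cur)
    fix t d
    show "mk_line t d \<in> kernel k \<longleftrightarrow> (\<exists>f\<in>F. f t = d)"
    proof
      assume "mk_line t d \<in> kernel k"
      then obtain L where L: "L \<in> \<Lambda>" "mk_line t d \<in> L" using supp by (auto simp: support_def)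
      then obtain f where f: "represents f L" using arr by (auto simp: pseudoline_arrangement_def pseudoline_def)
      then have "f t = d" using mem_represented[OF f] L by auto
      then show "\<exists>f\<in>F. f t = d" using f L by (auto simp: F_def)
    next
      assume "\<exists>f\<in>F. f t = d"
      then obtain f L where "L \<in> \<Lambda>" "represents f L" "f t = d" by (auto simp: F_def)
      then show "mk_line t d \<in> kernel k" using on[of f L t] unfolding supp[symmetric] support_def by blast
    qed
  next
    fix t assume inj: "inj_on (\<lambda>w. ht w t) C"
    show "inj_on (\<lambda>f. f t) F"
    proof (rule inj_onI, rule ccontr)
      fix f g assume fg: "f \<in> F" "g \<in> F" "f t = g t" "f \<noteq> g"
      obtain L where L: "L \<in> \<Lambda>" "represents f L" using fg by (auto simp: F_def)
      obtain M where M: "M \<in> \<Lambda>" "represents g M" using fg by (auto simp: F_def)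
      have "mk_line t (f t) \<in> L \<inter> M" using on[OF L(2), of t] on[OF M(2), of t] fg(3) by simp
      then have "crossing_point L M (mk_line t (f t)) \<or> contact_point L M (mk_line t (f t))"
        using arr L(1) M(1) ne[OF L(2) M(2) fg(4)] unfolding pseudoline_arrangement_def by blast
      then obtain s where s: "meet s f g t"
        using crossing_point_mk_line[OF L(2) M(2)] contact_point_mk_line[OF L(2) M(2)] by blast
      obtain e where g: "good t e" using good_ex by blast
      obtain p p' where 1: "germ f t e p p'" using germ_ex[OF g cur[OF fg(1)]] by blast
      obtain q q' where 2: "germ g t e q q'" using germ_ex[OF g cur[OF fg(2)]] by blast
      have "p \<noteq> q" using meet_germs_ne[OF g 1 2 s] by simp
      moreover have "ht p t = ht q t" using germD(3)[OF 1] germD(3)[OF 2] fg(3) by simp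
      ultimately show False using inj germD(1)[OF 1] germD(1)[OF 2] by (auto simp: inj_on_def)
    qed
  qed
  show "cross_once F"
    unfolding cross_once_def
  proof (intro ballI impI)
    fix f g assume fg: "f \<in> F" "g \<in> F" "f \<noteq> g"
    obtain L where L: "L \<in> \<Lambda>" "represents f L" using fg by (auto simp: F_def)
    obtain M where M: "M \<in> \<Lambda>" "represents g M" using fg by (auto simp: F_def)
    have "\<exists>!P. crossing_point L M P"
      using arr L(1) M(1) ne[OF L(2) M(2) fg(3)] unfolding pseudoline_arrangement_def by blast
    then show "(\<exists>t. crossing_at f g t) \<and>
        (\<forall>t t'. crossing_at f g t \<longrightarrow> crossing_at f g t' \<longrightarrow> (\<exists>m::int. t' = t + of_int m * pi))"
      unfolding ex1_crossing_point_iff[OF L(2) M(2)] .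
  qed
qed

section \<open>The net of a triangulation\<close>

definition stars :: "nat \<Rightarrow> complex set set \<Rightarrow> complex set set set" where
  "stars k T = {S. k_star k C S \<and> S \<subseteq> T}"

lemma finite_edges: "finite (edges C)"
proof (rule finite_subset)
  show "edges C \<subseteq> Pow C" by (auto simp: edges_def)
qed (simp add: fin_C)

lemma k_triangulation_edges: "k_triangulation k C T \<Longrightarrow> T \<subseteq> edges C"
  by (simp add: k_triangulation_def)

lemma finite_stars:
  assumes "k_triangulation k C T" shows "finite (stars k T)"
proof (rule finite_subset)
  show "stars k T \<subseteq> Pow T" by (auto simp: stars_def)
  show "finite (Pow T)" using finite_edges k_triangulation_edges[OF assms] finite_subset by auto
qed

text \<open>At angles without ties this is existence and uniqueness of the star through a line.
  Other angles are reached by a limit: just after the angle each point of a level lies on one of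
  finitely many star curves, and the sets of agreement are closed.\<close>

lemma net_stars:
  assumes T: "k_triangulation k C T" and k: "1 \<le> k"
  shows "net k (med k ` stars k T)"
  unfolding net_def
proof (intro conjI ballI allI impI)
  show "curve C f" if "f \<in> med k ` stars k T" for f
    using that curve_med(2)[OF _ k] by (auto simp: stars_def)
  show "inj_on (\<lambda>f. f t) (med k ` stars k T)" if "inj_on (\<lambda>w. ht w t) C" for t
    using star_through_unique[OF T k _ _ _ _ that] by (auto simp: inj_on_def stars_def)
  fix t d
  show "mk_line t d \<in> kernel k \<longleftrightarrow> (\<exists>f\<in>med k ` stars k T. f t = d)"
  proof
    assume "\<exists>f\<in>med k ` stars k T. f t = d"
    then show "mk_line t d \<in> kernel k" using med_in_kernel[OF _ k] by (auto simp: stars_def)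
  next
    assume "mk_line t d \<in> kernel k"
    then obtain j where j: "k + 1 \<le> j" "j \<le> n - k" "d = lev C j t" by (auto simp: mem_kernel)
    obtain e where g: "good t e" using good_ex by blast
    then have e: "0 < e" by (simp add: good_def)
    define A where "A S = {s. lev C j s = med k S s}" for S
    have "closed (\<Union>S\<in>stars k T. A S)"
    proof (intro closed_UN ballI finite_stars[OF T])
      fix S assume "S \<in> stars k T"
      then have "continuous_on UNIV (med k S)" using curve_med(2)[OF _ k, of S] by (auto simp: stars_def curve_def)
      moreover have "continuous_on UNIV (lev C j)" using j card_C by (intro continuous_on_lev fin_C) auto
      ultimately show "closed (A S)" unfolding A_def by (intro closed_Collect_eq)
    qed
    moreover have "{t<..<t + e} \<subseteq> (\<Union>S\<in>stars k T. A S)"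
    proof
      fix s assume s: "s \<in> {t<..<t + e}"
      have "mk_line s (lev C j s) \<in> kernel k" using j unfolding mem_kernel by blast
      then obtain S where "k_star k C S" "S \<subseteq> T" "med k S s = lev C j s"
        using star_through_exists[OF T k good_generic[OF g, of s]] s by auto
      then show "s \<in> (\<Union>S\<in>stars k T. A S)" by (auto simp: stars_def A_def)
    qed
    ultimately have "closure {t<..<t + e} \<subseteq> (\<Union>S\<in>stars k T. A S)" by (rule closure_minimal[rotated])
    moreover have "t \<in> closure {t<..<t + e}" using e by simp
    ultimately have "t \<in> (\<Union>S\<in>stars k T. A S)" by blast
    then show "\<exists>f\<in>med k ` stars k T. f t = d" using j by (auto simp: A_def)
  qed
qed

lemma graph_line_stars:
  assumes "1 \<le> k"
  shows "graph_line ` med k ` stars k T = dual_arrangement k C T"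
proof -
  have "graph_line (med k S) = dual_star k C S" if "S \<in> stars k T" for S
    using that dual_star_eq[OF _ assms, of S] by (simp add: graph_line_def stars_def)
  then have "graph_line ` med k ` stars k T = dual_star k C ` stars k T"
    unfolding image_image by (rule image_cong[OF refl])
  then show ?thesis by (auto simp: dual_arrangement_def stars_def)
qed

text \<open>Keeps \<open>\<Union>S\<close>, the vertex set of a star, from being unfolded into a
  bounded existential.\<close>

declare Union_iff [simp del]

lemma card_above_med:
  assumes S: "k_star k C S" and k: "1 \<le> k"
  shows "card {w \<in> \<Union>S. med k S t < ht w t} \<le> k" "card {w \<in> \<Union>S. ht w t < med k S t} \<le> k"
proof -
  note c = card_Union_star[OF S k]
  have fS: "finite (\<Union>S)" using c fin_C finite_subset by blast
  have p: "card {u \<in> \<Union>S. med k S t < ht u t} < k + 1" "k + 1 \<le> card {u \<in> \<Union>S. med k S t \<le> ht u t}"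
    unfolding med_def using lev_props(2,3)[OF fS, of "k + 1" t] c by auto
  then show "card {w \<in> \<Union>S. med k S t < ht w t} \<le> k" "card {w \<in> \<Union>S. ht w t < med k S t} \<le> k"
    using card_compl_ht(1)[OF fS, of t "med k S t"] c by auto
qed

lemma orient_sides_le:
  assumes S: "k_star k C S" and k: "1 \<le> k" and pq: "p \<noteq> q" "ht p t = med k S t" "ht q t = med k S t"
  shows "card {w \<in> \<Union>S. ccw p q w} \<le> k" "card {w \<in> \<Union>S. ccw q p w} \<le> k"
proof -
  have sw: "ccw b a r \<longleftrightarrow> orient a b r < 0" for a b r
    by (simp add: ccw_iff orient_def algebra_simps)
  obtain \<kappa> where \<kappa>: "\<kappa> \<noteq> 0" "\<And>r. ht r t - ht p t = \<kappa> * orient p q r"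
    using ht_diff_orient[of p t q] pq by auto
  have c: "card {w \<in> \<Union>S. 0 < \<kappa> * orient p q w} \<le> k" "card {w \<in> \<Union>S. \<kappa> * orient p q w < 0} \<le> k"
    using card_above_med[OF S k, of t] unfolding \<kappa>(2)[symmetric] pq(2) by simp_all
  show "card {w \<in> \<Union>S. ccw p q w} \<le> k" "card {w \<in> \<Union>S. ccw q p w} \<le> k"
  proof -
    consider "0 < \<kappa>" | "\<kappa> < 0" using \<kappa>(1) by linarith
    then have "card {w \<in> \<Union>S. ccw p q w} \<le> k \<and> card {w \<in> \<Union>S. ccw q p w} \<le> k"
    proof cases
      case 1 then show ?thesis using c unfolding ccw_iff[of p q] sw[of q p] by (simp add: zero_less_mult_iff mult_less_0_iff)
    next
      case 2 then show ?thesis using c unfolding ccw_iff[of p q] sw[of q p] by (simp add: zero_less_mult_iff mult_less_0_iff)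
    qed
    then show "card {w \<in> \<Union>S. ccw p q w} \<le> k" "card {w \<in> \<Union>S. ccw q p w} \<le> k" by auto
  qed
qed

lemma star_pos_mono_le: "star_pos k v a b \<Longrightarrow> i \<le> j \<Longrightarrow> j < k \<Longrightarrow> a i \<le> a j \<and> b i \<le> b j"
  using star_pos_mono[of k v a b i j] by (cases "i = j") auto

text \<open>If the second vertex on the line lay outside the angle at \<open>v\<close>, one side of
  the line would strictly contain all \<open>a\<close> and \<open>b 0\<close>, or all
  \<open>b\<close> and \<open>a (k - 1)\<close>.\<close>

lemma tie_in_angle:
  assumes st: "star_pos k v a b" and k: "1 \<le> k" and x: "v < x" "x < v + int n"
    and eq: "ht (vtx v) t = med k (star_set k v a b) t" "ht (vtx x) t = med k (star_set k v a b) t"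
  shows "a (k - 1) \<le> x" "x \<le> b 0"
proof -
  let ?S = "star_set k v a b"
  have U: "\<Union>?S = star_vs k v a b" by (rule Union_star_set[OF k])
  have fU: "finite (\<Union>?S)" unfolding U by simp
  have k1: "k - 1 < k" "0 < k" using k by auto
  have ne: "vtx v \<noteq> vtx x" using vtx_inj[of v x v] x by auto
  have le: "card {w \<in> \<Union>?S. ccw (vtx v) (vtx x) w} \<le> k" "card {w \<in> \<Union>?S. ccw (vtx x) (vtx v) w} \<le> k"
    using orient_sides_le[OF k_star_star_set[OF st k] k ne eq] by auto
  have right: "ccw (vtx v) (vtx x) (vtx i)" if "x < i" "i < v + int n" for i
    using ccw_vtx[of v x i] that x by auto
  have left: "ccw (vtx x) (vtx v) (vtx i)" if "v < i" "i < x" for i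
    using ccw_vtx[of v i x] that x ccw_rot by metis
  show "a (k - 1) \<le> x"
  proof (rule ccontr)
    assume "\<not> a (k - 1) \<le> x"
    then have gt: "x < a (k - 1)" by simp
    have "insert (vtx (a (k - 1))) ((vtx \<circ> b) ` {..<k}) \<subseteq> {w \<in> \<Union>?S. ccw (vtx v) (vtx x) w}"
    proof
      fix w assume "w \<in> insert (vtx (a (k - 1))) ((vtx \<circ> b) ` {..<k})"
      then obtain i where i: "w = vtx i" "i = a (k - 1) \<or> (\<exists>j<k. i = b j)" by auto
      have "x < i \<and> i < v + int n"
        using i(2)
      proof
        assume "i = a (k - 1)"
        then show ?thesis using gt star_pos_range(2)[OF st k1(1)] by simp
      next
        assume "\<exists>j<k. i = b j"
        then obtain j where "j < k" "i = b j" by blast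
        then show ?thesis using gt star_pos_sep[OF st k1(1), of j] star_pos_range(4)[OF st, of j] by simp
      qed
      moreover have "w \<in> \<Union>?S" unfolding U using i k1 by blast
      ultimately show "w \<in> {w \<in> \<Union>?S. ccw (vtx v) (vtx x) w}" using right i(1) by blast
    qed
    then have "card (insert (vtx (a (k - 1))) ((vtx \<circ> b) ` {..<k})) \<le> card {w \<in> \<Union>?S. ccw (vtx v) (vtx x) w}"
      by (rule card_mono[rotated]) (use fU in simp)
    then have "card (insert (vtx (a (k - 1))) ((vtx \<circ> b) ` {..<k})) \<le> k" using le(1) by linarith
    moreover have "vtx (a (k - 1)) \<notin> (vtx \<circ> b) ` {..<k}"
    proof -
      have "vtx (a (k - 1)) \<in> (vtx \<circ> a) ` {..<k}" using k1 by simp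
      then show ?thesis using card_star_sides(5)[OF st] by (simp only: disjoint_iff) blast
    qed
    ultimately show False using card_star_sides(2)[OF st] by (simp add: card_insert_disjoint)
  qed
  show "x \<le> b 0"
  proof (rule ccontr)
    assume "\<not> x \<le> b 0"
    then have gt: "b 0 < x" by simp
    have "insert (vtx (b 0)) ((vtx \<circ> a) ` {..<k}) \<subseteq> {w \<in> \<Union>?S. ccw (vtx x) (vtx v) w}"
    proof
      fix w assume "w \<in> insert (vtx (b 0)) ((vtx \<circ> a) ` {..<k})"
      then obtain i where i: "w = vtx i" "i = b 0 \<or> (\<exists>j<k. i = a j)" by auto
      have "v < i \<and> i < x"
        using i(2)
      proof
        assume "i = b 0"
        then show ?thesis using gt star_pos_range(3)[OF st k1(2)] by simp
      next
        assume "\<exists>j<k. i = a j"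
        then obtain j where "j < k" "i = a j" by blast
        then show ?thesis using gt star_pos_sep[OF st _ k1(2), of j] star_pos_range(1)[OF st, of j] by simp
      qed
      moreover have "w \<in> \<Union>?S" unfolding U using i k1 by blast
      ultimately show "w \<in> {w \<in> \<Union>?S. ccw (vtx x) (vtx v) w}" using left i(1) by blast
    qed
    then have "card (insert (vtx (b 0)) ((vtx \<circ> a) ` {..<k})) \<le> card {w \<in> \<Union>?S. ccw (vtx x) (vtx v) w}"
      by (rule card_mono[rotated]) (use fU in simp)
    then have "card (insert (vtx (b 0)) ((vtx \<circ> a) ` {..<k})) \<le> k" using le(2) by linarith
    moreover have "vtx (b 0) \<notin> (vtx \<circ> a) ` {..<k}"
    proof -
      have "vtx (b 0) \<in> (vtx \<circ> b) ` {..<k}" using k1 by simp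
      then show ?thesis using card_star_sides(5)[OF st] by (simp only: disjoint_iff) blast
    qed
    ultimately show False using card_star_sides(1)[OF st] by (simp add: card_insert_disjoint)
  qed
qed

lemma star_position_of_tie:
  assumes S: "k_star k C S" and k: "1 \<le> k" and pq: "p \<in> \<Union>S" "q \<in> C" "p \<noteq> q"
    and t: "ht p t = med k S t" "ht q t = med k S t"
  obtains v a b x where "star_pos k v a b" "S = star_set k v a b" "p = vtx v" "q = vtx x"
    "v < x" "x < v + int n" "a (k - 1) \<le> x" "x \<le> b 0"
proof -
  have "p \<in> range vtx" using pq(1) card_Union_star(2)[OF S k] range_vtx by blast
  then obtain v where v: "p = vtx v" by blast
  obtain x where x: "v \<le> x" "x < v + int n" "vtx x = q" using vtx_surj[OF pq(2)] by blast
  have vx: "v < x" using x v pq(3) by (cases "v = x") auto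
  obtain a b where ab: "star_pos k v a b" "S = star_set k v a b" using k_star_rooted[OF S k, of v] pq(1) v by blast
  have "a (k - 1) \<le> x" "x \<le> b 0"
    using tie_in_angle[OF ab(1) k vx x(2), of t] t v x(3) ab(2) by auto
  then show ?thesis using that[OF ab v x(3)[symmetric] vx x(2)] by blast
qed

text \<open>Between \<open>a (k - 1)\<close> and \<open>b 0\<close> the star has no further
  vertices, so a second star vertex on a bisector is the end of a side of the angle.\<close>

lemma tie_edge:
  assumes S: "k_star k C S" and k: "1 \<le> k" and pq: "p \<in> \<Union>S" "q \<in> \<Union>S" "p \<noteq> q"
    and t: "ht p t = med k S t" "ht q t = med k S t"
  shows "{p, q} \<in> S"
proof -
  have "q \<in> C" using pq(2) card_Union_star(2)[OF S k] by blast
  then obtain v a b x where s: "star_pos k v a b" "S = star_set k v a b" "p = vtx v" "q = vtx x"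
    "v < x" "x < v + int n" "a (k - 1) \<le> x" "x \<le> b 0"
    using star_position_of_tie[OF S k pq(1) _ pq(3) t] by blast
  have k1: "k - 1 < k" "0 < k" using k by auto
  have "vtx x \<in> star_vs k v a b" using pq(2) s(4) unfolding s(2) Union_star_set[OF k] by simp
  then obtain i where i: "vtx x = vtx i" "i = v \<or> (\<exists>j<k. i = a j) \<or> (\<exists>j<k. i = b j)" by auto
  have ri: "v \<le> i \<and> i < v + int n" using i(2) star_pos_range[OF s(1)] n_ge_3 by fastforce
  have "x = i" by (rule vtx_inj[OF i(1), of v]) (use s ri in auto)
  have "x = a (k - 1) \<or> x = b 0"
  proof -
    consider j where "j < k" "x = a j" | j where "j < k" "x = b j" using i(2) \<open>x = i\<close> s(5) by auto
    then show ?thesis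
    proof cases
      case 1
      then show ?thesis using s(7) star_pos_mono_le[OF s(1), of j "k - 1"] k1 by simp
    next
      case 2
      then show ?thesis using s(8) star_pos_mono_le[OF s(1), of 0 j] k1 by simp
    qed
  qed
  then show ?thesis unfolding s(2,3,4) by (auto simp: star_set_def)
qed

text \<open>A vertex outside the star lies strictly inside the angle at \<open>p\<close>, where an
  edge of \<open>T\<close> from \<open>p\<close> would cross \<open>k\<close> edges of the
  star.\<close>

lemma tie_not_edge:
  assumes T: "k_triangulation k C T" and k: "1 \<le> k" and S: "k_star k C S" "S \<subseteq> T"
    and pq: "p \<in> \<Union>S" "q \<in> C - \<Union>S"
    and t: "ht p t = med k S t" "ht q t = med k S t"
  shows "{p, q} \<notin> T"
proof -
  have ne: "p \<noteq> q" "q \<in> C" using pq by auto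
  obtain v a b x where s: "star_pos k v a b" "S = star_set k v a b" "p = vtx v" "q = vtx x"
    "v < x" "x < v + int n" "a (k - 1) \<le> x" "x \<le> b 0"
    using star_position_of_tie[OF S(1) k pq(1) ne(2,1) t] by blast
  have k1: "k - 1 < k" "0 < k" using k by auto
  have out: "vtx x \<notin> star_vs k v a b" using pq(2) s(4) unfolding s(2) Union_star_set[OF k] by simp
  have "x \<noteq> a (k - 1)" "x \<noteq> b 0" using out k1 by blast+
  then have st: "a (k - 1) < x" "x < b 0" using s by auto
  have "a i < x \<and> x < b i" if "i < k" for i
  proof -
    have "i \<le> k - 1" using that by linarith
    then show ?thesis
      using st star_pos_mono_le[OF s(1), of i "k - 1"] star_pos_mono_le[OF s(1), of 0 i] that k1 by linarith
  qed
  then show ?thesis using star_angle_empty[OF T k s(1)] S(2) unfolding s(2-4) by blast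
qed

lemma card_above_generic:
  assumes S: "k_star k C S" and k: "1 \<le> k" and p: "p \<in> \<Union>S" "med k S t = ht p t"
    and inj: "inj_on (\<lambda>w. ht w t) C"
  shows "card {w \<in> \<Union>S. ht p t < ht w t} = k"
proof -
  note c = card_Union_star[OF S k]
  have fS: "finite (\<Union>S)" using c fin_C finite_subset by blast
  have inj': "inj_on (\<lambda>w. ht w t) (\<Union>S)" using inj c(2) inj_on_subset by blast
  have "card {w \<in> \<Union>S. ht p t \<le> ht w t} = k + 1"
    using card_ge_lev_generic[OF fS _ _ inj', of "k + 1"] c p(2) by (simp add: med_def)
  moreover have "{w \<in> \<Union>S. ht p t \<le> ht w t} = insert p {w \<in> \<Union>S. ht p t < ht w t}"
    using p(1) inj' by (force simp: inj_on_def order.order_iff_strict)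
  moreover have "card (insert p {w \<in> \<Union>S. ht p t < ht w t}) = Suc (card {w \<in> \<Union>S. ht p t < ht w t})"
    by (rule card_insert_disjoint) (use fS in simp_all)
  ultimately show ?thesis by simp
qed

text \<open>Before and after \<open>t\<close>, exactly \<open>k\<close> star vertices lie above the
  curve. If the curve stays on \<open>p\<close>, a star vertex \<open>q\<close> tied with
  \<open>p\<close> would be the only one to change sides, and this count would change.\<close>

lemma straight_strand_other:
  assumes S: "k_star k C S" and k: "1 \<le> k" and g: "good t e" and ge: "germ (med k S) t e p p"
    and p: "p \<in> \<Union>S" and q: "q \<in> C" "q \<noteq> p" "ht q t = ht p t"
  shows "q \<notin> \<Union>S"
proof
  assume qS: "q \<in> \<Union>S"
  have e: "0 < e" using g by (simp add: good_def)
  note c = card_Union_star[OF S k]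
  have fS: "finite (\<Union>S)" using c fin_C finite_subset by blast
  define A where "A = {w \<in> \<Union>S. ht p t < ht w t}"
  have count: "k = card A + (if ht p y < ht q y then 1 else 0)" if y: "y \<noteq> t" "\<bar>y - t\<bar> < e" for y
  proof -
    have m: "med k S y = ht p y" using y germD(5,6)[OF ge, of y] by (cases "y < t") auto
    have inj: "inj_on (\<lambda>w. ht w y) C" by (rule good_generic[OF g y(2,1)])
    have iff: "ht p y < ht w y \<longleftrightarrow> ht p t < ht w t" if w: "w \<in> \<Union>S" "w \<noteq> p" "w \<noteq> q" for w
    proof -
      have wC: "w \<in> C" "p \<in> C" using w c p by auto
      have "ht w t \<noteq> ht p t" using no_triple_tie[of p q w t] q w wC by auto
      then show ?thesis using good_less[OF g y(2), of w p] good_less[OF g y(2), of p w] wC by force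
    qed
    have "{w \<in> \<Union>S - {p, q}. ht p y < ht w y} = A"
    proof (rule set_eqI)
      fix x
      show "x \<in> {w \<in> \<Union>S - {p, q}. ht p y < ht w y} \<longleftrightarrow> x \<in> A"
        using iff[of x] q(3) by (cases "x = p"; cases "x = q") (auto simp: A_def)
    qed
    moreover have "{w \<in> \<Union>S. ht p y < ht w y} = {w \<in> \<Union>S - {p, q}. ht p y < ht w y} \<union> (if ht p y < ht q y then {q} else {})"
      using qS by auto
    ultimately have "{w \<in> \<Union>S. ht p y < ht w y} = A \<union> (if ht p y < ht q y then {q} else {})" by simp
    moreover have "q \<notin> A" using q by (simp add: A_def)
    moreover have "finite A" using fS by (simp add: A_def)
    ultimately have "card {w \<in> \<Union>S. ht p y < ht w y} = card A + (if ht p y < ht q y then 1 else 0)" by simp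
    then show ?thesis using card_above_generic[OF S k p m inj] by simp
  qed
  have "ht p (t - e / 2) < ht q (t - e / 2) \<longleftrightarrow> ht p (t + e / 2) < ht q (t + e / 2)"
    using count[of "t - e / 2"] count[of "t + e / 2"] e by (auto split: if_splits)
  then show False
    using good_swap[OF g q(3)[symmetric] q(2)[symmetric], of "t - e / 2" "t + e / 2"] e
    by (auto simp: mult_less_0_iff)
qed

text \<open>At a contact a star curve passes from one vertex of the line to the other, so both
  belong to its star and form one of its edges. At a crossing it stays on one vertex, so the other
  is outside the star and the edge is not in \<open>T\<close>.\<close>

lemma stars_meets:
  assumes T: "k_triangulation k C T" and k: "1 \<le> k"
  shows "meets 1 (med k ` stars k T) \<subseteq> T" "meets (- 1) (med k ` stars k T) \<inter> T = {}"
proof -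
  let ?F = "med k ` stars k T"
  have F: "net k ?F" by (rule net_stars[OF T k])
  have main: "(s = 1 \<longrightarrow> on_line t (f t) \<in> T) \<and> (s = - 1 \<longrightarrow> on_line t (f t) \<notin> T)"
    if fg: "f \<in> ?F" "h \<in> ?F" "f \<noteq> h" "meet s f h t" for f h s t
  proof -
    obtain S where S: "k_star k C S" "S \<subseteq> T" "f = med k S" using fg(1) by (auto simp: stars_def)
    obtain e where g: "good t e" using good_ex by blast
    obtain p p' where 1: "germ f t e p p'" "p \<in> \<Union>S" "p' \<in> \<Union>S"
      using germ_ex[OF g curve_med(1)[OF S(1) k] card_Union_star(2)[OF S(1) k]] S(3) by blast
    obtain q q' where 2: "germ h t e q q'" using germ_ex[OF g netD(1)[OF F fg(2)]] by blast
    have eq: "f t = h t" using fg(4) by (simp add: meet_def)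
    note ne = net_germs_ne[OF F fg(1-3) g 1(1) 2]
    note m = meet_germs[OF g 1(1) 2 eq ne]
    have ht: "ht p t = f t" "ht q t = f t" "ht p' t = f t" using germD(3,4)[OF 1(1)] germD(3)[OF 2] eq by auto
    have ol: "on_line t (f t) = {p, q}" by (rule on_line_pair[OF germD(1)[OF 1(1)] germD(1)[OF 2] ne(1) ht(1,2)])
    show ?thesis
    proof (intro conjI impI)
      assume "s = 1"
      then have "p' = q" using m fg(4) by simp
      then have "{p, q} \<in> S" using tie_edge[OF S(1) k 1(2), of q t] 1(3) ne(1) ht S(3) by simp
      then show "on_line t (f t) \<in> T" using ol S(2) by auto
    next
      assume "s = - 1"
      then have "p' = p" using m fg(4) by simp
      then have "q \<notin> \<Union>S"
        using straight_strand_other[OF S(1) k g _ 1(2), of q] 1(1) S(3) germD(1)[OF 2] ne(1) ht by auto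
      then show "on_line t (f t) \<notin> T"
        using tie_not_edge[OF T k S(1,2) 1(2), of q t] germD(1)[OF 2] ht S(3) ol by simp
    qed
  qed
  show "meets 1 ?F \<subseteq> T" using main unfolding meets_def by blast
  show "meets (- 1) ?F \<inter> T = {}" using main unfolding meets_def by blast
qed

text \<open>A bisector through an outside vertex \<open>q\<close> contains a star vertex with
  exactly \<open>k\<close> star vertices on each side of the line. Around \<open>q\<close> the star
  vertices are linearly ordered, so this is the middle one, and the line is determined.\<close>

lemma med_tie_unique:
  assumes S: "k_star k C S" and k: "1 \<le> k" and q: "q \<in> C" "q \<notin> \<Union>S"
    and t: "ht q t = med k S t" "ht q t' = med k S t'"
  shows "\<exists>m::int. t' = t + of_int m * pi"
proof -
  note c = card_Union_star[OF S k]
  have fS: "finite (\<Union>S)" using c fin_C finite_subset by blast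
  have ex: "\<exists>v\<in>\<Union>S. ht v t = ht q t \<and> card {w \<in> \<Union>S. ccw q v w} = k" if t: "ht q t = med k S t" for t
  proof -
    obtain v where v: "v \<in> \<Union>S" "med k S t = ht v t" using curve_value[OF curve_med(1)[OF S k]] by blast
    have ne: "q \<noteq> v" using v q by auto
    have le: "card {w \<in> \<Union>S. ccw q v w} \<le> k" "card {w \<in> \<Union>S. ccw v q w} \<le> k"
      using orient_sides_le[OF S k ne t v(2)[symmetric]] by blast+
    have "\<Union>S \<subseteq> insert v ({w \<in> \<Union>S. ccw q v w} \<union> {w \<in> \<Union>S. ccw v q w})"
    proof
      fix w assume w: "w \<in> \<Union>S"
      have "ccw v q w \<longleftrightarrow> \<not> ccw v w q" if "w \<noteq> v"
        using ccw_total[of v q w] w q v c ne that by auto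
      then show "w \<in> insert v ({w \<in> \<Union>S. ccw q v w} \<union> {w \<in> \<Union>S. ccw v q w})"
        using w ccw_rot by blast
    qed
    then have "card (\<Union>S) \<le> card (insert v ({w \<in> \<Union>S. ccw q v w} \<union> {w \<in> \<Union>S. ccw v q w}))"
      using fS by (intro card_mono) auto
    also have "\<dots> \<le> Suc (card ({w \<in> \<Union>S. ccw q v w} \<union> {w \<in> \<Union>S. ccw v q w}))"
      using fS by (simp add: card_insert_if)
    also have "\<dots> \<le> Suc (card {w \<in> \<Union>S. ccw q v w} + card {w \<in> \<Union>S. ccw v q w})"
      using card_Un_le by auto
    finally have "card {w \<in> \<Union>S. ccw q v w} = k" using le c by linarith
    then show ?thesis using v t by auto
  qed
  obtain v where v: "v \<in> \<Union>S" "ht v t = ht q t" "card {w \<in> \<Union>S. ccw q v w} = k" using ex[OF t(1)] by blast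
  obtain u where u: "u \<in> \<Union>S" "ht u t' = ht q t'" "card {w \<in> \<Union>S. ccw q u w} = k" using ex[OF t(2)] by blast
  have no: "\<not> ccw q a b" if a: "a \<in> \<Union>S" "card {w \<in> \<Union>S. ccw q a w} = k" and b: "b \<in> \<Union>S" "card {w \<in> \<Union>S. ccw q b w} = k" for a b
  proof
    assume ab: "ccw q a b"
    have C: "a \<in> C" "b \<in> C" using that c by auto
    have "{w \<in> \<Union>S. ccw q b w} \<subseteq> {w \<in> \<Union>S. ccw q a w}"
      using ccw_trans(2)[OF q(1) C _ ab] c(2) by blast
    moreover have "b \<in> {w \<in> \<Union>S. ccw q a w}" "b \<notin> {w \<in> \<Union>S. ccw q b w}" using ab b ccw_distinct by blast+
    ultimately have "{w \<in> \<Union>S. ccw q b w} \<subset> {w \<in> \<Union>S. ccw q a w}" by blast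
    then have "card {w \<in> \<Union>S. ccw q b w} < card {w \<in> \<Union>S. ccw q a w}" using fS by (intro psubset_card_mono) auto
    then show False using a b by simp
  qed
  have "u = v"
  proof (rule ccontr)
    assume "u \<noteq> v"
    then have "ccw q u v \<or> ccw q v u" using ccw_total[of q u v] q u v c by auto
    then show False using no u v by blast
  qed
  then show ?thesis using ht_tie_unique[of q t v t'] u v q by auto
qed

lemma cross_once_stars:
  assumes T: "k_triangulation k C T" and k: "1 \<le> k"
  shows "cross_once (med k ` stars k T)"
proof -
  let ?F = "med k ` stars k T"
  have F: "net k ?F" by (rule net_stars[OF T k])
  have uniq: "\<exists>m::int. t2 = t1 + of_int m * pi"
    if fg: "f \<in> ?F" "h0 \<in> ?F" "f \<noteq> h0" and cr: "crossing_at f h0 t1" "crossing_at f h0 t2" for f h0 t1 t2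
  proof -
    obtain S where S: "k_star k C S" "S \<subseteq> T" "f = med k S" using fg(1) by (auto simp: stars_def)
    define Q where "Q = C - \<Union>S"
    have cQ: "card Q = n - 2 * k - 1" "finite Q"
      using card_Union_star[OF S(1) k] fin_C card_C by (auto simp: Q_def card_Diff_subset finite_subset)
    have cF: "card (?F - {f}) = n - 2 * k - 1" using card_net[OF F] fg(1) by simp
    have ex: "\<exists>q\<in>Q. ht q t = f t" if h: "h \<in> ?F" "f \<noteq> h" "crossing_at f h t" for h t
    proof -
      obtain e where g: "good t e" using good_ex by blast
      obtain p p' where 1: "germ f t e p p'" "p \<in> \<Union>S" "p' \<in> \<Union>S"
        using germ_ex[OF g curve_med(1)[OF S(1) k] card_Union_star(2)[OF S(1) k]] S(3) by blast
      obtain q q' where 2: "germ h t e q q'" using germ_ex[OF g netD(1)[OF F h(1)]] by blast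
      have eq: "f t = h t" using h(3) by (simp add: meet_def)
      note ne = net_germs_ne[OF F fg(1) h(1,2) g 1(1) 2]
      have "p' = p" using meet_germs[OF g 1(1) 2 eq ne] h(3) by simp
      then have "q \<notin> \<Union>S"
        using straight_strand_other[OF S(1) k g _ 1(2), of q] 1(1) S(3) germD(1,3)[OF 2] germD(3)[OF 1(1)] ne(1) eq by auto
      then show ?thesis using germD(1,3)[OF 2] eq by (auto simp: Q_def)
    qed
    have inj: "h = h' \<and> (\<exists>m::int. t' = t + of_int m * pi)"
      if h: "h \<in> ?F" "f \<noteq> h" "crossing_at f h t" and h': "h' \<in> ?F" "f \<noteq> h'" "crossing_at f h' t'"
        and q: "q \<in> Q" "ht q t = f t" "ht q t' = f t'" for h h' t t' q
    proof -
      obtain m :: int where m: "t' = t + of_int m * pi"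
        using med_tie_unique[OF S(1) k, of q t t'] q S(3) by (auto simp: Q_def)
      have ft: "f t' = (if even m then f t else - f t)"
        unfolding m by (rule antiperiodic_int) (rule curve_antiper[OF netD(1)[OF F fg(1)]])
      have "on_line t (f t) = on_line t' (f t')" unfolding ft using on_line_shift[of t m "f t"] m by simp
      moreover have "f t = h t" "f t' = h' t'" using h h' by (auto simp: meet_def)
      ultimately have "{f, h} = {f, h'}"
        using strands_unique[OF F fg(1) h(1,2) _ fg(1) h'(1,2), of t t'] by blast
      then show ?thesis using m h(2) h'(2) by (auto simp: doubleton_eq_iff)
    qed
    have "\<exists>t q. crossing_at f h t \<and> q \<in> Q \<and> ht q t = f t" if "h \<in> ?F - {f}" for h
      using net_crossing_ex[OF F fg(1), of h] ex[of h] that by blast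
    then obtain \<tau> \<rho> where \<tau>: "\<And>h. h \<in> ?F - {f} \<Longrightarrow> crossing_at f h (\<tau> h) \<and> \<rho> h \<in> Q \<and> ht (\<rho> h) (\<tau> h) = f (\<tau> h)"
      by metis
    have "inj_on \<rho> (?F - {f})"
    proof (rule inj_onI)
      fix h h' assume hh: "h \<in> ?F - {f}" "h' \<in> ?F - {f}" "\<rho> h = \<rho> h'"
      then show "h = h'" using inj[of h "\<tau> h" h' "\<tau> h'" "\<rho> h"] \<tau>[OF hh(1)] \<tau>[OF hh(2)] by auto
    qed
    then have "card (\<rho> ` (?F - {f})) = card Q" using cQ cF by (simp add: card_image)
    moreover have "\<rho> ` (?F - {f}) \<subseteq> Q" using \<tau> by blast
    ultimately have im: "\<rho> ` (?F - {f}) = Q" using cQ(2) by (intro card_subset_eq)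
    \<comment> \<open>\<open>\<rho>\<close> assigns to each other curve the outside vertex of one of
      its crossings with \<open>f\<close>, and is onto by cardinality. So any crossing of
      \<open>f\<close> with \<open>h0\<close> uses an assigned vertex, which by \<open>inj\<close>
      is that of \<open>h0\<close>, at the same angle modulo \<open>pi\<close>.\<close>
    have near: "\<exists>m::int. t = \<tau> h0 + of_int m * pi" if t: "crossing_at f h0 t" for t
    proof -
      obtain q where q: "q \<in> Q" "ht q t = f t" using ex[OF fg(2,3) t] by blast
      then obtain h where h: "h \<in> ?F - {f}" "q = \<rho> h" using im by blast
      have "h = h0 \<and> (\<exists>m::int. t = \<tau> h + of_int m * pi)"
        using inj[of h "\<tau> h" h0 t q] \<tau>[OF h(1)] h fg t q by auto
      then show ?thesis by blast
    qed
    obtain m1 m2 :: int where "t1 = \<tau> h0 + of_int m1 * pi" "t2 = \<tau> h0 + of_int m2 * pi"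
      using near cr by blast
    then have "t2 = t1 + of_int (m2 - m1) * pi" by (simp add: algebra_simps)
    then show ?thesis by blast
  qed
  show ?thesis unfolding cross_once_def using uniq net_crossing_ex[OF F] by blast
qed

theorem dual_arrangement_of_triangulation:
  assumes T: "k_triangulation k C T" and k: "1 \<le> k"
  shows "pseudoline_arrangement (dual_arrangement k C T)"
    "support (dual_arrangement k C T) = remove_levels k (support (dual_points C))"
  using arrangement_of_net[OF net_stars[OF T k] cross_once_stars[OF T k]] graph_line_stars[OF k, of T]
    remove_levels_eq_kernel[of k] by simp_all

end

section \<open>Contact edges contain no (k + 1)-crossing\<close>

lemma sign_change_shift:
  fixes \<sigma> :: "real \<Rightarrow> real"
  assumes anti: "\<And>t. \<sigma> (t + pi) = - \<sigma> t"
  shows "(\<exists>c. c \<noteq> 0 \<and> (\<forall>\<^sub>F s in at (t + of_int m * pi). \<sigma> s = c)) \<longleftrightarrow>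
    (\<exists>c. c \<noteq> 0 \<and> (\<forall>\<^sub>F s in at t. \<sigma> s = c))"
proof -
  define Q where "Q t \<longleftrightarrow> (\<exists>c. c \<noteq> 0 \<and> (\<forall>\<^sub>F s in at t. \<sigma> s = c))" for t
  have one: "Q (t + a)" if a: "\<And>s. \<sigma> (s + a) = - \<sigma> s" and Q: "Q t" for t a
  proof -
    obtain c d where c: "c \<noteq> 0" "0 < d" "\<And>s. s \<noteq> t \<Longrightarrow> dist s t < d \<Longrightarrow> \<sigma> s = c"
      using Q unfolding Q_def eventually_at by blast
    have "\<sigma> s = - c" if "s \<noteq> t + a" "dist s (t + a) < d" for s
      using c(3)[of "s - a"] a[of "s - a"] that by (auto simp: dist_real_def algebra_simps)
    then have "\<forall>\<^sub>F s in at (t + a). \<sigma> s = - c" unfolding eventually_at using c(2) by blast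
    then show ?thesis unfolding Q_def using c(1) by (intro exI[of _ "- c"]) simp
  qed
  have "\<sigma> (s - pi) = - \<sigma> s" for s using anti[of "s - pi"] by simp
  then have "Q (t + pi) \<longleftrightarrow> Q t" for t
    using one[of pi t] one[of "- pi" "t + pi"] anti by auto
  then have "antiper (\<lambda>t. {d. Q t})" by (simp add: antiper_def)
  from antiper_int[OF this, of 0 t m] have "Q (t + of_int m * pi) \<longleftrightarrow> Q t" by (simp split: if_splits)
  then show ?thesis unfolding Q_def .
qed

context ngon
begin

text \<open>Seen from \<open>q\<close> the other vertices are linearly ordered, and the number of
  successors determines the place in that order.\<close>

lemma rank_unique:
  assumes W: "W \<subseteq> C" and q: "q \<in> C" and a: "a \<in> W" "a \<noteq> q" and b: "b \<in> W" "b \<noteq> q"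
    and eq: "card {w \<in> W. ccw q a w} = card {w \<in> W. ccw q b w}"
  shows "a = b"
proof -
  have fW: "finite W" using W fin_C finite_subset by blast
  have no: "card {w \<in> W. ccw q b w} < card {w \<in> W. ccw q a w}" if ab: "a \<in> W" "b \<in> W" "ccw q a b" for a b
  proof -
    have C: "a \<in> C" "b \<in> C" using ab W by auto
    have "{w \<in> W. ccw q b w} \<subseteq> {w \<in> W. ccw q a w}"
      using ccw_trans(2)[OF q C _ ab(3)] W by blast
    moreover have "b \<in> {w \<in> W. ccw q a w}" "b \<notin> {w \<in> W. ccw q b w}" using ab ccw_distinct by blast+
    ultimately have "{w \<in> W. ccw q b w} \<subset> {w \<in> W. ccw q a w}" by blast
    then show ?thesis using fW by (intro psubset_card_mono) auto
  qed
  show ?thesis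
  proof (rule ccontr)
    assume "a \<noteq> b"
    then have "ccw q a b \<or> ccw q b a" using ccw_total[of q a b] q a b W by auto
    then show False using no[of a b] no[of b a] a b eq by auto
  qed
qed

lemma ccw_flip: "ccw q p r \<longleftrightarrow> orient p q r < 0"
  by (simp add: ccw_iff orient_def algebra_simps)

text \<open>Each of the other \<open>k\<close> edges crosses \<open>{p, q}\<close> and has one end
  on either side. Distinct edges of the crossing share no vertex, so these ends together with
  \<open>p\<close> and \<open>q\<close> exhaust the \<open>2k + 2\<close> vertices.\<close>

lemma crossing_sides:
  assumes X: "is_crossing (k + 1) C X" and e: "{p, q} \<in> X"
  shows "p \<noteq> q" "card (\<Union>X) = 2 * k + 2" "\<Union>X \<subseteq> C"
    "card {w \<in> \<Union>X. ccw p q w} = k" "card {w \<in> \<Union>X. ccw q p w} = k"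
proof -
  have XE: "X \<subseteq> edges C" and fX: "finite X" "card X = k + 1"
    and cr: "\<And>e f. e \<in> X \<Longrightarrow> f \<in> X \<Longrightarrow> e \<noteq> f \<Longrightarrow> edges_cross e f"
    using X by (auto simp: is_crossing_def)
  have pair: "\<exists>r s. f = {r, s} \<and> r \<in> C \<and> s \<in> C \<and> r \<noteq> s" if "f \<in> X" for f
    using that XE unfolding edges_def by blast
  have sides: "\<exists>r s. f = {r, s} \<and> ccw p q r \<and> ccw q p s" if f: "f \<in> X" "f \<noteq> {p, q}" and pq: "{p, q} \<in> X" for f p q
  proof -
    obtain r s where rs: "f = {r, s}" "r \<in> C" "s \<in> C" "r \<noteq> s" using pair[OF f(1)] by blast
    have C: "p \<in> C" "q \<in> C" "p \<noteq> q" using pair[OF pq] by (auto simp: doubleton_eq_iff)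
    have "orient p q r * orient p q s < 0"
      using cr[OF pq f(1)] f(2) edges_cross_iff[OF C(1,2) rs(2,3) C(3) rs(4)] rs(1) by auto
    then have "(ccw p q r \<and> ccw q p s) \<or> (ccw p q s \<and> ccw q p r)"
      unfolding ccw_flip[of q p] ccw_iff[of p q] by (auto simp: mult_less_0_iff)
    then show ?thesis using rs(1) by blast
  qed
  show ne: "p \<noteq> q" using pair[OF e] by (auto simp: doubleton_eq_iff)
  show UC: "\<Union>X \<subseteq> C"
  proof
    fix w assume "w \<in> \<Union>X"
    then obtain f where f: "f \<in> X" "w \<in> f" by (rule UnionE)
    then show "w \<in> C" using pair[OF f(1)] by blast
  qed
  have fU: "finite (\<Union>X)" using UC fin_C finite_subset by blast
  have dis: "f \<inter> g = {}" if fg: "f \<in> X" "g \<in> X" "f \<noteq> g" for f g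
  proof -
    obtain a b where ab: "f = {a, b}" using pair[OF fg(1)] by blast
    obtain r s where "g = {r, s}" "ccw a b r" "ccw b a s" using sides[of g a b] fg ab by auto
    then show ?thesis using ab ccw_distinct by blast
  qed
  have "card (\<Union>X) = (\<Sum>f\<in>X. card f)"
  proof (rule card_Union_disjoint)
    show "pairwise disjnt X" using dis by (auto simp: pairwise_def disjnt_def)
    show "finite f" if "f \<in> X" for f using pair[OF that] by auto
  qed
  also have "\<dots> = (\<Sum>f\<in>X. 2)"
  proof (rule sum.cong[OF refl])
    show "card f = 2" if "f \<in> X" for f using pair[OF that] by (auto simp: card_2_iff)
  qed
  finally show cU: "card (\<Union>X) = 2 * k + 2" using fX by simp
  let ?Y = "X - {{p, q}}"
  have cY: "card ?Y = k" "finite ?Y" using fX e by auto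
  have "\<exists>r. r \<in> f \<and> ccw p q r" "\<exists>s. s \<in> f \<and> ccw q p s" if "f \<in> ?Y" for f
    using sides[OF _ _ e, of f] that by blast+
  then obtain \<alpha> \<beta> where \<alpha>: "\<And>f. f \<in> ?Y \<Longrightarrow> \<alpha> f \<in> f \<and> ccw p q (\<alpha> f)"
    and \<beta>: "\<And>f. f \<in> ?Y \<Longrightarrow> \<beta> f \<in> f \<and> ccw q p (\<beta> f)" by metis
  have inj: "inj_on \<alpha> ?Y" "inj_on \<beta> ?Y"
  proof -
    have same: "f = g" if "f \<in> ?Y" "g \<in> ?Y" "x \<in> f" "x \<in> g" for f g x using dis[of f g] that by blast
    show "inj_on \<alpha> ?Y"
    proof (rule inj_onI)
      fix f g assume fg: "f \<in> ?Y" "g \<in> ?Y" "\<alpha> f = \<alpha> g"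
      show "f = g" by (rule same[OF fg(1,2), of "\<alpha> f"]) (use \<alpha>[OF fg(1)] \<alpha>[OF fg(2)] fg(3) in simp_all)
    qed
    show "inj_on \<beta> ?Y"
    proof (rule inj_onI)
      fix f g assume fg: "f \<in> ?Y" "g \<in> ?Y" "\<beta> f = \<beta> g"
      show "f = g" by (rule same[OF fg(1,2), of "\<beta> f"]) (use \<beta>[OF fg(1)] \<beta>[OF fg(2)] fg(3) in simp_all)
    qed
  qed
  let ?R = "{w \<in> \<Union>X. ccw p q w}" and ?L = "{w \<in> \<Union>X. ccw q p w}"
  have "\<alpha> ` ?Y \<subseteq> ?R" "\<beta> ` ?Y \<subseteq> ?L" using \<alpha> \<beta> by (auto simp: Union_iff)
  then have "card (\<alpha> ` ?Y) \<le> card ?R" "card (\<beta> ` ?Y) \<le> card ?L" using fU by (auto intro!: card_mono)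
  then have ge: "k \<le> card ?R" "k \<le> card ?L" using inj cY by (simp_all add: card_image)
  have "?R \<inter> ?L = {}" unfolding ccw_flip[of q p] ccw_iff[of p q] by auto
  then have "card (?R \<union> ?L) = card ?R + card ?L" using fU by (intro card_Un_disjoint) auto
  moreover have "?R \<union> ?L \<subseteq> \<Union>X - {p, q}" using ccw_distinct by blast
  then have "card (?R \<union> ?L) \<le> card (\<Union>X - {p, q})" using fU by (intro card_mono) auto
  moreover have "card (\<Union>X - {p, q}) = 2 * k"
  proof -
    have "{p, q} \<subseteq> \<Union>X" using e by blast
    then show ?thesis using cU fU ne by (simp add: card_Diff_subset)
  qed
  ultimately show "card ?R = k" "card ?L = k" using ge by linarith+
qed

text \<open>The edge of \<open>X\<close> at \<open>p\<close> has \<open>k\<close> vertices of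
  \<open>\<Union>X\<close> on either side, and by \<open>rank_unique\<close> only one vertex gives
  such a line through \<open>p\<close>.\<close>

lemma halving_in_crossing:
  assumes X: "is_crossing (k + 1) C X" and pq: "p \<in> \<Union>X" "q \<in> \<Union>X" "p \<noteq> q"
    and half: "card {w \<in> \<Union>X. ccw p q w} = k"
  shows "{p, q} \<in> X"
proof -
  obtain f where f: "f \<in> X" "p \<in> f" using pq(1) by (rule UnionE)
  have "f \<in> edges C" using f X by (auto simp: is_crossing_def)
  then obtain r where r: "f = {p, r}" using f(2) unfolding edges_def by blast
  note s = crossing_sides[OF X, of p r]
  have "r \<in> \<Union>X" using f r by blast
  then have "q = r"
    using rank_unique[of "\<Union>X" p q r] s f(1) r pq half by auto
  then show ?thesis using f r by simp
qed

lemma short_not_in_crossing: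
  assumes X: "is_crossing (k + 1) C X" and e: "e \<in> X"
  shows "e \<notin> short_edges k C"
proof
  assume "e \<in> short_edges k C"
  then obtain p q where pq: "e = {p, q}" "card {r \<in> C. ccw p q r} < k" unfolding short_edges_def by blast
  note s = crossing_sides[OF X, of p q]
  have "card {w \<in> \<Union>X. ccw p q w} \<le> card {r \<in> C. ccw p q r}"
    using s(3) e pq(1) fin_C by (intro card_mono) auto
  then show False using s(4) e pq by auto
qed

text \<open>\<open>side A a0\<close> tells on which side of a curve halving \<open>A\<close> a point at height \<open>x\<close> lies; ties are
  broken by \<open>a0\<close> so that the choice stays antiperiodic.\<close>

definition balance :: "complex set \<Rightarrow> real \<Rightarrow> real \<Rightarrow> int" where
  "balance A x y = int (card {w \<in> A. ht w y < x}) - int (card {w \<in> A. x < ht w y})"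

definition side :: "complex set \<Rightarrow> complex \<Rightarrow> real \<Rightarrow> real \<Rightarrow> real" where
  "side A a0 x y = (if balance A x y \<noteq> 0 then sgn (of_int (balance A x y)) else sgn (ht a0 y - x))"

text \<open>Phrased as the negation of the local condition in
  \<open>antiperiodic_sign_change\<close>, which thus provides a flip for every curve.\<close>

definition flips_at :: "complex set \<Rightarrow> complex \<Rightarrow> (real \<Rightarrow> real) \<Rightarrow> real \<Rightarrow> bool" where
  "flips_at A a0 f t \<longleftrightarrow> \<not> (\<exists>c. c \<noteq> 0 \<and> (\<forall>\<^sub>F s in at t. side A a0 (f s) s = c))"

lemma side_antiperiodic: "side A a0 (- x) (t + pi) = - side A a0 x t"
proof -
  have "balance A (- x) (t + pi) = - balance A x t" by (simp add: balance_def)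
  moreover have "sgn (ht a0 (t + pi) - - x) = - sgn (ht a0 t - x)"
    unfolding sgn_minus[symmetric] by simp
  ultimately show ?thesis unfolding side_def by (simp add: sgn_minus)
qed

lemma balance_near:
  assumes AC: "A \<subseteq> C" and g: "good t e" and y: "\<bar>y - t\<bar> < e" and u: "u \<in> C" "ht u t = d"
  shows "balance A (ht u y) y = balance A d t +
    int (card {w \<in> A. ht w t = d \<and> ht w y < ht u y}) - int (card {w \<in> A. ht w t = d \<and> ht u y < ht w y})"
proof -
  have fA: "finite A" using AC fin_C finite_subset by blast
  have l: "{w \<in> A. ht w y < ht u y} = {w \<in> A. ht w t < d} \<union> {w \<in> A. ht w t = d \<and> ht w y < ht u y}"
  proof (rule set_eqI)
    fix w
    show "w \<in> {w \<in> A. ht w y < ht u y} \<longleftrightarrow> w \<in> {w \<in> A. ht w t < d} \<union> {w \<in> A. ht w t = d \<and> ht w y < ht u y}"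
      using good_less[OF g y, of w u] good_less[OF g y, of u w] u AC
      by (cases "w \<in> A"; cases "ht w t < d"; cases "ht w t = d") force+
  qed
  have r: "{w \<in> A. ht u y < ht w y} = {w \<in> A. d < ht w t} \<union> {w \<in> A. ht w t = d \<and> ht u y < ht w y}"
  proof (rule set_eqI)
    fix w
    show "w \<in> {w \<in> A. ht u y < ht w y} \<longleftrightarrow> w \<in> {w \<in> A. d < ht w t} \<union> {w \<in> A. ht w t = d \<and> ht u y < ht w y}"
      using good_less[OF g y, of w u] good_less[OF g y, of u w] u AC
      by (cases "w \<in> A"; cases "ht w t < d"; cases "ht w t = d") force+
  qed
  have "card {w \<in> A. ht w y < ht u y} = card {w \<in> A. ht w t < d} + card {w \<in> A. ht w t = d \<and> ht w y < ht u y}"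
    unfolding l using fA by (intro card_Un_disjoint) auto
  moreover have "card {w \<in> A. ht u y < ht w y} = card {w \<in> A. d < ht w t} + card {w \<in> A. ht w t = d \<and> ht u y < ht w y}"
    unfolding r using fA by (intro card_Un_disjoint) auto
  ultimately show ?thesis by (simp add: balance_def)
qed

lemma card_split_at:
  assumes AC: "A \<subseteq> C"
  shows "card A = card {w \<in> A. ht w t < d} + card {w \<in> A. d < ht w t} + card {w \<in> A. ht w t = d}"
proof -
  have fA: "finite A" using AC fin_C finite_subset by blast
  have "A = ({w \<in> A. ht w t < d} \<union> {w \<in> A. d < ht w t}) \<union> {w \<in> A. ht w t = d}" by auto
  then have "card A = card (({w \<in> A. ht w t < d} \<union> {w \<in> A. d < ht w t}) \<union> {w \<in> A. ht w t = d})" by simp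
  also have "\<dots> = card ({w \<in> A. ht w t < d} \<union> {w \<in> A. d < ht w t}) + card {w \<in> A. ht w t = d}"
    using fA by (intro card_Un_disjoint) auto
  also have "card ({w \<in> A. ht w t < d} \<union> {w \<in> A. d < ht w t}) = card {w \<in> A. ht w t < d} + card {w \<in> A. d < ht w t}"
    using fA by (intro card_Un_disjoint) auto
  finally show ?thesis .
qed

lemma not_flips_atI:
  assumes "0 < e" "c \<noteq> 0" "\<And>y. \<bar>y - t\<bar> < e \<Longrightarrow> y \<noteq> t \<Longrightarrow> side A a0 (f y) y = c"
  shows "\<not> flips_at A a0 f t"
proof -
  have "\<forall>\<^sub>F s in at t. side A a0 (f s) s = c"
    unfolding eventually_at using assms(1,3) by (intro exI[of _ e]) (auto simp: dist_real_def)
  then show ?thesis using assms(2) by (auto simp: flips_at_def)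
qed

lemma flips_at_ex: "curve C f \<Longrightarrow> \<exists>t. flips_at A a0 f t"
  unfolding flips_at_def
  using antiperiodic_sign_change[of "\<lambda>t. side A a0 (f t) t"] side_antiperiodic curve_antiper by metis

lemma flips_at_shift:
  assumes "curve C f" shows "flips_at A a0 f (t + of_int m * pi) \<longleftrightarrow> flips_at A a0 f t"
  unfolding flips_at_def
  using sign_change_shift[of "\<lambda>t. side A a0 (f t) t" t m] side_antiperiodic curve_antiper[OF assms] by simp

lemma order_side:
  assumes g: "good t e" and pq: "p \<noteq> q" "ht p t = ht q t"
    and y: "\<bar>y - t\<bar> < e" "y \<noteq> t" and z: "\<bar>z - t\<bar> < e" "z \<noteq> t"
  shows "(ht p y < ht q y \<longleftrightarrow> ht p z < ht q z) \<longleftrightarrow> (y < t \<longleftrightarrow> z < t)"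
proof -
  have e: "0 < e" using g by (simp add: good_def)
  have sw: "ht p a < ht q a \<longleftrightarrow> \<not> ht p b < ht q b" if "\<bar>a - t\<bar> < e" "a < t" "\<bar>b - t\<bar> < e" "t < b" for a b
    using good_swap[OF g pq(2,1), of a b] that by (auto simp: mult_less_0_iff)
  show ?thesis
  proof (cases "y < t"; cases "z < t")
    assume "y < t" "z < t"
    then show ?thesis using sw[of y "t + e / 2"] sw[of z "t + e / 2"] y z e by simp
  next
    assume "y < t" "\<not> z < t"
    then show ?thesis using sw[of y z] y z by simp
  next
    assume "\<not> y < t" "z < t"
    then show ?thesis using sw[of z y] y z by auto
  next
    assume "\<not> y < t" "\<not> z < t"
    then show ?thesis using sw[of "t - e / 2" y] sw[of "t - e / 2" z] y z e by simp
  qed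
qed

lemma card_sides_orient:
  assumes qa: "q \<noteq> a" "ht q t = d" "ht a t = d"
    and c: "card {w \<in> W. d < ht w t} = k" "card {w \<in> W. ht w t < d} = k"
  shows "card {w \<in> W. ccw q a w} = k"
proof -
  obtain \<kappa> where \<kappa>: "\<kappa> \<noteq> 0" "\<And>r. ht r t - ht q t = \<kappa> * orient q a r"
    using ht_diff_orient[of q t a] qa by auto
  have r: "d < ht w t \<longleftrightarrow> 0 < \<kappa> * orient q a w" "ht w t < d \<longleftrightarrow> \<kappa> * orient q a w < 0" for w
    using \<kappa>(2)[of w] qa(2) by linarith+
  consider "0 < \<kappa>" | "\<kappa> < 0" using \<kappa>(1) by linarith
  then show ?thesis
  proof cases
    case 1 then show ?thesis using c(1) unfolding r ccw_iff by (simp add: zero_less_mult_iff)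
  next
    case 2 then show ?thesis using c(2) unfolding r ccw_iff by (simp add: mult_less_0_iff)
  qed
qed

text \<open>Only two curves pass a contact edge, they touch there, and touching curves exchange
  their vertices.\<close>

lemma contact_switches:
  assumes F: "net k F" and f: "f \<in> F" and g: "good t e" and ge: "germ f t e p p'"
    and ab: "a \<in> C" "b \<in> C" "a \<noteq> b" "ht a t = f t" "ht b t = f t" and con: "{a, b} \<in> meets 1 F"
  shows "p' \<noteq> p"
proof -
  have "{a, b} \<in> relevant k" using con relevant_eq_meets[OF F] by blast
  then obtain f1 f2 where f12: "f1 \<in> F" "f2 \<in> F" "f1 \<noteq> f2" "f1 t = ht a t" "f2 t = ht a t"
    "\<forall>l\<in>F. l t = ht a t \<longrightarrow> l = f1 \<or> l = f2"
    using relevant_strands[OF F ab(1-3), of t] ab(4,5) by auto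
  then obtain h where h: "h \<in> F" "f \<noteq> h" "f t = h t"
    using f ab(4) by metis
  have ol: "on_line t (f t) = {a, b}" by (rule on_line_pair[OF ab])
  have "\<not> crossing_at f h t"
  proof
    assume "crossing_at f h t"
    then have "{a, b} \<in> meets (- 1) F" using f h ol unfolding meets_def by blast
    then show False using con meets_disjoint[OF F] by blast
  qed
  moreover obtain q q' where q: "germ h t e q q'" using germ_ex[OF g netD(1)[OF F h(1)]] by blast
  note ne = net_germs_ne[OF F f h(1,2) g ge q]
  ultimately show ?thesis using meet_germs[OF g ge q h(3) ne] by blast
qed

text \<open>The number of vertices of \<open>\<Union>X\<close> on the line decides. With none, no
  vertex changes sides. With two, the imbalance is even and critical only when zero; the line then
  carries an edge of \<open>X\<close>, and as this is a contact, the curve exchanges its vertices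
  and keeps its side. With one, the imbalance is odd, and a flip needs a passage to an outside
  vertex \<open>q\<close> that brings it to zero and a tie-break by \<open>a0\<close> against it.
  The last clause, telling on which side of \<open>t\<close> the curve follows \<open>q\<close>, is
  what makes \<open>q\<close> characteristic of the curve.\<close>

lemma flips_at_case:
  assumes F: "net k F" and f: "f \<in> F" and X: "is_crossing (k + 1) C X" "X \<subseteq> meets 1 F"
    and a0: "a0 \<in> \<Union>X" and fl: "flips_at (\<Union>X) a0 f t" and g: "good t e"
  shows "\<exists>a q. a \<in> \<Union>X - {a0} \<and> q \<in> C - \<Union>X \<and> ht a t = f t \<and> ht q t = f t \<and>
    card {w \<in> \<Union>X - {a0}. ccw q a w} = k \<and>
    (\<forall>y. \<bar>y - t\<bar> < e \<longrightarrow> y \<noteq> t \<longrightarrow> (ht q y < ht a y \<longleftrightarrow> ht a0 t < f t) \<longrightarrow> f y = ht q y)"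
proof (rule ccontr)
  assume no: "\<not> ?thesis"
  obtain x where x: "x \<in> X" using a0 by (rule UnionE)
  have "x \<in> edges C" using x X by (auto simp: is_crossing_def)
  then obtain x1 x2 where "x = {x1, x2}" unfolding edges_def by blast
  then have AC: "\<Union>X \<subseteq> C" and cA: "card (\<Union>X) = 2 * k + 2"
    using crossing_sides[OF X(1), of x1 x2] x by auto
  define A where "A = \<Union>X"
  note AC = AC[folded A_def] and cA = cA[folded A_def] and a0 = a0[folded A_def]
    and fl = fl[folded A_def] and no = no[folded A_def]
  have fA: "finite A" using AC fin_C finite_subset by blast
  have e: "0 < e" using g by (simp add: good_def)
  define d where "d = f t"
  define T where "T = {w \<in> A. ht w t = d}"
  obtain p p' where ge: "germ f t e p p'" using germ_ex[OF g netD(1)[OF F f]] by blast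
  define u where "u y = (if y < t then p else p')" for y
  have uC: "u y \<in> C" "ht (u y) t = d" for y
    using germD(1-4)[OF ge] by (auto simp: u_def d_def)
  have fu: "f y = ht (u y) y" if "\<bar>y - t\<bar> < e" "y \<noteq> t" for y
    using germD(5,6)[OF ge, of y] that by (cases "y < t") (auto simp: u_def)
  define b0 where "b0 = balance A d t"
  have bal: "balance A (f y) y = b0 + int (card {w \<in> T. ht w y < ht (u y) y}) - int (card {w \<in> T. ht (u y) y < ht w y})"
    if y: "\<bar>y - t\<bar> < e" "y \<noteq> t" for y
    using balance_near[OF AC g y(1) uC(1,2)[of y]] unfolding fu[OF y] b0_def T_def by simp
  define lo where "lo = int (card {w \<in> A. ht w t < d})"
  define up where "up = int (card {w \<in> A. d < ht w t})"
  have "2 * k + 2 = card {w \<in> A. ht w t < d} + card {w \<in> A. d < ht w t} + card T"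
    using card_split_at[OF AC, of t d] cA by (simp add: T_def)
  then have "int (2 * k + 2) = int (card {w \<in> A. ht w t < d} + card {w \<in> A. d < ht w t} + card T)"
    by (rule arg_cong)
  \<comment> \<open>As \<open>\<Union>X\<close> has \<open>2k + 2\<close> vertices, the imbalance
    \<open>lo - up\<close> has the parity of the number of vertices on the line.\<close>
  then have par: "2 * int k + 2 = lo + up + int (card T)"
    by (simp only: lo_def up_def of_nat_add of_nat_mult of_nat_numeral)
  have b0: "b0 = lo - up" by (simp add: b0_def balance_def lo_def up_def)
  have cards: "card {w \<in> A. ht w t < d} = m" if "lo = int m" for m using that by (simp add: lo_def)
  have cards': "card {w \<in> A. d < ht w t} = m" if "up = int m" for m using that by (simp add: up_def)
  have "\<exists>c. c \<noteq> 0 \<and> (\<forall>y. \<bar>y - t\<bar> < e \<longrightarrow> y \<noteq> t \<longrightarrow> side A a0 (f y) y = c)"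
  proof (cases "T = {}")
    case True
    then have "ht a0 t \<noteq> d" using a0 by (auto simp: T_def)
    define c where "c = (if b0 \<noteq> 0 then sgn (of_int b0) else sgn (ht a0 t - d))"
    have "side A a0 (f y) y = c" if y: "\<bar>y - t\<bar> < e" "y \<noteq> t" for y
    proof -
      have "balance A (f y) y = b0" using bal[OF y] True by simp
      moreover have "sgn (ht a0 y - ht (u y) y) = sgn (ht a0 t - d)"
        using good_less[OF g y(1), of a0 "u y"] good_less[OF g y(1), of "u y" a0] uC[of y] a0 AC \<open>ht a0 t \<noteq> d\<close>
        by (cases "ht a0 t < d") (auto simp: sgn_if)
      ultimately show ?thesis using fu[OF y] by (simp add: side_def c_def)
    qed
    moreover have "c \<noteq> 0" using \<open>ht a0 t \<noteq> d\<close> by (simp add: c_def sgn_zero_iff)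
    ultimately show ?thesis by blast
  next
    case False
    then obtain a where a: "a \<in> T" by blast
    have aA: "a \<in> A" "a \<in> C" "ht a t = d" using a AC by (auto simp: T_def)
    show ?thesis
    proof (cases "T = {a}")
      case single: True
      have cT: "int (card T) = 1" using single by simp
      have "b0 = 2 * lo - 2 * int k - 1" using par b0 cT by linarith
      then have odd: "odd b0" by simp
      then have b0nz: "b0 \<noteq> 0" by auto
      show ?thesis
      proof (cases "p = a \<and> p' = a")
        case True
        then have ua: "u y = a" for y by (simp add: u_def)
        have none: "{w \<in> T. ht w y < ht a y} = {}" "{w \<in> T. ht a y < ht w y} = {}" for y
          using single by auto
        have "side A a0 (f y) y = sgn (of_int b0)" if y: "\<bar>y - t\<bar> < e" "y \<noteq> t" for y
          using bal[OF y] b0nz unfolding ua none by (simp add: side_def)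
        then show ?thesis using b0nz by (intro exI[of _ "sgn (of_int b0)"]) (simp add: sgn_zero_iff)
      next
        case False
        then obtain q where q: "q \<in> C" "q \<noteq> a" "ht q t = d"
          using germD(1-4)[OF ge] by (auto simp: d_def)
        have qA: "q \<notin> A" using q single by (auto simp: T_def)
        have uaq: "u y = a \<or> u y = q" for y
          using two_at_tie[OF aA(2) q(1) uC(1) q(2)[symmetric] aA(3) q(3) uC(2)] .
        have tie: "ht q t = ht a t" using q aA by simp
        have cond: "\<exists>y. \<bar>y - t\<bar> < e \<and> y \<noteq> t \<and> (ht q y < ht a y \<longleftrightarrow> ht a0 t < d) \<and> f y \<noteq> ht q y"
          if h: "a \<noteq> a0" "card {w \<in> A - {a0}. d < ht w t} = k" "card {w \<in> A - {a0}. ht w t < d} = k"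
        proof (rule ccontr)
          assume "\<not> ?thesis"
          moreover have "card {w \<in> A - {a0}. ccw q a w} = k"
            by (rule card_sides_orient[OF q(2,3) aA(3) h(2,3)])
          ultimately show False
            using no h(1) aA q qA unfolding d_def by blast
        qed
        have "side A a0 (f y) y = sgn (of_int b0)" if y: "\<bar>y - t\<bar> < e" "y \<noteq> t" for y
        proof (cases "u y = a")
          case True
          have none: "{w \<in> T. ht w y < ht a y} = {}" "{w \<in> T. ht a y < ht w y} = {}"
            using single by auto
          show ?thesis using bal[OF y] b0nz unfolding True none by (simp add: side_def)
        next
          case False
          then have uq: "u y = q" using uaq by blast
          have fy: "f y = ht q y" using fu[OF y] uq by simp
          have neq: "ht a y \<noteq> ht q y"
            using good_generic[OF g y] aA(2) q(1,2) by (auto simp: inj_on_def)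
          \<comment> \<open>\<open>h(4)\<close> puts \<open>y\<close> on the same side of
            \<open>t\<close> as a witness \<open>z\<close> at which the curve is not on
            \<open>q\<close>; but on one side of \<open>t\<close> the curve follows a single
            vertex.\<close>
          have aux: False
            if h: "a \<noteq> a0" "card {w \<in> A - {a0}. d < ht w t} = k" "card {w \<in> A - {a0}. ht w t < d} = k"
              "ht q y < ht a y \<longleftrightarrow> ht a0 t < d"
          proof -
            obtain z where z: "\<bar>z - t\<bar> < e" "z \<noteq> t" "ht q z < ht a z \<longleftrightarrow> ht a0 t < d" "f z \<noteq> ht q z"
              using cond[OF h(1-3)] by blast
            have "y < t \<longleftrightarrow> z < t" using order_side[OF g q(2) tie y z(1,2)] h(4) z(3) by simp
            then have "u z = q" using uq by (auto simp: u_def split: if_splits)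
            then show False using fu[OF z(1,2)] z(4) by simp
          qed
          have a0d: "ht a0 t \<noteq> d" if "a0 \<noteq> a" using that single a0 by (auto simp: T_def)
          have up: "{w \<in> A - {a0}. d < ht w t} = {w \<in> A. d < ht w t} - (if d < ht a0 t then {a0} else {})"
            and dn: "{w \<in> A - {a0}. ht w t < d} = {w \<in> A. ht w t < d} - (if ht a0 t < d then {a0} else {})"
            by auto
          have cup: "card {w \<in> A - {a0}. d < ht w t} = card {w \<in> A. d < ht w t} - (if d < ht a0 t then 1 else 0)"
            and cdn: "card {w \<in> A - {a0}. ht w t < d} = card {w \<in> A. ht w t < d} - (if ht a0 t < d then 1 else 0)"
            unfolding up dn using a0 fA by auto
          have gl: "ht a0 t < d \<Longrightarrow> ht a0 y < ht q y" "d < ht a0 t \<Longrightarrow> ht q y < ht a0 y"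
            using good_less[OF g y(1), of a0 q] good_less[OF g y(1), of q a0] a0 AC q by auto
          show ?thesis
          proof (cases "ht a y < ht q y")
            case True
            have s: "{w \<in> T. ht w y < ht q y} = {a}" "{w \<in> T. ht q y < ht w y} = {}" using single True by auto
            have b: "balance A (f y) y = b0 + 1" using bal[OF y] unfolding uq s by simp
            \<comment> \<open>Only for \<open>b0 = - 1\<close> does the imbalance become zero.
              Unless \<open>a0\<close> lies above the line, it is then below \<open>q\<close> and
              confirms the negative sign; if it lies above, deleting it leaves \<open>k\<close>
              vertices on either side, which is the excluded configuration.\<close>
            show ?thesis
            proof (cases "b0 = - 1")
              case m1: True
              then have "lo = int k" "up = int (k + 1)" using par b0 cT by linarith+
              note cc = cards[OF this(1)] cards'[OF this(2)]
              have "ht a0 y < ht q y"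
              proof (cases "a0 = a")
                case False
                have "\<not> d < ht a0 t"
                proof
                  assume "d < ht a0 t"
                  then show False using aux False cc cup cdn True by auto
                qed
                then show ?thesis using a0d[OF False] gl by linarith
              qed (use True in simp)
              then show ?thesis using b m1 fy by (simp add: side_def)
            next
              case False
              then have "0 < b0 + 1 \<and> 0 < b0 \<or> b0 + 1 < 0 \<and> b0 < 0" using odd b0nz by presburger
              then show ?thesis using b by (auto simp: side_def)
            qed
          next
            case False
            then have lt: "ht q y < ht a y" using neq by simp
            have s: "{w \<in> T. ht w y < ht q y} = {}" "{w \<in> T. ht q y < ht w y} = {a}" using single lt by auto
            have b: "balance A (f y) y = b0 - 1" using bal[OF y] unfolding uq s by simp
            show ?thesis
            proof (cases "b0 = 1")
              case m1: True
              then have "lo = int (k + 1)" "up = int k" using par b0 cT by linarith+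
              note cc = cards[OF this(1)] cards'[OF this(2)]
              have "ht q y < ht a0 y"
              proof (cases "a0 = a")
                case False
                have "\<not> ht a0 t < d"
                proof
                  assume "ht a0 t < d"
                  then show False using aux False cc cup cdn lt by auto
                qed
                then show ?thesis using a0d[OF False] gl by linarith
              qed (use lt in simp)
              then show ?thesis using b m1 fy by (simp add: side_def)
            next
              case False
              then have "0 < b0 - 1 \<and> 0 < b0 \<or> b0 - 1 < 0 \<and> b0 < 0" using odd b0nz by presburger
              then show ?thesis using b by (auto simp: side_def)
            qed
          qed
        qed
        then show ?thesis using b0nz by (intro exI[of _ "sgn (of_int b0)"]) (simp add: sgn_zero_iff)
      qed
    next
      case False
      then obtain b where b: "b \<in> T" "b \<noteq> a" using a by blast
      have bA: "b \<in> A" "b \<in> C" "ht b t = d" using b AC by (auto simp: T_def)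
      have Tab: "T = {a, b}"
        using two_at_tie[OF aA(2) bA(2) _ b(2)[symmetric] aA(3) bA(3)] a b AC by (auto simp: T_def)
      have cT: "int (card T) = 2" using b(2) by (simp add: Tab)
      have uab: "u y = a \<or> u y = b" for y
        using two_at_tie[OF aA(2) bA(2) uC(1) b(2)[symmetric] aA(3) bA(3) uC(2)] .
      have "b0 = 2 * lo - 2 * int k" using par b0 cT by linarith
      then have even: "even b0" by simp
      have bl: "balance A (f y) y = b0 + (if ht v y < ht (u y) y then 1 else - 1)"
        if y: "\<bar>y - t\<bar> < e" "y \<noteq> t" and v: "{a, b} = {u y, v}" for y v
      proof -
        have vu: "v \<noteq> u y" using v b(2) by (auto simp: doubleton_eq_iff)
        have neq: "ht v y \<noteq> ht (u y) y"
          using good_generic[OF g y] vu v uC(1) aA(2) bA(2) by (auto simp: inj_on_def doubleton_eq_iff)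
        have Tv: "T = {u y, v}" using Tab v by simp
        show ?thesis
        proof (cases "ht v y < ht (u y) y")
          case True
          have s: "{w \<in> T. ht w y < ht (u y) y} = {v}" "{w \<in> T. ht (u y) y < ht w y} = {}"
            unfolding Tv using True by auto
          show ?thesis using bal[OF y] True unfolding s by simp
        next
          case False
          have s: "{w \<in> T. ht w y < ht (u y) y} = {}" "{w \<in> T. ht (u y) y < ht w y} = {v}"
            unfolding Tv using False neq by auto
          show ?thesis using bal[OF y] False unfolding s by simp
        qed
      qed
      have oth: "\<exists>v. {a, b} = {u y, v}" for y using uab[of y] by auto
      show ?thesis
      proof (cases "b0 = 0")
        case False
        have "side A a0 (f y) y = sgn (of_int b0)" if y: "\<bar>y - t\<bar> < e" "y \<noteq> t" for y
        proof -
          obtain v where v: "{a, b} = {u y, v}" using oth by blast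
          have "balance A (f y) y = b0 + 1 \<or> balance A (f y) y = b0 - 1" using bl[OF y v] by (auto split: if_splits)
          moreover have "2 \<le> b0 \<or> b0 \<le> - 2" using even False by presburger
          ultimately show ?thesis by (auto simp: side_def sgn_if)
        qed
        then show ?thesis using False by (intro exI[of _ "sgn (of_int b0)"]) (simp add: sgn_zero_iff)
      next
        case True
        then have "up = int k" "lo = int k" using par b0 cT by linarith+
        note cc = cards'[OF this(1)] cards[OF this(2)]
        have "card {w \<in> A. ccw a b w} = k" by (rule card_sides_orient[OF b(2)[symmetric] aA(3) bA(3) cc])
        then have "{a, b} \<in> X" using halving_in_crossing[OF X(1), of a b] aA bA b(2) unfolding A_def by auto
        then have con: "{a, b} \<in> meets 1 F" using X(2) by blast
        have sw: "p' \<noteq> p"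
          by (rule contact_switches[OF F f g ge aA(2) bA(2) b(2)[symmetric] _ _ con]) (use aA bA in \<open>auto simp: d_def\<close>)
        have pp: "{a, b} = {p, p'}" using uab[of "t - 1"] uab[of "t + 1"] sw by (auto simp: u_def)
        have ptie: "ht p' t = ht p t" using germD(3,4)[OF ge] by simp
        define y0 where "y0 = t - e / 2"
        have y0: "\<bar>y0 - t\<bar> < e" "y0 \<noteq> t" "y0 < t" using e by (auto simp: y0_def)
        define c :: real where "c = (if ht p' y0 < ht p y0 then 1 else - 1)"
        have "side A a0 (f y) y = c" if y: "\<bar>y - t\<bar> < e" "y \<noteq> t" for y
        proof (cases "y < t")
          case left: True
          then have "u y = p" by (simp add: u_def)
          then have "balance A (f y) y = (if ht p' y < ht p y then 1 else - 1)" using bl[OF y, of p'] pp True by simp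
          moreover have "ht p' y < ht p y \<longleftrightarrow> ht p' y0 < ht p y0" using order_side[OF g sw ptie y y0(1,2)] left y0 by simp
          ultimately show ?thesis by (simp add: side_def c_def)
        next
          case right: False
          then have "u y = p'" by (simp add: u_def)
          then have bb: "balance A (f y) y = (if ht p y < ht p' y then 1 else - 1)"
            using bl[OF y, of p] pp True by (simp add: insert_commute)
          have "ht p y \<noteq> ht p' y" using good_generic[OF g y] sw germD(1,2)[OF ge] by (auto simp: inj_on_def)
          moreover have "(ht p' y < ht p y \<longleftrightarrow> ht p' y0 < ht p y0) \<longleftrightarrow> False"
            using order_side[OF g sw ptie y y0(1,2)] right y0 by simp
          ultimately show ?thesis using bb by (auto simp: side_def c_def)
        qed
        moreover have "c \<noteq> 0" by (simp add: c_def)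
        ultimately show ?thesis by blast
      qed
    qed
  qed
  then show False using not_flips_atI[where t = t and f = f and A = A, OF e] fl by blast
qed

lemma contacts_crossing_free:
  assumes F: "net k F" and X: "X \<subseteq> meets 1 F"
  shows "\<not> is_crossing (k + 1) C X"
proof
  assume cr: "is_crossing (k + 1) C X"
  have "X \<noteq> {}" using cr by (auto simp: is_crossing_def)
  then obtain x where x: "x \<in> X" by blast
  have "x \<in> edges C" using x cr by (auto simp: is_crossing_def)
  then obtain x1 x2 where x12: "x = {x1, x2}" unfolding edges_def by blast
  have AC: "\<Union>X \<subseteq> C" and cA: "card (\<Union>X) = 2 * k + 2"
    using crossing_sides[OF cr, of x1 x2] x x12 by auto
  have a0: "x1 \<in> \<Union>X" using x x12 by blast
  have fA: "finite (\<Union>X)" using AC fin_C finite_subset by blast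
  define R where "R f t e a q \<longleftrightarrow> good t e \<and> a \<in> \<Union>X - {x1} \<and> q \<in> C - \<Union>X \<and> ht a t = f t \<and> ht q t = f t \<and>
    card {w \<in> \<Union>X - {x1}. ccw q a w} = k \<and>
    (\<forall>y. \<bar>y - t\<bar> < e \<longrightarrow> y \<noteq> t \<longrightarrow> (ht q y < ht a y \<longleftrightarrow> ht x1 t < f t) \<longrightarrow> f y = ht q y)" for f t e a q
  have R: "\<exists>a q. R f t e a q" if "f \<in> F" "flips_at (\<Union>X) x1 f t" "good t e" for f t e
    unfolding R_def using flips_at_case[OF F that(1) cr X a0 that(2,3)] that(3) by blast
  have "\<exists>t e a q. flips_at (\<Union>X) x1 f t \<and> R f t e a q" if f: "f \<in> F" for f
  proof -
    obtain t where "flips_at (\<Union>X) x1 f t" using flips_at_ex[OF netD(1)[OF F f]] by blast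
    moreover obtain e where "good t e" using good_ex by blast
    ultimately show ?thesis using R[OF f] by blast
  qed
  then obtain tt ee aa qq where *: "\<And>f. f \<in> F \<Longrightarrow> flips_at (\<Union>X) x1 f (tt f) \<and> R f (tt f) (ee f) (aa f) (qq f)"
    by metis
  have "inj_on qq F"
  proof (rule inj_onI)
    fix f h assume fh: "f \<in> F" "h \<in> F" "qq f = qq h"
    define t e a q where "t = tt f" and "e = ee f" and "a = aa f" and "q = qq f"
    have Rf: "R f t e a q" using *[OF fh(1)] by (simp add: t_def e_def a_def q_def)
    have Rh: "R h (tt h) (ee h) (aa h) q" using *[OF fh(2)] fh(3) by (simp add: q_def)
    \<comment> \<open>Both lines pass through \<open>q\<close> and leave \<open>k\<close> of the
      \<open>2k + 1\<close> vertices \<open>\<Union>X - {x1}\<close> on a given side, so they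
      contain the same vertex of this set.\<close>
    have "aa h = a"
      by (rule rank_unique[of "\<Union>X - {x1}" q]) (use Rf Rh AC in \<open>auto simp: R_def\<close>)
    have qa: "q \<noteq> a" using Rf by (auto simp: R_def)
    have "\<exists>m::int. t = tt h + of_int m * pi"
      by (rule ht_tie_unique[of q _ a]) (use Rf Rh qa \<open>aa h = a\<close> in \<open>simp_all add: R_def\<close>)
    then obtain m :: int where m: "t = tt h + of_int m * pi" by blast
    \<comment> \<open>The flip of \<open>h\<close> is moved to the angle \<open>t\<close>, so that
      both curves are described on one neighbourhood.\<close>
    have "flips_at (\<Union>X) x1 h t"
      unfolding m using flips_at_shift[OF netD(1)[OF F fh(2)]] *[OF fh(2)] by blast
    moreover have ge: "good t e" using Rf by (simp add: R_def)
    ultimately obtain a' q' where R': "R h t e a' q'" using R[OF fh(2)] by blast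
    have "h t = (if even m then h (tt h) else - h (tt h))"
      unfolding m by (rule antiperiodic_int) (rule curve_antiper[OF netD(1)[OF F fh(2)]])
    moreover have "ht q t = (if even m then ht q (tt h) else - ht q (tt h))" unfolding m by (rule ht_add_int_pi)
    ultimately have htq: "h t = ht q t" using Rh by (auto simp: R_def split: if_splits)
    have fhq: "f t = ht q t" "ht a t = ht q t" using Rf by (auto simp: R_def)
    have "a' = q \<or> a' = a" "q' = q \<or> q' = a"
      using two_at_tie[of q a a' t "ht q t"] two_at_tie[of q a q' t "ht q t"] Rf R' qa htq fhq AC
      by (auto simp: R_def)
    then have eq: "a' = a" "q' = q" using Rf R' by (auto simp: R_def)
    have e: "0 < e" using ge by (simp add: good_def)
    \<comment> \<open>The order of \<open>q\<close> and \<open>a\<close> reverses at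
      \<open>t\<close>, so on one side of \<open>t\<close> the condition holds under which both
      curves follow \<open>q\<close>. There they agree at an angle without ties.\<close>
    have "(ht q (t - e / 2) < ht a (t - e / 2) \<longleftrightarrow> ht q (t + e / 2) < ht a (t + e / 2)) \<longleftrightarrow> False"
      using order_side[OF ge qa fhq(2)[symmetric], of "t - e / 2" "t + e / 2"] e by simp
    then obtain y where y: "\<bar>y - t\<bar> < e" "y \<noteq> t" "ht q y < ht a y \<longleftrightarrow> ht x1 t < f t"
    proof (cases "ht q (t - e / 2) < ht a (t - e / 2) \<longleftrightarrow> ht x1 t < f t")
      case True then show ?thesis using that[of "t - e / 2"] e by simp
    next
      case False
      assume "(ht q (t - e / 2) < ht a (t - e / 2) \<longleftrightarrow> ht q (t + e / 2) < ht a (t + e / 2)) \<longleftrightarrow> False"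
      then show ?thesis using that[of "t + e / 2"] False e by auto
    qed
    have "f y = ht q y" using Rf y unfolding R_def by blast
    moreover have "h y = ht q y"
    proof -
      have "ht q' y < ht a' y \<longleftrightarrow> ht x1 t < h t" using y(3) eq htq fhq by simp
      then show ?thesis using R' y(1,2) eq unfolding R_def by blast
    qed
    ultimately show "f = h" using netD(3)[OF F good_generic[OF ge y(1,2)] fh(1,2)] by simp
  qed
  moreover have "qq ` F \<subseteq> C - \<Union>X" using * by (auto simp: R_def)
  ultimately have "card F \<le> card (C - \<Union>X)" using fin_C by (metis card_inj_on_le finite_Diff)
  moreover have "card (C - \<Union>X) = n - (2 * k + 2)" using AC cA card_C fA by (simp add: card_Diff_subset)
  moreover have "2 * k + 2 \<le> n" using AC cA card_C card_mono[OF fin_C] by metis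
  ultimately show False using card_net[OF F] by linarith
qed

section \<open>From contact edges to a triangulation\<close>

lemma wedge_dual_points:
  assumes pq: "p \<noteq> q" "ht p t = ht q t"
  shows "wedge (dual_point p) (dual_point q) = mk_line t (ht p t)"
proof -
  note r = represents_dual_point[of p] represents_dual_point[of q]
  have cr: "crossing_at (ht p) (ht q) t"
    unfolding meet_def
  proof (intro conjI exI[of _ pi] ballI)
    fix y z assume "y \<in> {t - pi<..<t}" "z \<in> {t<..<t + pi}"
    then show "0 < - 1 * ((ht p y - ht q y) * (ht p z - ht q z))"
      using ht_tie_swap[OF pq(2,1), of y z] by simp
  qed (use pq in auto)
  have "\<exists>m::int. s' = s + of_int m * pi" if "crossing_at (ht p) (ht q) s" "crossing_at (ht p) (ht q) s'" for s s'
    using that ht_tie_unique[of p s q s'] pq(1) by (auto simp: meet_def)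
  then have "\<exists>!P. crossing_point (dual_point p) (dual_point q) P"
    unfolding ex1_crossing_point_iff[OF r] using cr by blast
  then show ?thesis
    unfolding wedge_def using crossing_point_mk_line[OF r] cr by (intro the1_equality) auto
qed

text \<open>The crossing point of the duals of \<open>p\<close> and \<open>q\<close> is the line
  through both, so contact points of the arrangement correspond to the pairs recorded in
  \<open>meets\<close>.\<close>

lemma primal_edges_eq_meets:
  assumes arr: "pseudoline_arrangement \<Lambda>" and supp: "support \<Lambda> = kernel k"
  defines "F \<equiv> {f. \<exists>L\<in>\<Lambda>. represents f L}"
  shows "primal_edges C \<Lambda> = meets 1 F"
proof -
  have F: "net k F" unfolding F_def by (rule net_of_arrangement[OF arr supp])
  have contact: "arrangement_contact_point \<Lambda> (mk_line t d) \<longleftrightarrow>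
      (\<exists>f\<in>F. \<exists>g\<in>F. f \<noteq> g \<and> f t = d \<and> contact_at f g t)" for t d
  proof
    assume "arrangement_contact_point \<Lambda> (mk_line t d)"
    then obtain L M where LM: "L \<in> \<Lambda>" "M \<in> \<Lambda>" "L \<noteq> M" "contact_point L M (mk_line t d)"
      unfolding arrangement_contact_point_def by blast
    obtain f where f: "represents f L" using arr LM(1) unfolding pseudoline_arrangement_def pseudoline_def by blast
    obtain g where g: "represents g M" using arr LM(2) unfolding pseudoline_arrangement_def pseudoline_def by blast
    obtain s where "mk_line t d = mk_line s (f s)" using LM(4) contact_point_iff[OF f g] by blast
    then have "mk_line t d \<in> L" using mem_represented[OF f, of s "f s"] by simp
    then have d: "d = f t" using mem_represented[OF f] by simp
    then have "contact_at f g t" using LM(4) contact_point_mk_line[OF f g] by simp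
    moreover have "f \<noteq> g" using represents_eq[OF f] g LM(3) by blast
    moreover have "f \<in> F" "g \<in> F" using f g LM by (auto simp: F_def)
    ultimately show "\<exists>f\<in>F. \<exists>g\<in>F. f \<noteq> g \<and> f t = d \<and> contact_at f g t" using d by blast
  next
    assume "\<exists>f\<in>F. \<exists>g\<in>F. f \<noteq> g \<and> f t = d \<and> contact_at f g t"
    then obtain f g where fg: "f \<in> F" "g \<in> F" "f \<noteq> g" "f t = d" "contact_at f g t" by blast
    obtain L where L: "L \<in> \<Lambda>" "represents f L" using fg(1) by (auto simp: F_def)
    obtain M where M: "M \<in> \<Lambda>" "represents g M" using fg(2) by (auto simp: F_def)
    have "L \<noteq> M" using represents_unique[OF L(2)] M(2) fg(3) by blast
    moreover have "contact_point L M (mk_line t d)"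
      using contact_point_mk_line[OF L(2) M(2), of t] fg(4,5) by simp
    ultimately show "arrangement_contact_point \<Lambda> (mk_line t d)"
      using L(1) M(1) unfolding arrangement_contact_point_def by blast
  qed
  show ?thesis
  proof
    show "primal_edges C \<Lambda> \<subseteq> meets 1 F"
    proof
      fix x assume "x \<in> primal_edges C \<Lambda>"
      then obtain p q where pq: "x = {p, q}" "p \<in> C" "q \<in> C" "p \<noteq> q"
        "arrangement_contact_point \<Lambda> (wedge (dual_point p) (dual_point q))"
        unfolding primal_edges_def by blast
      obtain t where t: "ht p t = ht q t" using ht_tie_ex by blast
      obtain f g where fg: "f \<in> F" "g \<in> F" "f \<noteq> g" "f t = ht p t" "contact_at f g t"
        using pq(5) unfolding wedge_dual_points[OF pq(4) t] contact by blast
      have "x = on_line t (f t)"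
        unfolding pq(1) fg(4) by (rule on_line_pair[OF pq(2-4) refl t[symmetric], symmetric])
      then show "x \<in> meets 1 F" using fg unfolding meets_def by blast
    qed
    show "meets 1 F \<subseteq> primal_edges C \<Lambda>"
    proof
      fix x assume "x \<in> meets 1 F"
      then obtain f g t where fg: "x = on_line t (f t)" "f \<in> F" "g \<in> F" "f \<noteq> g" "contact_at f g t"
        unfolding meets_def by blast
      have "f t = g t" using fg(5) by (simp add: meet_def)
      then obtain p q where pq: "p \<in> C" "q \<in> C" "p \<noteq> q" "ht p t = f t" "ht q t = f t" "on_line t (f t) = {p, q}"
        using net_meet_relevant[OF F fg(2-4)] by blast
      have "wedge (dual_point p) (dual_point q) = mk_line t (f t)"
        using wedge_dual_points[OF pq(3), of t] pq(4,5) by simp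
      moreover have "arrangement_contact_point \<Lambda> (mk_line t (f t))"
        unfolding contact using fg(2-5) by blast
      ultimately have "arrangement_contact_point \<Lambda> (wedge (dual_point p) (dual_point q))" by simp
      then show "x \<in> primal_edges C \<Lambda>" using pq fg(1) unfolding primal_edges_def by blast
    qed
  qed
qed

lemma extend_to_triangulation:
  assumes E: "E \<subseteq> edges C" "crossing_free (k + 1) C E"
  shows "\<exists>T. E \<subseteq> T \<and> k_triangulation k C T"
proof -
  define \<T> where "\<T> = {T. E \<subseteq> T \<and> T \<subseteq> edges C \<and> crossing_free (k + 1) C T}"
  have fin: "finite \<T>" by (rule finite_subset[of _ "Pow (edges C)"]) (auto simp: \<T>_def finite_edges)
  have "E \<in> \<T>" using E by (simp add: \<T>_def)
  from finite_has_maximal2[OF fin this]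
  obtain T where T: "T \<in> \<T>" "E \<subseteq> T" "\<forall>T'\<in>\<T>. T \<subseteq> T' \<longrightarrow> T = T'" by (elim bexE conjE)
  have max: "T' = T" if "T \<subseteq> T'" "T' \<subseteq> edges C" "crossing_free (k + 1) C T'" for T'
  proof -
    have "T' \<in> \<T>" unfolding \<T>_def mem_Collect_eq using that T(2) order_trans by metis
    then show ?thesis using T(3) that(1) by metis
  qed
  have "T \<subseteq> edges C \<and> crossing_free (k + 1) C T" using T(1) by (simp add: \<T>_def)
  then have "k_triangulation k C T" using max unfolding k_triangulation_def by metis
  then show ?thesis using T(2) by blast
qed

lemma not_relevant_short:
  assumes "e \<in> edges C" "e \<notin> relevant k"
  shows "e \<in> short_edges k C"
proof -
  obtain p q where pq: "e = {p, q}" "p \<in> C" "q \<in> C" "p \<noteq> q" using assms(1) unfolding edges_def by blast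
  then have "card {r \<in> C. ccw p q r} < k \<or> card {r \<in> C. ccw q p r} < k"
  proof -
    have "\<not> (k \<le> card {r \<in> C. ccw p q r} \<and> k \<le> card {r \<in> C. ccw q p r})"
      using assms(2) pq unfolding relevant_def by blast
    then show ?thesis by linarith
  qed
  moreover have "e = {q, p}" using pq(1) by (simp add: insert_commute)
  ultimately show ?thesis using pq unfolding short_edges_def by blast
qed

theorem triangulation_of_arrangement:
  assumes k: "1 \<le> k" and arr: "pseudoline_arrangement \<Lambda>"
    and supp: "support \<Lambda> = remove_levels k (support (dual_points C))"
  shows "k_triangulation k C (primal_edges C \<Lambda> \<union> short_edges k C)"
proof -
  have supp': "support \<Lambda> = kernel k" using supp remove_levels_eq_kernel by simp
  define F where "F = {f. \<exists>L\<in>\<Lambda>. represents f L}"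
  have F: "net k F" "cross_once F" unfolding F_def by (rule net_of_arrangement[OF arr supp'])+
  have prim: "primal_edges C \<Lambda> = meets 1 F" unfolding F_def by (rule primal_edges_eq_meets[OF arr supp'])
  define E where "E = meets 1 F \<union> short_edges k C"
  have rel: "relevant k \<subseteq> edges C" unfolding relevant_def edges_def by blast
  have "short_edges k C \<subseteq> edges C" unfolding short_edges_def edges_def by blast
  then have EC: "E \<subseteq> edges C" using relevant_eq_meets[OF F(1)] rel unfolding E_def by blast
  have "crossing_free (k + 1) C E"
    unfolding crossing_free_def
  proof
    assume "\<exists>X\<subseteq>E. is_crossing (k + 1) C X"
    then obtain X where X: "X \<subseteq> E" "is_crossing (k + 1) C X" by blast
    then have "X \<subseteq> meets 1 F" using short_not_in_crossing[OF X(2)] unfolding E_def by blast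
    then show False using contacts_crossing_free[OF F(1)] X(2) by blast
  qed
  then obtain T where T: "E \<subseteq> T" "k_triangulation k C T" using extend_to_triangulation[OF EC] by blast
  let ?G = "med k ` stars k T"
  have G: "net k ?G" "cross_once ?G" using net_stars[OF T(2) k] cross_once_stars[OF T(2) k] by auto
  \<comment> \<open>Relevant edges are contacts or crossings of the star net; \<open>T\<close>
    contains all of the former and none of the latter.\<close>
  have TG: "T \<inter> relevant k = meets 1 ?G"
    using stars_meets[OF T(2) k] relevant_eq_meets[OF G(1)] by blast
  have "meets 1 F \<subseteq> meets 1 ?G"
    using T(1) relevant_eq_meets[OF F(1)] unfolding TG[symmetric] E_def by blast
  moreover have "finite (meets 1 ?G)"
    using finite_relevant[of k] unfolding TG[symmetric] by blast
  ultimately have eq: "meets 1 F = meets 1 ?G"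
    using card_contacts_eq[OF F G] by (intro card_subset_eq) auto
  have "T \<subseteq> E"
  proof
    fix e assume e: "e \<in> T"
    show "e \<in> E"
    proof (cases "e \<in> relevant k")
      case True
      then have "e \<in> meets 1 ?G" using e unfolding TG[symmetric] by blast
      then show ?thesis unfolding E_def eq by blast
    next
      case False
      have "e \<in> edges C" using e k_triangulation_edges[OF T(2)] by blast
      then show ?thesis using not_relevant_short False unfolding E_def by blast
    qed
  qed
  then have "T = E" using T(1) by blast
  then show ?thesis using T(2) unfolding prim E_def by simp
qed

end

theorem theorem23:
  fixes C :: "complex set" and n k :: nat
  assumes "convex_ngon_vertices n C" and "1 \<le> k"
  shows
    "(\<forall>T. k_triangulation k C T \<longrightarrow>
        pseudoline_arrangement (dual_arrangement k C T) \<and>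
        support (dual_arrangement k C T) = remove_levels k (support (dual_points C))) \<and>
     (\<forall>\<Lambda>. pseudoline_arrangement \<Lambda> \<and>
        support \<Lambda> = remove_levels k (support (dual_points C)) \<longrightarrow>
        k_triangulation k C (primal_edges C \<Lambda> \<union> short_edges k C))"
proof -
  interpret ngon C n by standard (rule assms(1))
  show ?thesis
    using dual_arrangement_of_triangulation[OF _ assms(2)] triangulation_of_arrangement[OF assms(2)] by blast
qed

end
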